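(* Let $\alpha+\beta>0$ and $\gamma+\delta_{in}>0$, and let $\varepsilon>0$ be arbitrarily small. Let $d=d(t)$ be any function of $t$ with non-negative integer values. Let $n_{in}(t,d)$ be the number of vertices of in-degree $d$ in the random graph $\mathcal G(t)$ with parameters $\alpha,\beta,\gamma,\delta_{in},\delta_{out},G_0$. Then $$\left|n_{in}(t,d)-\overline{f_d}\,t\right|\le\left(\sqrt{\overline{f_d}\,t}+(d+1)^{-\frac12+\varepsilon}\right)\ln t$$ with probability tending to $1$ as $t\to\infty$. Here $\overline{c}_{in}=\frac{1-\gamma}{1+\delta_{in}(\alpha+\gamma)}$, $\overline{f_0}=\frac{\alpha}{1+\delta_{in}\overline{c}_{in}}$, and for $d\ge1$ $$\overline{f_d}=C_{in}\frac{\Gamma(d+\delta_{in})}{\Gamma\left(d+\delta_{in}+1+\frac1{\overline{c}_{in}}\right)},\qquad C_{in}=\frac{\Gamma\left(\delta_{in}+\frac1{\overline{c}_{in}}\right)}{\Gamma(1+\delta_{in})}\cdot\frac{1-\overline{c}_{in}}{\overline{c}_{in}^2}.$$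
   Context: The model $\mathcal G(t)$. Parameters: $\alpha,\beta,\gamma\in[0,1]$ with $\alpha+\beta+\gamma=1$; reals $\delta_{in}\ge0$, $\delta_{out}\ge0$; a fixed finite directed graph $G_0$ (loops and multiple edges allowed) with at least one vertex, and with at least one edge if $\delta_{in}=0$ or $\delta_{out}=0$. Standing assumption: $\alpha+\gamma>0$. Let $t_0$ be the number of edges of $G_0$. At time $t_0$ the random graph is $G_0$. Given the random graph $G$ at time $t\ge t_0$ (it has $t$ edges; let $n$ be its current number of vertices, $d_{in},d_{out}$ its in- and out-degrees), the graph at time $t+1$ is obtained by one of the following, chosen independently of the past: ($\dagger$) with probability $\alpha$, add a new vertex $v$ and an edge from $v$ to an existing vertex $w\in G$ chosen with probability $\frac{d_{in}(w)+\delta_{in}}{t+\delta_{in}n}$; ($\dagger\dagger$) with probability $\beta$, add an edge from $v\in G$ to $w\in G$, where $v$ is chosen with probability $\frac{d_{out}(v)+\delta_{out}}{t+\delta_{out}n}$ and, independently, $w$ with probability $\frac{d_{in}(w)+\delta_{in}}{t+\delta_{in}n}$; ($\ddagger$) with probability $\gamma$, add a new vertex $w$ and an edge to $w$ from an existing vertex $v\in G$ chosen with probability $\frac{d_{out}(v)+\delta_{out}}{t+\delta_{out}n}$. $\mathcal G(t)$ denotes the random graph at time $t$. Under the hypotheses, $0<\overline{c}_{in}<1$. *)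

theory Defs
  imports
    "HOL-Library.Infinite_Typeclass"
    "HOL-Probability.Probability"
    "Graph_Theory.Digraph"
begin

text \<open>
  Finite directed graphs with loops and parallel arcs are the \<^locale>\<open>fin_digraph\<close>s; degrees are
  \<^const>\<open>in_degree\<close> and \<^const>\<open>out_degree\<close>, so a loop counts once in each.  The types of vertex and
  arc names are infinite, so that new names are always available; which new name is taken is
  irrelevant.
\<close>

definition fresh :: "'a::infinite set \<Rightarrow> 'a" where
  "fresh A = (SOME x. x \<notin> A)"

definition new_arc :: "('a, 'b::infinite) pre_digraph \<Rightarrow> 'a \<Rightarrow> 'a \<Rightarrow> ('a, 'b) pre_digraph" where
  "new_arc G v w =
     (let e = fresh (arcs G)
      in \<lparr> verts = verts G \<union> {v, w}, arcs = insert e (arcs G),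
           tail = (tail G)(e := v), head = (head G)(e := w) \<rparr>)"

text \<open>
  Preferential choice of a vertex. Both degrees sum to the number of arcs, which is why
  the following weights sum to \<open>1\<close> (see \<open>pmf_choose_in\<close> and \<open>pmf_choose_out\<close> below).
\<close>

definition choose_vertex ::
    "(('a, 'b) pre_digraph \<Rightarrow> 'a \<Rightarrow> nat) \<Rightarrow> real \<Rightarrow> ('a, 'b) pre_digraph \<Rightarrow> 'a pmf" where
  "choose_vertex deg \<delta> G = embed_pmf (\<lambda>v. if v \<in> verts G
     then (real (deg G v) + \<delta>) / (real (card (arcs G)) + \<delta> * real (card (verts G))) else 0)"

abbreviation choose_in :: "real \<Rightarrow> ('a, 'b) pre_digraph \<Rightarrow> 'a pmf" where
  "choose_in \<equiv> choose_vertex in_degree"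

abbreviation choose_out :: "real \<Rightarrow> ('a, 'b) pre_digraph \<Rightarrow> 'a pmf" where
  "choose_out \<equiv> choose_vertex out_degree"

datatype step_kind = From_New | Between_Old | To_New

definition step_kind_pmf :: "real \<Rightarrow> real \<Rightarrow> real \<Rightarrow> step_kind pmf" where
  "step_kind_pmf \<alpha> \<beta> \<gamma> = pmf_of_list [(From_New, \<alpha>), (Between_Old, \<beta>), (To_New, \<gamma>)]"

definition graph_step :: "real \<Rightarrow> real \<Rightarrow> real \<Rightarrow> real \<Rightarrow> real \<Rightarrow>
    ('a::infinite, 'b::infinite) pre_digraph \<Rightarrow> ('a, 'b) pre_digraph pmf" where
  "graph_step \<alpha> \<beta> \<gamma> \<delta>_in \<delta>_out G =
     bind_pmf (step_kind_pmf \<alpha> \<beta> \<gamma>) (\<lambda>k. case k of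
       From_New \<Rightarrow> map_pmf (\<lambda>w. new_arc G (fresh (verts G)) w) (choose_in \<delta>_in G)
     | Between_Old \<Rightarrow> map_pmf (\<lambda>(v, w). new_arc G v w)
                        (pair_pmf (choose_out \<delta>_out G) (choose_in \<delta>_in G))
     | To_New \<Rightarrow> map_pmf (\<lambda>v. new_arc G v (fresh (verts G))) (choose_out \<delta>_out G))"

text \<open>
  The law of the random graph at time \<open>t\<close>. The process starts with \<open>G0\<close> at time
  \<open>t0 = card (arcs G0)\<close>; for \<open>t < t0\<close> truncated subtraction yields the junk value \<open>G0\<close>.
\<close>

definition random_graph :: "real \<Rightarrow> real \<Rightarrow> real \<Rightarrow> real \<Rightarrow> real \<Rightarrow>
    ('a::infinite, 'b::infinite) pre_digraph \<Rightarrow> nat \<Rightarrow> ('a, 'b) pre_digraph pmf" where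
  "random_graph \<alpha> \<beta> \<gamma> \<delta>_in \<delta>_out G0 t =
     ((\<lambda>p. bind_pmf p (graph_step \<alpha> \<beta> \<gamma> \<delta>_in \<delta>_out)) ^^ (t - card (arcs G0))) (return_pmf G0)"

definition n_in :: "('a, 'b) pre_digraph \<Rightarrow> nat \<Rightarrow> nat" where
  "n_in G d = card {v \<in> verts G. in_degree G v = d}"

definition c_in :: "real \<Rightarrow> real \<Rightarrow> real \<Rightarrow> real" where
  "c_in \<alpha> \<gamma> \<delta>_in = (1 - \<gamma>) / (1 + \<delta>_in * (\<alpha> + \<gamma>))"

definition C_in :: "real \<Rightarrow> real \<Rightarrow> real \<Rightarrow> real" where
  "C_in \<alpha> \<gamma> \<delta>_in =
     (let c = c_in \<alpha> \<gamma> \<delta>_in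
      in Gamma (\<delta>_in + 1 / c) / Gamma (1 + \<delta>_in) * ((1 - c) / c\<^sup>2))"

definition f_bar :: "real \<Rightarrow> real \<Rightarrow> real \<Rightarrow> nat \<Rightarrow> real" where
  "f_bar \<alpha> \<gamma> \<delta>_in d =
     (let c = c_in \<alpha> \<gamma> \<delta>_in
      in if d = 0 then \<alpha> / (1 + \<delta>_in * c)
         else C_in \<alpha> \<gamma> \<delta>_in * (Gamma (real d + \<delta>_in) / Gamma (real d + \<delta>_in + 1 + 1 / c)))"

lemma fresh_notin: "finite A \<Longrightarrow> fresh A \<notin> A"
  unfolding fresh_def by (rule someI_ex) (rule ex_new_if_finite[OF infinite_UNIV])

lemma pmf_step_kind:
  assumes "0 \<le> \<alpha>" "0 \<le> \<beta>" "0 \<le> \<gamma>" "\<alpha> + \<beta> + \<gamma> = 1"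
  shows "pmf (step_kind_pmf \<alpha> \<beta> \<gamma>) From_New = \<alpha>"
    and "pmf (step_kind_pmf \<alpha> \<beta> \<gamma>) Between_Old = \<beta>"
    and "pmf (step_kind_pmf \<alpha> \<beta> \<gamma>) To_New = \<gamma>"
proof -
  have "pmf_of_list_wf [(From_New, \<alpha>), (Between_Old, \<beta>), (To_New, \<gamma>)]"
    using assms by (auto simp: pmf_of_list_wf_def)
  then show "pmf (step_kind_pmf \<alpha> \<beta> \<gamma>) From_New = \<alpha>"
    and "pmf (step_kind_pmf \<alpha> \<beta> \<gamma>) Between_Old = \<beta>"
    and "pmf (step_kind_pmf \<alpha> \<beta> \<gamma>) To_New = \<gamma>"
    by (simp_all add: step_kind_pmf_def pmf_pmf_of_list)
qed

lemma pmf_choose_vertex: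
  assumes fin: "finite (verts G)" and "0 \<le> \<delta>"
    and deg: "(\<Sum>v\<in>verts G. deg G v) = card (arcs G)"
    and pos: "0 < real (card (arcs G)) + \<delta> * real (card (verts G))"
  shows "pmf (choose_vertex deg \<delta> G) v = (if v \<in> verts G
     then (real (deg G v) + \<delta>) / (real (card (arcs G)) + \<delta> * real (card (verts G))) else 0)"
  unfolding choose_vertex_def
proof (rule pmf_embed_pmf)
  let ?T = "real (card (arcs G)) + \<delta> * real (card (verts G))"
  let ?f = "\<lambda>v. if v \<in> verts G then (real (deg G v) + \<delta>) / ?T else 0"
  show nn: "0 \<le> ?f v" for v
    using assms by simp
  have sum1: "(\<Sum>v\<in>verts G. ?f v) = 1"
  proof -
    have "(\<Sum>v\<in>verts G. ?f v) = (\<Sum>v\<in>verts G. real (deg G v) + \<delta>) / ?T"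
      by (simp add: sum_divide_distrib)
    also have "(\<Sum>v\<in>verts G. real (deg G v) + \<delta>) = ?T"
      by (simp add: sum.distrib mult.commute flip: deg)
    finally show ?thesis using pos by simp
  qed
  have "(\<integral>\<^sup>+v. ennreal (?f v) \<partial>count_space UNIV) = (\<Sum>v\<in>verts G. ennreal (?f v))"
    using fin by (intro nn_integral_count_space') auto
  also have "\<dots> = ennreal (\<Sum>v\<in>verts G. ?f v)"
    using nn by (rule sum_ennreal)
  finally show "(\<integral>\<^sup>+v. ennreal (?f v) \<partial>count_space UNIV) = 1"
    by (simp only: sum1 ennreal_1)
qed

lemma sum_in_degree:
  assumes "fin_digraph G"
  shows "(\<Sum>v\<in>verts G. in_degree G v) = card (arcs G)"
proof -
  interpret fin_digraph G by fact
  have "(\<Sum>v\<in>verts G. card (in_arcs G v)) = card (\<Union>v\<in>verts G. in_arcs G v)"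
    by (rule card_UN_disjoint[symmetric]) (auto simp: in_arcs_def)
  also have "(\<Union>v\<in>verts G. in_arcs G v) = arcs G"
    by (auto simp: in_arcs_def)
  finally show ?thesis by (simp add: in_degree_def)
qed

lemma sum_out_degree:
  assumes "fin_digraph G"
  shows "(\<Sum>v\<in>verts G. out_degree G v) = card (arcs G)"
proof -
  interpret fin_digraph G by fact
  have "(\<Sum>v\<in>verts G. card (out_arcs G v)) = card (\<Union>v\<in>verts G. out_arcs G v)"
    by (rule card_UN_disjoint[symmetric]) (auto simp: out_arcs_def)
  also have "(\<Union>v\<in>verts G. out_arcs G v) = arcs G"
    by (auto simp: out_arcs_def)
  finally show ?thesis by (simp add: out_degree_def)
qed

lemma total_weight_pos:
  assumes "fin_digraph G" "verts G \<noteq> {}" "0 \<le> \<delta>" "\<delta> = 0 \<Longrightarrow> arcs G \<noteq> {}"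
  shows "0 < real (card (arcs G)) + \<delta> * real (card (verts G))"
proof -
  interpret fin_digraph G by fact
  show ?thesis
  proof (cases "\<delta> = 0")
    case True
    then show ?thesis using assms(4) by (simp add: card_gt_0_iff)
  next
    case False
    then show ?thesis using assms(2,3) by (simp add: add_nonneg_pos card_gt_0_iff)
  qed
qed

lemma pmf_choose_in:
  assumes "fin_digraph G" "verts G \<noteq> {}" "0 \<le> \<delta>" "\<delta> = 0 \<Longrightarrow> arcs G \<noteq> {}" "v \<in> verts G"
  shows "pmf (choose_in \<delta> G) v =
    (real (in_degree G v) + \<delta>) / (real (card (arcs G)) + \<delta> * real (card (verts G)))"
  using assms total_weight_pos[OF assms(1-4)]
  by (simp add: pmf_choose_vertex sum_in_degree fin_digraph.finite_verts)

lemma pmf_choose_out: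
  assumes "fin_digraph G" "verts G \<noteq> {}" "0 \<le> \<delta>" "\<delta> = 0 \<Longrightarrow> arcs G \<noteq> {}" "v \<in> verts G"
  shows "pmf (choose_out \<delta> G) v =
    (real (out_degree G v) + \<delta>) / (real (card (arcs G)) + \<delta> * real (card (verts G)))"
  using assms total_weight_pos[OF assms(1-4)]
  by (simp add: pmf_choose_vertex sum_out_degree fin_digraph.finite_verts)

end

theory Submission
  imports Defs "HOL-Real_Asymp.Real_Asymp"
begin

text \<open>
  Condition on the sequence of step kinds. Then the total weight \<open>W = t + \<delta>_in n\<close> is deterministic,
  and two facts suffice. First, the number of vertices of in-degree \<open>d\<close> has conditional variance at
  most twice its conditional mean; this follows by induction on time for arbitrary sums
  \<open>\<Sum>v. h (in_degree v)\<close>, because one step contributes at most twice the sum over the vertices of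
  the variance increments of \<open>h\<close>. Secondly, the conditional means solve a linear recursion with
  nonnegative coefficients. Since \<open>f_bar d * W / w\<close>, where \<open>w\<close> is the mean increment of \<open>W\<close>, solves
  it up to centred noise, summation by parts reduces the error to a sum over times \<open>r\<close> of perturbations
  of size \<open>r powr (- 1 / 2)\<close> with profile \<open>f_bar\<close>. The effect of such a perturbation on the count at
  time \<open>t\<close> is bounded by its mass and by \<open>f_bar d * t / r\<close>; using the former for
  \<open>r \<le> f_bar d * t\<close> and the latter beyond gives \<open>O(sqrt (f_bar d * t))\<close>, up to the factor by which
  the step counts deviate, which by Hoeffding's inequality is \<open>o(ln t)\<close>. The theorem then follows
  from Chebyshev's inequality if \<open>f_bar d * t\<close> is large and from Markov's inequality otherwise.
\<close>

section \<open>The limit sequence\<close>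

text \<open>Since \<open>d\<close> may depend on \<open>t\<close> in any way, every constant must be
  uniform in the degree. Hence all errors are measured against one profile, \<open>majorant\<close>,
  and the variance is compared with the mean: a bounded-difference inequality would give
  fluctuations of order \<open>sqrt t\<close> for every degree. The coefficient
  \<open>1 - rate * (k + \<delta>)\<close> of the mean recursion is negative for large
  \<open>k\<close>, so comparison works only up to a moving \<open>frontier\<close> that bounds the
  in-degrees; above it the means vanish, and what enters there is controlled by the finite first
  moment of \<open>majorant\<close>. Deviations of the step counts are measured on two scales:
  \<open>L * i powr (3 / 4)\<close> with fixed \<open>L\<close> holds at all times with probability
  close to 1 and yields constants free of \<open>N\<close>, while the sharper
  \<open>fluctuation N * sqrt i\<close> enters the estimate of the means as a linear factor.
  \<open>flux\<close> is the forward operator of the pure birth process in which a vertex of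
  in-degree \<open>k\<close> moves up at speed \<open>k + \<delta>\<close>.\<close>

definition flux :: "real \<Rightarrow> (nat \<Rightarrow> real) \<Rightarrow> nat \<Rightarrow> real" where
  "flux \<delta> v k = (if k = 0 then 0 else (real k - 1 + \<delta>) * v (k - 1)) - (real k + \<delta>) * v k"

lemma flux_0 [simp]: "flux \<delta> v 0 = - \<delta> * v 0"
  by (simp add: flux_def)

lemma flux_Suc [simp]: "flux \<delta> v (Suc k) = (real k + \<delta>) * v k - (real k + 1 + \<delta>) * v (Suc k)"
  by (simp add: flux_def)

lemma flux_add: "flux \<delta> (\<lambda>k. u k + v k) k = flux \<delta> u k + flux \<delta> v k"
  by (simp add: flux_def algebra_simps)

lemma flux_diff: "flux \<delta> (\<lambda>k. u k - v k) k = flux \<delta> u k - flux \<delta> v k"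
  by (simp add: flux_def algebra_simps)

lemma flux_cmult: "flux \<delta> (\<lambda>k. r * v k) k = r * flux \<delta> v k"
  by (simp add: flux_def algebra_simps)

locale attachment =
  fixes \<alpha> \<beta> \<gamma> \<delta> :: real and t0 n0 :: nat
  assumes \<alpha>: "0 \<le> \<alpha>" and \<beta>: "0 \<le> \<beta>" and \<gamma>: "0 \<le> \<gamma>" and sum1: "\<alpha> + \<beta> + \<gamma> = 1"
    and \<delta>: "0 \<le> \<delta>"
    and \<alpha>\<gamma>: "\<alpha> + \<gamma> > 0" and \<alpha>\<beta>: "\<alpha> + \<beta> > 0" and \<gamma>\<delta>: "\<gamma> + \<delta> > 0"
    and W0: "0 < real t0 + \<delta> * real n0"
begin

definition w :: real where "w = 1 + \<delta> * (\<alpha> + \<gamma>)"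
text \<open>At a late time \<open>t\<close> a vertex of in-degree \<open>k\<close> receives the next
  arc with probability about \<open>c * (k + \<delta>) / t\<close>: the weight is about
  \<open>w * t\<close>, and a fraction \<open>1 - \<gamma>\<close> of the steps attach to an old
  vertex.\<close>

definition c :: real where "c = c_in \<alpha> \<gamma> \<delta>"
definition f :: "nat \<Rightarrow> real" where "f = f_bar \<alpha> \<gamma> \<delta>"

text \<open>
  \<open>f 0\<close> vanishes when \<open>\<alpha> = 0\<close>; raising it keeps the supersolution property \<open>flux_majorant_le\<close>.
\<close>
definition majorant :: "nat \<Rightarrow> real" where
  "majorant k = (if k = 0 then max (f 0) (f 1) else f k)"

lemma w_ge_1: "1 \<le> w"
  using \<delta> \<alpha>\<gamma> by (simp add: w_def)

lemma w_pos: "0 < w"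
  using w_ge_1 by simp

lemma \<gamma>_less_1: "\<gamma> < 1"
  using sum1 \<alpha>\<beta> by simp

lemma c_eq: "c = (1 - \<gamma>) / w"
  by (simp add: c_def c_in_def w_def)

lemma c_w: "c * w = 1 - \<gamma>"
  using w_pos by (simp add: c_eq)

lemma c_pos: "0 < c"
  using \<gamma>_less_1 w_pos by (simp add: c_eq)

text \<open>\<open>(1 - c) * w\<close> equals \<gamma> + \<delta> * (\<alpha> + \<gamma>). As
  \<open>f\<close> decays with exponent \<open>1 + 1 / c\<close>, this is what makes its first
  moment finite.\<close>

lemma c_less_1: "c < 1"
proof -
  have "0 < \<gamma> + \<delta> * (\<alpha> + \<gamma>)"
  proof (cases "\<gamma> = 0")
    case True
    then show ?thesis using \<alpha>\<gamma> \<gamma>\<delta> by simp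
  next
    case False
    then show ?thesis using \<gamma> \<delta> \<alpha>\<gamma> by (simp add: add_pos_nonneg)
  qed
  then show ?thesis using w_pos by (simp add: c_eq w_def)
qed

section \<open>Recursion and positivity of the limit sequence\<close>

lemma f_0: "(1 + c * \<delta>) * f 0 = \<alpha>"
  using c_pos \<delta> by (simp add: f_def f_bar_def c_def[symmetric] add_nonneg_eq_0_iff mult.commute
      add_pos_nonneg less_imp_neq[THEN not_sym])

lemma f_1: "f 1 = (1 - c) / ((1 + c * \<delta>) * (1 + c * (1 + \<delta>)))"
proof -
  let ?z = "\<delta> + 1 / c"
  have z: "0 < ?z" using c_pos \<delta> by (simp add: add_nonneg_pos)
  have g: "Gamma (1 + \<delta> + 1 + 1 / c) = (?z + 1) * (?z * Gamma ?z)"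
    using Gamma_plus1[of "?z"] Gamma_plus1[of "?z + 1"] z nonpos_Ints_nonpos[of ?z]
      nonpos_Ints_nonpos[of "?z + 1"] by (force simp: add_ac)
  have G: "Gamma ?z > 0" "Gamma (1 + \<delta>) > 0"
    using z \<delta> by (auto intro!: Gamma_real_pos)
  have "f 1 = Gamma ?z / Gamma (1 + \<delta>) * ((1 - c) / c\<^sup>2)
      * (Gamma (1 + \<delta>) / ((?z + 1) * (?z * Gamma ?z)))"
    using g by (simp add: f_def f_bar_def C_in_def Let_def c_def[symmetric])
  also have "\<dots> = (1 - c) / ((c * ?z) * (c * (?z + 1)))"
  proof -
    have "A / B * ((1 - c) / c\<^sup>2) * (B / ((y + 1) * (y * A))) = (1 - c) / ((c * y) * (c * (y + 1)))"
      if "A > 0" "B > 0" "y > 0" for A B y :: real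
      using that c_pos by (simp add: divide_simps power2_eq_square)
    from this[OF G z] show ?thesis .
  qed
  also have "c * ?z = 1 + c * \<delta>" using c_pos by (simp add: field_simps)
  also have "c * (?z + 1) = 1 + c * (1 + \<delta>)" using c_pos by (simp add: field_simps)
  finally show ?thesis .
qed

text \<open>The normalisation \<open>C_in\<close> is exactly what fits this boundary equation, in
  which the inflow from degree 0 meets the births at degree 1. It comes down to \<open>1 - c = c *
  \<delta> * \<alpha> + \<gamma> * (1 + c * \<delta>)\<close>, a rearrangement of
  \<open>c * w = 1 - \<gamma>\<close>.\<close>

lemma f_1_rec: "(1 + c * (1 + \<delta>)) * f 1 = c * \<delta> * f 0 + \<gamma>"
proof -
  have p: "1 + c * \<delta> > 0" "1 + c * (1 + \<delta>) > 0" using c_pos \<delta> by (auto simp: add_pos_nonneg)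
  have f0: "f 0 = \<alpha> / (1 + c * \<delta>)" using f_0 p by (simp add: field_simps)
  have "1 - c = c * \<delta> * \<alpha> + \<gamma> * (1 + c * \<delta>)"
    using c_w by (simp add: w_def algebra_simps)
  then have "(1 - c) / (1 + c * \<delta>) = c * \<delta> * f 0 + \<gamma>"
    using p by (simp add: f0 field_simps)
  moreover have "(1 + c * (1 + \<delta>)) * f 1 = (1 - c) / (1 + c * \<delta>)"
    unfolding f_1 using p by simp
  ultimately show ?thesis by simp
qed

lemma f_Suc_rec:
  assumes "1 \<le> k"
  shows "(1 + c * (real k + 1 + \<delta>)) * f (Suc k) = c * (real k + \<delta>) * f k"
proof -
  have p: "real k + \<delta> > 0" "real k + \<delta> + 1 + 1 / c > 0" using assms \<delta> c_pos by (auto simp: add_nonneg_pos)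
  have g1: "Gamma (real (Suc k) + \<delta>) = (real k + \<delta>) * Gamma (real k + \<delta>)"
    using Gamma_plus1[of "real k + \<delta>"] p nonpos_Ints_nonpos[of "real k + \<delta>"] by (force simp: add_ac)
  have g2: "Gamma (real (Suc k) + \<delta> + 1 + 1 / c)
      = (real k + \<delta> + 1 + 1 / c) * Gamma (real k + \<delta> + 1 + 1 / c)"
    using Gamma_plus1[of "real k + \<delta> + 1 + 1 / c"] p
      nonpos_Ints_nonpos[of "real k + \<delta> + 1 + 1 / c"] by (force simp: add_ac)
  have e: "1 + c * (real k + 1 + \<delta>) = c * (real k + \<delta> + 1 + 1 / c)"
    using c_pos by (simp add: field_simps)
  show ?thesis
    using assms p unfolding e f_def f_bar_def Let_def c_def[symmetric] g1 g2 by simp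
qed

lemma f_0_nonneg: "0 \<le> f 0"
  using f_0 \<alpha> c_pos \<delta> by (metis add_pos_nonneg less_eq_real_def mult_nonneg_nonneg zero_le_mult_iff
      zero_less_one not_le)

lemma f_pos: "1 \<le> k \<Longrightarrow> 0 < f k"
proof (induction k rule: dec_induct)
  case base
  have p: "1 + c * \<delta> > 0" "1 + c * (1 + \<delta>) > 0" using c_pos \<delta> by (auto simp: add_pos_nonneg)
  then show ?case using c_less_1 unfolding f_1 by simp
next
  case (step k)
  have "0 < c * (real k + \<delta>) * f k" using step c_pos \<delta> by (simp add: add_pos_nonneg)
  then have "0 < (1 + c * (real k + 1 + \<delta>)) * f (Suc k)" using f_Suc_rec step by simp
  moreover have "1 + c * (real k + 1 + \<delta>) > 0" using c_pos \<delta> by (simp add: add_pos_nonneg)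
  ultimately show ?case by (simp add: zero_less_mult_iff)
qed

lemma f_nonneg: "0 \<le> f k"
  using f_pos[of k] f_0_nonneg by (cases k) auto

text \<open>Stationarity of the profile: with rate \<open>c / t\<close> and mean births \<alpha> at
  0 and \<gamma> at 1, \<open>f k * t\<close> grows by exactly \<open>f k\<close> in each
  step.\<close>

lemma f_balance: "f k = c * flux \<delta> f k + \<alpha> * of_bool (k = 0) + \<gamma> * of_bool (k = 1)"
proof (cases k)
  case 0
  then show ?thesis using f_0 by (simp add: algebra_simps)
next
  case (Suc j)
  show ?thesis
  proof (cases "j = 0")
    case True
    then show ?thesis using f_1_rec Suc by (simp add: algebra_simps)
  next
    case False
    then show ?thesis using f_Suc_rec[of j] Suc by (simp add: algebra_simps)
  qed
qed

section \<open>The majorant and its first moment\<close>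

lemma f_le_majorant: "f k \<le> majorant k"
  by (simp add: majorant_def)

lemma majorant_pos: "0 < majorant k"
  using f_pos[of 1] f_pos[of k] by (auto simp: majorant_def less_max_iff_disj)

text \<open>For comparison: a bound \<open>s * majorant\<close> at one time becomes at most
  \<open>s * (1 + rate / c) * majorant\<close> at the next.\<close>

lemma flux_majorant_le: "flux \<delta> majorant k \<le> majorant k / c"
proof (cases k)
  case 0
  have "- \<delta> * majorant 0 \<le> 0" using \<delta> majorant_pos[of 0] by simp
  also have "0 \<le> majorant 0 / c" using majorant_pos[of 0] c_pos by simp
  finally show ?thesis using 0 by simp
next
  case (Suc j)
  have fl: "flux \<delta> f k \<le> f k / c"
    using f_balance[of k] \<alpha> \<gamma> c_pos by (simp add: field_simps)
  show ?thesis
  proof (cases "j = 0")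
    case True
    have "\<delta> * f 0 - (1 + \<delta>) * f 1 \<le> f 1 / c" using fl Suc True by simp
    \<comment> \<open>The case \<open>majorant 0 = f 1\<close>: even the raised inflow
      \<open>\<delta> * f 1\<close> stays below the outflow
      \<open>(1 + \<delta>) * f 1\<close>.\<close>
    moreover have "\<delta> * f 1 - (1 + \<delta>) * f 1 \<le> f 1 / c"
      using f_pos[of 1] c_pos by (simp add: algebra_simps)
        (smt (verit) divide_pos_pos)
    ultimately show ?thesis using Suc True by (simp add: majorant_def max_def)
  next
    case False
    then show ?thesis using fl Suc by (simp add: majorant_def)
  qed
qed

lemma sum_weighted_majorant_bounded:
  obtains M where "0 < M" "\<And>n. (\<Sum>k\<le>n. (real k + 1) * majorant k) \<le> M"
proof -
  define a where "a k = (real k + \<delta>) * f k" for k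
  have a_nn: "0 \<le> a k" for k using f_nonneg \<delta> by (simp add: a_def)
  \<comment> \<open>The recursion multiplied by \<open>n + 1 + \<delta>\<close> sums to a conserved
    quantity. Since \<open>1 / c > 1\<close>, both of its terms are nonnegative, so each is bounded
    by the value at 1; this replaces asymptotics of the Gamma function.\<close>
  have inv: "(1 / c - 1) * (\<Sum>k=1..n. a k) + (real n + 1 + \<delta>) * a n = (1 / c + 1 + \<delta>) * a 1"
    if "1 \<le> n" for n
    using that
  proof (induction n rule: dec_induct)
    case base
    show ?case by (simp add: algebra_simps)
  next
    case (step n)
    have "c * a n = (1 + c * (real n + 1 + \<delta>)) * f (Suc n)"
      using f_Suc_rec[of n] step by (simp add: a_def mult_ac)
    then have "a n = f (Suc n) / c + a (Suc n)"
      using c_pos by (simp add: a_def field_simps)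
    then have "(real n + 1 + \<delta>) * a n = a (Suc n) / c + (real n + 1 + \<delta>) * a (Suc n)"
      by (simp add: a_def algebra_simps)
    then show ?case using step by (simp add: algebra_simps)
  qed
  define M where "M = majorant 0 + 2 * ((1 / c + 1 + \<delta>) * a 1 / (1 / c - 1)) + 1"
  have cp: "1 / c - 1 > 0" using c_pos c_less_1 by simp
  have le: "(\<Sum>k=1..n. a k) \<le> (1 / c + 1 + \<delta>) * a 1 / (1 / c - 1)" for n
  proof (cases "1 \<le> n")
    case True
    have "(1 / c - 1) * (\<Sum>k=1..n. a k) \<le> (1 / c + 1 + \<delta>) * a 1"
      using inv[OF True] a_nn[of n] \<delta> by (smt (verit) mult_nonneg_nonneg of_nat_0_le_iff)
    then show ?thesis using cp by (simp add: pos_le_divide_eq mult.commute)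
  next
    case False
    then show ?thesis using cp a_nn[of 1] c_pos \<delta> by simp
  qed
  have "(\<Sum>k\<le>n. (real k + 1) * majorant k) \<le> M" for n
  proof -
    have "(\<Sum>k\<le>n. (real k + 1) * majorant k)
        = majorant 0 + (\<Sum>k=1..n. (real k + 1) * majorant k)"
      by (simp add: sum.atMost_shift sum.shift_bounds_cl_Suc_ivl[of _ 0] atLeast0AtMost[symmetric]
          sum.atLeast_Suc_atMost)
    also have "(\<Sum>k=1..n. (real k + 1) * majorant k) \<le> (\<Sum>k=1..n. 2 * a k)"
    proof (rule sum_mono)
      fix k assume k: "k \<in> {1..n}"
      have "(real k + 1) * f k \<le> 2 * (real k + \<delta>) * f k"
        using k \<delta> f_nonneg[of k] by (intro mult_right_mono) auto
      also have "\<dots> = 2 * a k" by (simp add: a_def)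
      finally show "(real k + 1) * majorant k \<le> 2 * a k" using k by (simp add: majorant_def)
    qed
    also have "(\<Sum>k=1..n. 2 * a k) = 2 * (\<Sum>k=1..n. a k)" by (simp add: sum_distrib_left)
    finally show ?thesis using le[of n] by (simp add: M_def)
  qed
  moreover have "0 < M"
    using majorant_pos[of 0] cp a_nn[of 1] c_pos \<delta> by (simp add: M_def add_pos_nonneg)
  ultimately show ?thesis using that by blast
qed

text \<open>The directions in which the fluctuations of the step counts drive the mean degree counts.\<close>

lemma noise_direction_bounds:
  obtains \<Lambda> where "0 < \<Lambda>"
    "\<And>k. \<bar>flux \<delta> f k\<bar> \<le> \<Lambda> * majorant k" "\<And>k. \<bar>flux \<delta> (flux \<delta> f) k\<bar> \<le> \<Lambda> * majorant k"
    "\<And>k j. j \<le> 1 \<Longrightarrow> \<bar>of_bool (k = j)\<bar> \<le> \<Lambda> * majorant k"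
    "\<And>k j. j \<le> 1 \<Longrightarrow> \<bar>flux \<delta> (\<lambda>k. of_bool (k = j)) k\<bar> \<le> \<Lambda> * majorant k"
proof -
  define P where "P v \<longleftrightarrow> (\<exists>\<Lambda>>0. \<forall>k. \<bar>v k\<bar> \<le> \<Lambda> * majorant k)" for v :: "nat \<Rightarrow> real"
  \<comment> \<open>Finitely many values are absorbed in the constant because
    \<open>majorant\<close> is positive. The threshold is 3 because
    \<open>flux \<delta> (flux \<delta> f) k\<close> reads \<open>flux \<delta> f\<close> at
    \<open>k - 1\<close>, and \<open>f\<close> satisfies the eigenvalue equation
    \<open>flux \<delta> f k = f k / c\<close> from 2 on.\<close>
  have finite_exception: "P v" if "\<And>k. 3 \<le> k \<Longrightarrow> \<bar>v k\<bar> \<le> C * f k" for v C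
  proof -
    define \<Lambda> where "\<Lambda> = \<bar>C\<bar> + (\<Sum>k<3. \<bar>v k\<bar> / majorant k) + 1"
    have "\<bar>v k\<bar> \<le> \<Lambda> * majorant k" for k
    proof (cases "k < 3")
      case True
      have "\<bar>v k\<bar> / majorant k \<le> (\<Sum>k<3. \<bar>v k\<bar> / majorant k)"
        using True majorant_pos by (intro member_le_sum) (auto simp: less_imp_le)
      then have "\<bar>v k\<bar> / majorant k \<le> \<Lambda>" by (simp add: \<Lambda>_def)
      then show ?thesis using majorant_pos[of k] by (simp add: pos_divide_le_eq)
    next
      case False
      have "0 \<le> (\<Sum>k<3. \<bar>v k\<bar> / majorant k)"
        using majorant_pos by (intro sum_nonneg) (auto simp: less_imp_le)
      then have "C \<le> \<Lambda>" by (simp add: \<Lambda>_def)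
      then have "C * f k \<le> \<Lambda> * f k" using f_nonneg by (intro mult_right_mono)
      then show ?thesis using that[of k] False by (simp add: majorant_def)
    qed
    moreover have "0 < \<Lambda>"
      using majorant_pos by (auto simp: \<Lambda>_def less_imp_le intro!: add_nonneg_pos add_nonneg_nonneg sum_nonneg)
    ultimately show ?thesis unfolding P_def by blast
  qed
  have fl: "flux \<delta> f k = f k / c" if "2 \<le> k" for k
    using f_balance[of k] that c_pos by (simp add: field_simps)
  have "P (flux \<delta> f)"
    using finite_exception[of "flux \<delta> f" "1 / c"] fl c_pos f_nonneg by simp
  moreover have "P (flux \<delta> (flux \<delta> f))"
  proof (rule finite_exception[of _ "1 / c / c"])
    fix k :: nat assume k: "3 \<le> k"
    have "flux \<delta> (flux \<delta> f) k = flux \<delta> (\<lambda>k. (1 / c) * f k) k"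
      using k fl[of k] fl[of "k - 1"] by (simp add: flux_def)
    also have "\<dots> = 1 / c / c * f k" unfolding flux_cmult using fl[of k] k by simp
    finally show "\<bar>flux \<delta> (flux \<delta> f) k\<bar> \<le> 1 / c / c * f k" using c_pos f_nonneg[of k] by simp
  qed
  moreover have "P (\<lambda>k. of_bool (k = 0))" "P (\<lambda>k. of_bool (k = 1))"
    by (rule finite_exception[of _ 0]; simp)+
  moreover have "P (flux \<delta> (\<lambda>k. of_bool (k = 0)))" "P (flux \<delta> (\<lambda>k. of_bool (k = 1)))"
    by (rule finite_exception[of _ 0]; auto simp: flux_def)+
  ultimately obtain a1 a2 a3 a4 a5 a6 where a: "a1 > 0" "a2 > 0" "a3 > 0" "a4 > 0" "a5 > 0" "a6 > 0"
    "\<And>k. \<bar>flux \<delta> f k\<bar> \<le> a1 * majorant k" "\<And>k. \<bar>flux \<delta> (flux \<delta> f) k\<bar> \<le> a2 * majorant k"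
    "\<And>k. \<bar>of_bool (k = 0)\<bar> \<le> a3 * majorant k" "\<And>k. \<bar>of_bool (k = 1)\<bar> \<le> a4 * majorant k"
    "\<And>k. \<bar>flux \<delta> (\<lambda>k. of_bool (k = 0)) k\<bar> \<le> a5 * majorant k"
    "\<And>k. \<bar>flux \<delta> (\<lambda>k. of_bool (k = 1)) k\<bar> \<le> a6 * majorant k"
    unfolding P_def by metis
  define \<Lambda> where "\<Lambda> = a1 + a2 + a3 + a4 + a5 + a6"
  have up: "x \<le> \<Lambda> * majorant k" if "x \<le> b * majorant k" "b \<le> \<Lambda>" for x b k
    using that majorant_pos[of k] by (meson less_imp_le mult_right_mono order_trans)
  have j: "j = 0 \<or> j = 1" if "j \<le> 1" for j :: nat using that by linarith
  show ?thesis
  proof (rule that[of \<Lambda>])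
    show "0 < \<Lambda>" using a by (simp add: \<Lambda>_def)
    show "\<bar>flux \<delta> f k\<bar> \<le> \<Lambda> * majorant k" for k
      by (rule up[OF a(7)]) (use a(1-6) in \<open>simp add: \<Lambda>_def\<close>)
    show "\<bar>flux \<delta> (flux \<delta> f) k\<bar> \<le> \<Lambda> * majorant k" for k
      by (rule up[OF a(8)]) (use a(1-6) in \<open>simp add: \<Lambda>_def\<close>)
    show "\<bar>of_bool (k = j)\<bar> \<le> \<Lambda> * majorant k" if "j \<le> 1" for k j
      using j[OF that] up[OF a(9)[of k]] up[OF a(10)[of k]] a(1-6) unfolding \<Lambda>_def by fastforce
    show "\<bar>flux \<delta> (\<lambda>k. of_bool (k = j)) k\<bar> \<le> \<Lambda> * majorant k" if "j \<le> 1" for k j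
      using j[OF that] up[OF a(11)[of k]] up[OF a(12)[of k]] a(1-6) unfolding \<Lambda>_def by fastforce
  qed
qed

end

section \<open>The mean degree counts for given step kinds\<close>

definition cnt :: "step_kind \<Rightarrow> (nat \<Rightarrow> step_kind) \<Rightarrow> nat \<Rightarrow> real" where
  "cnt k \<omega> i = (\<Sum>j<i. of_bool (\<omega> j = k))"

lemma cnt_0 [simp]: "cnt k \<omega> 0 = 0"
  by (simp add: cnt_def)

lemma cnt_Suc [simp]: "cnt k \<omega> (Suc i) = cnt k \<omega> i + of_bool (\<omega> i = k)"
  by (simp add: cnt_def)

lemma cnt_nonneg [simp]: "0 \<le> cnt k \<omega> i"
  by (simp add: cnt_def sum_nonneg)

text \<open>The exponent is \<open>2 - 3 / 4\<close>: a deviation of order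
  \<open>r powr (3 / 4)\<close> divided by two factors of order \<open>r\<close>, either two weights
  or a weight and a \<open>growth\<close>.\<close>

lemma bounded_sum_powr:
  obtains P :: real where "0 \<le> P" "\<And>i. (\<Sum>r<i. (real r + 1) powr (- (5 / 4))) \<le> P"
proof -
  let ?p = "\<lambda>r. (real r + 1) powr (- (5 / 4))"
  have "summable (\<lambda>n. real (Suc n) powr (- (5 / 4)))"
    by (subst summable_Suc_iff) (simp add: summable_real_powr_iff)
  then have s: "summable ?p" by (simp add: add.commute)
  show ?thesis
  proof (rule that)
    show "0 \<le> suminf ?p" by (rule suminf_nonneg[OF s]) simp
    show "(\<Sum>r<i. ?p r) \<le> suminf ?p" for i
      by (rule sum_le_suminf[OF s]) auto
  qed
qed

context attachment
begin

section \<open>Weight, frontier, noise and mean counts along a sequence of kinds\<close>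

definition weight :: "(nat \<Rightarrow> step_kind) \<Rightarrow> nat \<Rightarrow> real" where
  "weight \<omega> i = real t0 + real i + \<delta> * (real n0 + cnt From_New \<omega> i + cnt To_New \<omega> i)"

definition rate :: "(nat \<Rightarrow> step_kind) \<Rightarrow> nat \<Rightarrow> real" where
  "rate \<omega> i = (if \<omega> i = To_New then 0 else 1 / weight \<omega> i)"

text \<open>An upper bound for the in-degrees at time \<open>i\<close>: initial ones are at most
  \<open>t0\<close>, and only a step attaching to an old vertex can raise the maximum. The summand 1
  covers vertices born with in-degree 1.\<close>

definition frontier :: "(nat \<Rightarrow> step_kind) \<Rightarrow> nat \<Rightarrow> nat" where
  "frontier \<omega> i = t0 + 1 + (\<Sum>j<i. of_bool (\<omega> j \<noteq> To_New))"

definition deviation :: "(nat \<Rightarrow> step_kind) \<Rightarrow> nat \<Rightarrow> real" where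
  "deviation \<omega> i = \<bar>cnt From_New \<omega> i - \<alpha> * real i\<bar> + \<bar>cnt To_New \<omega> i - \<gamma> * real i\<bar>"

text \<open>An exponent above \<open>1 / 2\<close> lets one \<open>L\<close> serve all times with
  high probability; an exponent below 1 makes deviations negligible against the weight, even after
  division by its square and summation.\<close>

definition regular :: "real \<Rightarrow> (nat \<Rightarrow> step_kind) \<Rightarrow> nat \<Rightarrow> bool" where
  "regular L \<omega> N \<longleftrightarrow> (\<forall>i\<le>N. deviation \<omega> i \<le> L * real i powr (3 / 4))"

text \<open>Here \<open>i - cnt To_New \<omega> i\<close> is the sum of \<open>rate * weight\<close>
  over the first \<open>i\<close> steps. Comparing it with \<open>c\<close> times the increase of
  the weight gives a centred quantity because \<open>c * w = 1 - \<gamma>\<close>.\<close>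

definition drift_noise :: "(nat \<Rightarrow> step_kind) \<Rightarrow> nat \<Rightarrow> real" where
  "drift_noise \<omega> i = (real i - cnt To_New \<omega> i - c * (weight \<omega> i - weight \<omega> 0)) / w"

text \<open>The accumulated defect of \<open>f k * weight \<omega> i / w\<close> in the recursion of
  \<open>mean\<close>: attachments and both sorts of birth, each minus its share in the growth of
  the weight.\<close>

definition noise :: "(nat \<Rightarrow> step_kind) \<Rightarrow> nat \<Rightarrow> nat \<Rightarrow> real" where
  "noise \<omega> i k = drift_noise \<omega> i * flux \<delta> f k
     + (cnt From_New \<omega> i - \<alpha> * (weight \<omega> i - weight \<omega> 0) / w) * of_bool (k = 0)
     + (cnt To_New \<omega> i - \<gamma> * (weight \<omega> i - weight \<omega> 0) / w) * of_bool (k = 1)"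

primrec mean :: "(nat \<Rightarrow> real) \<Rightarrow> (nat \<Rightarrow> step_kind) \<Rightarrow> nat \<Rightarrow> nat \<Rightarrow> real" where
  "mean \<pi> \<omega> 0 = \<pi>"
| "mean \<pi> \<omega> (Suc i) = (\<lambda>k. mean \<pi> \<omega> i k + rate \<omega> i * flux \<delta> (mean \<pi> \<omega> i) k
     + of_bool (k = 0 \<and> \<omega> i = From_New) + of_bool (k = 1 \<and> \<omega> i = To_New))"

text \<open>
  Both \<open>f k * weight \<omega> i / w\<close> and the noise are explicit, and the choice of \<open>weight / w\<close> instead of
  the time makes the remaining error satisfy a recursion without births.
\<close>
definition err :: "(nat \<Rightarrow> real) \<Rightarrow> (nat \<Rightarrow> step_kind) \<Rightarrow> nat \<Rightarrow> nat \<Rightarrow> real" where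
  "err \<pi> \<omega> i k = mean \<pi> \<omega> i k - f k * weight \<omega> i / w - noise \<omega> i k"

lemma weight_Suc:
  "weight \<omega> (Suc i) = weight \<omega> i + 1 + \<delta> * (of_bool (\<omega> i = From_New) + of_bool (\<omega> i = To_New))"
  by (simp add: weight_def algebra_simps)

lemma weight_Suc_le: "weight \<omega> (Suc i) \<le> weight \<omega> i + 1 + \<delta>"
  using \<delta> by (auto simp: weight_Suc)

lemma weight_Suc_ge: "weight \<omega> i + 1 \<le> weight \<omega> (Suc i)"
  using \<delta> by (auto simp: weight_Suc)

definition w_low :: real where "w_low = min 1 (real t0 + \<delta> * real n0)"
definition w_up :: real where "w_up = real t0 + \<delta> * real n0 + 1 + \<delta>"

lemma w_low_pos: "0 < w_low"
  using W0 by (simp add: w_low_def)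

lemma w_up_ge_1: "1 \<le> w_up"
  using \<delta> by (simp add: w_up_def)

lemma weight_ge: "w_low * (real i + 1) \<le> weight \<omega> i"
proof (induction i)
  case 0
  show ?case by (simp add: weight_def w_low_def)
next
  case (Suc i)
  have "w_low \<le> 1" by (simp add: w_low_def)
  then have "w_low * (real (Suc i) + 1) \<le> w_low * (real i + 1) + 1" by (simp add: algebra_simps)
  then show ?case using Suc weight_Suc_ge[of \<omega> i] by simp
qed

lemma weight_le: "weight \<omega> i \<le> w_up * (real i + 1)"
proof (induction i)
  case 0
  show ?case using \<delta> by (simp add: weight_def w_up_def)
next
  case (Suc i)
  have "w_up * (real (Suc i) + 1) = w_up * (real i + 1) + w_up" by (simp add: algebra_simps)
  moreover have "1 + \<delta> \<le> w_up" using \<delta> by (simp add: w_up_def)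
  ultimately show ?case using Suc weight_Suc_le[of \<omega> i] by simp
qed

lemma weight_pos: "0 < weight \<omega> i"
  using weight_ge[of i \<omega>] w_low_pos by (smt (verit) mult_pos_pos of_nat_0_le_iff)

lemma rate_nonneg: "0 \<le> rate \<omega> i"
  using weight_pos[of \<omega> i] by (simp add: rate_def)

lemma rate_le: "rate \<omega> i \<le> 1 / weight \<omega> i"
  using weight_pos[of \<omega> i] by (simp add: rate_def)

lemma rate_weight: "rate \<omega> i * weight \<omega> i = of_bool (\<omega> i \<noteq> To_New)"
  using weight_pos[of \<omega> i] by (simp add: rate_def)

lemma deviation_nonneg [simp]: "0 \<le> deviation \<omega> i"
  by (simp add: deviation_def)

lemma weight_diff:
  "weight \<omega> i - weight \<omega> 0
     = w * real i + \<delta> * ((cnt From_New \<omega> i - \<alpha> * real i) + (cnt To_New \<omega> i - \<gamma> * real i))"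
  by (simp add: weight_def w_def algebra_simps)

lemma weight_diff_deviation: "\<bar>weight \<omega> i - weight \<omega> 0 - w * real i\<bar> \<le> \<delta> * deviation \<omega> i"
  unfolding weight_diff deviation_def using \<delta>
  by (simp add: abs_mult mult_left_mono)

text \<open>Each coefficient is a centred count, up to sign and a division by
  \<open>w \<ge> 1\<close>, plus a multiple of the weight error \<open>e\<close> with factor at most
  1. The first contributes at most \<open>deviation\<close>, the second \<delta> times that; hence
  \<open>1 + \<delta>\<close>.\<close>

lemma abs_noise_coeffs:
  shows "\<bar>drift_noise \<omega> i\<bar> \<le> (1 + \<delta>) * deviation \<omega> i"
    and "\<bar>cnt From_New \<omega> i - \<alpha> * (weight \<omega> i - weight \<omega> 0) / w\<bar> \<le> (1 + \<delta>) * deviation \<omega> i"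
    and "\<bar>cnt To_New \<omega> i - \<gamma> * (weight \<omega> i - weight \<omega> 0) / w\<bar> \<le> (1 + \<delta>) * deviation \<omega> i"
proof -
  define e where "e = weight \<omega> i - weight \<omega> 0 - w * real i"
  have e: "\<bar>e\<bar> \<le> \<delta> * deviation \<omega> i" using weight_diff_deviation by (simp add: e_def)
  have scaled: "\<bar>r * e / w\<bar> \<le> \<delta> * deviation \<omega> i" if "0 \<le> r" "r \<le> 1" for r
  proof -
    have "\<bar>r * e / w\<bar> = (r / w) * \<bar>e\<bar>" using that w_pos by (simp add: abs_mult)
    also have "\<dots> \<le> 1 * \<bar>e\<bar>"
      using that w_ge_1 by (intro mult_right_mono) auto
    finally show ?thesis using e by simp
  qed
  have dA: "\<bar>cnt From_New \<omega> i - \<alpha> * real i\<bar> \<le> deviation \<omega> i"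
    and dG: "\<bar>cnt To_New \<omega> i - \<gamma> * real i\<bar> \<le> deviation \<omega> i"
    by (simp_all add: deviation_def)
  have eqA: "cnt From_New \<omega> i - \<alpha> * (weight \<omega> i - weight \<omega> 0) / w
      = (cnt From_New \<omega> i - \<alpha> * real i) - \<alpha> * e / w"
    using w_pos by (simp add: e_def field_simps)
  show "\<bar>cnt From_New \<omega> i - \<alpha> * (weight \<omega> i - weight \<omega> 0) / w\<bar> \<le> (1 + \<delta>) * deviation \<omega> i"
    unfolding eqA distrib_right mult_1 using scaled[of \<alpha>] dA \<alpha> \<beta> \<gamma> sum1 by linarith
  have eqG: "cnt To_New \<omega> i - \<gamma> * (weight \<omega> i - weight \<omega> 0) / w
      = (cnt To_New \<omega> i - \<gamma> * real i) - \<gamma> * e / w"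
    using w_pos by (simp add: e_def field_simps)
  show "\<bar>cnt To_New \<omega> i - \<gamma> * (weight \<omega> i - weight \<omega> 0) / w\<bar> \<le> (1 + \<delta>) * deviation \<omega> i"
    unfolding eqG distrib_right mult_1 using scaled[of \<gamma>] dG \<alpha> \<beta> \<gamma> sum1 by linarith
  have "c * (weight \<omega> i - weight \<omega> 0) = (c * w) * real i + c * e"
    by (simp add: e_def algebra_simps)
  then have "real i - cnt To_New \<omega> i - c * (weight \<omega> i - weight \<omega> 0)
      = - (cnt To_New \<omega> i - \<gamma> * real i) - c * e"
    unfolding c_w by (simp add: algebra_simps)
  then have "drift_noise \<omega> i = - (cnt To_New \<omega> i - \<gamma> * real i) / w - c * e / w"
    unfolding drift_noise_def by (simp only: diff_divide_distrib)
  moreover have "\<bar>- (cnt To_New \<omega> i - \<gamma> * real i) / w\<bar> \<le> deviation \<omega> i"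
  proof -
    have "\<bar>- (cnt To_New \<omega> i - \<gamma> * real i) / w\<bar> \<le> \<bar>cnt To_New \<omega> i - \<gamma> * real i\<bar>"
      using w_ge_1 by (simp add: abs_minus_commute divide_le_eq mult_le_cancel_left1)
    then show ?thesis using dG by simp
  qed
  ultimately show "\<bar>drift_noise \<omega> i\<bar> \<le> (1 + \<delta>) * deviation \<omega> i"
    unfolding distrib_right mult_1 using scaled[of c] c_pos c_less_1 by linarith
qed

lemma noise_bounds:
  obtains \<Lambda> where "0 < \<Lambda>"
    "\<And>\<omega> i k. \<bar>noise \<omega> i k\<bar> \<le> \<Lambda> * deviation \<omega> i * majorant k"
    "\<And>\<omega> i k. \<bar>flux \<delta> (noise \<omega> i) k\<bar> \<le> \<Lambda> * deviation \<omega> i * majorant k"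
proof -
  obtain \<Lambda> where \<Lambda>: "0 < \<Lambda>"
    "\<And>k. \<bar>flux \<delta> f k\<bar> \<le> \<Lambda> * majorant k" "\<And>k. \<bar>flux \<delta> (flux \<delta> f) k\<bar> \<le> \<Lambda> * majorant k"
    "\<And>k j. j \<le> 1 \<Longrightarrow> \<bar>of_bool (k = j)\<bar> \<le> \<Lambda> * majorant k"
    "\<And>k j. j \<le> 1 \<Longrightarrow> \<bar>flux \<delta> (\<lambda>k. of_bool (k = j)) k\<bar> \<le> \<Lambda> * majorant k"
    using noise_direction_bounds by blast
  have bound: "\<bar>p * x + q * y + r * z\<bar> \<le> 3 * \<Lambda> * (1 + \<delta>) * D * m"
    if "\<bar>p\<bar> \<le> (1 + \<delta>) * D" "\<bar>q\<bar> \<le> (1 + \<delta>) * D" "\<bar>r\<bar> \<le> (1 + \<delta>) * D"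
      "\<bar>x\<bar> \<le> \<Lambda> * m" "\<bar>y\<bar> \<le> \<Lambda> * m" "\<bar>z\<bar> \<le> \<Lambda> * m" "0 \<le> D"
    for p q r x y z D m :: real
  proof -
    have "\<bar>p * x\<bar> \<le> (1 + \<delta>) * D * (\<Lambda> * m)" "\<bar>q * y\<bar> \<le> (1 + \<delta>) * D * (\<Lambda> * m)"
      "\<bar>r * z\<bar> \<le> (1 + \<delta>) * D * (\<Lambda> * m)"
      unfolding abs_mult using that \<delta> by (auto intro!: mult_mono)
    then show ?thesis by (simp add: algebra_simps)
  qed
  show ?thesis
  proof (rule that)
    show "0 < 3 * \<Lambda> * (1 + \<delta>)" using \<Lambda> \<delta> by simp
    show "\<bar>noise \<omega> i k\<bar> \<le> 3 * \<Lambda> * (1 + \<delta>) * deviation \<omega> i * majorant k" for \<omega> i k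
      unfolding noise_def
      by (rule bound; (rule \<Lambda>(2) \<Lambda>(4) abs_noise_coeffs deviation_nonneg; simp)?)
    have "flux \<delta> (noise \<omega> i) k = drift_noise \<omega> i * flux \<delta> (flux \<delta> f) k
     + (cnt From_New \<omega> i - \<alpha> * (weight \<omega> i - weight \<omega> 0) / w) * flux \<delta> (\<lambda>k. of_bool (k = 0)) k
     + (cnt To_New \<omega> i - \<gamma> * (weight \<omega> i - weight \<omega> 0) / w) * flux \<delta> (\<lambda>k. of_bool (k = 1)) k"
      for \<omega> i k
      unfolding noise_def[abs_def] flux_add flux_cmult ..
    then show "\<bar>flux \<delta> (noise \<omega> i) k\<bar> \<le> 3 * \<Lambda> * (1 + \<delta>) * deviation \<omega> i * majorant k" for \<omega> i k
      by (simp only:) (rule bound; (rule \<Lambda>(3) \<Lambda>(5) abs_noise_coeffs deviation_nonneg; simp)?)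
  qed
qed

text \<open>This is the summation by parts. Because the accumulated noise is subtracted, its
  increments cancel, and what drives the error is the noise times the rate: of order
  \<open>sqrt i / i\<close> where the increments were of order 1.\<close>

lemma err_Suc:
  "err \<pi> \<omega> (Suc i) k = err \<pi> \<omega> i k + rate \<omega> i * flux \<delta> (err \<pi> \<omega> i) k
     + rate \<omega> i * flux \<delta> (noise \<omega> i) k"
proof -
  have "err \<pi> \<omega> i = (\<lambda>k. mean \<pi> \<omega> i k - weight \<omega> i / w * f k - noise \<omega> i k)"
    by (simp add: err_def[abs_def] mult.commute)
  then have "flux \<delta> (err \<pi> \<omega> i) k
      = flux \<delta> (mean \<pi> \<omega> i) k - weight \<omega> i / w * flux \<delta> f k - flux \<delta> (noise \<omega> i) k"
    by (simp only: flux_diff flux_cmult)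
  then have "rate \<omega> i * flux \<delta> (err \<pi> \<omega> i) k + rate \<omega> i * flux \<delta> (noise \<omega> i) k
      = rate \<omega> i * flux \<delta> (mean \<pi> \<omega> i) k - (rate \<omega> i * weight \<omega> i) / w * flux \<delta> f k"
    by (simp only:) (simp add: algebra_simps)
  then have fl: "rate \<omega> i * flux \<delta> (err \<pi> \<omega> i) k + rate \<omega> i * flux \<delta> (noise \<omega> i) k
      = rate \<omega> i * flux \<delta> (mean \<pi> \<omega> i) k - of_bool (\<omega> i \<noteq> To_New) / w * flux \<delta> f k"
    unfolding rate_weight .
  define \<Delta> where "\<Delta> = weight \<omega> (Suc i) - weight \<omega> i"
  have w': "weight \<omega> (Suc i) = weight \<omega> i + \<Delta>" by (simp add: \<Delta>_def)
  have "noise \<omega> (Suc i) k - noise \<omega> i k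
      = (of_bool (\<omega> i \<noteq> To_New) - c * \<Delta>) / w * flux \<delta> f k
        + (of_bool (\<omega> i = From_New) - \<alpha> * \<Delta> / w) * of_bool (k = 0)
        + (of_bool (\<omega> i = To_New) - \<gamma> * \<Delta> / w) * of_bool (k = 1)"
    unfolding noise_def drift_noise_def w' using w_pos by (auto simp: field_simps)
  also have "\<dots> = of_bool (\<omega> i \<noteq> To_New) / w * flux \<delta> f k
        + of_bool (\<omega> i = From_New) * of_bool (k = 0) + of_bool (\<omega> i = To_New) * of_bool (k = 1)
        - (c * flux \<delta> f k + \<alpha> * of_bool (k = 0) + \<gamma> * of_bool (k = 1)) * \<Delta> / w"
    using w_pos by (simp add: field_simps)
  \<comment> \<open>By \<open>f_balance\<close> the three compensating terms add up to
    \<open>f k * \<Delta> / w\<close>, the increment of the main term.\<close>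
  finally have n: "noise \<omega> (Suc i) k - noise \<omega> i k = of_bool (\<omega> i \<noteq> To_New) / w * flux \<delta> f k
        + of_bool (\<omega> i = From_New) * of_bool (k = 0) + of_bool (\<omega> i = To_New) * of_bool (k = 1)
        - f k * \<Delta> / w"
    unfolding f_balance[symmetric] .
  have "f k * weight \<omega> (Suc i) / w = f k * weight \<omega> i / w + f k * \<Delta> / w"
    by (simp add: w' distrib_left add_divide_distrib)
  moreover have "mean \<pi> \<omega> (Suc i) k = mean \<pi> \<omega> i k + rate \<omega> i * flux \<delta> (mean \<pi> \<omega> i) k
       + of_bool (\<omega> i = From_New) * of_bool (k = 0) + of_bool (\<omega> i = To_New) * of_bool (k = 1)"
    by auto
  ultimately show ?thesis using n fl unfolding err_def by linarith
qed

lemma frontier_Suc: "frontier \<omega> (Suc i) = frontier \<omega> i + of_bool (\<omega> i \<noteq> To_New)"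
  by (simp add: frontier_def)

lemma real_frontier: "real (frontier \<omega> i) = real t0 + 1 + real i - cnt To_New \<omega> i"
  by (induction i) (auto simp: frontier_Suc, simp add: frontier_def)

lemma frontier_le: "frontier \<omega> i \<le> t0 + 1 + i"
  by (induction i) (auto simp: frontier_Suc frontier_def)

text \<open>The support grows only with the frontier: a \<open>To_New\<close> step has rate 0 and
  adds mass at 1, which is never above the frontier.\<close>

lemma mean_eq_0:
  assumes "\<And>k. t0 < k \<Longrightarrow> \<pi> k = 0" "frontier \<omega> i < k"
  shows "mean \<pi> \<omega> i k = 0"
  using assms(2)
proof (induction i arbitrary: k)
  case 0
  then show ?case using assms(1) by (simp add: frontier_def)
next
  case (Suc i)
  then have k: "frontier \<omega> i < k" "2 \<le> k" "\<omega> i \<noteq> To_New \<Longrightarrow> frontier \<omega> i < k - 1"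
    by (auto simp: frontier_Suc frontier_def)
  then show ?case using Suc.IH[of k] Suc.IH[of "k - 1"] by (auto simp: rate_def flux_def)
qed

text \<open>Besides controlling the explicit part of \<open>mean\<close>, this bounds the error
  itself above the frontier, where \<open>mean\<close> vanishes.\<close>

lemma abs_mean_minus_err:
  assumes "0 \<le> L"
  obtains C where "0 < C"
    "\<And>\<pi> \<omega> N i k. regular L \<omega> N \<Longrightarrow> i \<le> N \<Longrightarrow>
       \<bar>mean \<pi> \<omega> i k - err \<pi> \<omega> i k\<bar> \<le> C * (real i + 1) * majorant k"
proof -
  obtain \<Lambda> where \<Lambda>: "0 < \<Lambda>"
    "\<And>\<omega> i k. \<bar>noise \<omega> i k\<bar> \<le> \<Lambda> * deviation \<omega> i * majorant k"
    using noise_bounds by metis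
  show ?thesis
  proof (rule that)
    show "0 < w_up + \<Lambda> * L" using w_up_ge_1 \<Lambda> assms by (simp add: add_pos_nonneg)
    fix \<pi> \<omega> N i k assume r: "regular L \<omega> N" "i \<le> N"
    have p: "real i powr (3 / 4) \<le> real i + 1"
    proof (cases "i = 0")
      case False
      then have "real i powr (3 / 4) \<le> real i powr 1" by (intro powr_mono) auto
      then show ?thesis by simp
    qed simp
    have "deviation \<omega> i \<le> L * real i powr (3 / 4)" using r by (simp add: regular_def)
    also have "\<dots> \<le> L * (real i + 1)" using p assms by (intro mult_left_mono)
    finally have "\<Lambda> * deviation \<omega> i * majorant k \<le> \<Lambda> * (L * (real i + 1)) * majorant k"
      using \<Lambda>(1) majorant_pos[of k] by (intro mult_right_mono mult_left_mono) auto
    moreover have "\<bar>f k * weight \<omega> i / w\<bar> \<le> majorant k * (w_up * (real i + 1))"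
    proof -
      have "f k * weight \<omega> i / w \<le> f k * weight \<omega> i"
        using divide_left_mono[OF w_ge_1, of "f k * weight \<omega> i"] f_nonneg[of k] weight_pos[of \<omega> i]
          w_pos by simp
      also have "\<dots> \<le> majorant k * (w_up * (real i + 1))"
        using f_le_majorant weight_le f_nonneg[of k] weight_pos[of \<omega> i] majorant_pos[of k]
        by (intro mult_mono) (auto simp: less_imp_le)
      finally show ?thesis using f_nonneg[of k] weight_pos[of \<omega> i] w_pos by simp
    qed
    ultimately have "\<bar>f k * weight \<omega> i / w\<bar> + \<bar>noise \<omega> i k\<bar>
        \<le> majorant k * (w_up * (real i + 1)) + \<Lambda> * (L * (real i + 1)) * majorant k"
      using \<Lambda>(2)[of \<omega> i k] by linarith
    also have "\<dots> = (w_up + \<Lambda> * L) * (real i + 1) * majorant k" by (simp add: algebra_simps)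
    finally show "\<bar>mean \<pi> \<omega> i k - err \<pi> \<omega> i k\<bar> \<le> (w_up + \<Lambda> * L) * (real i + 1) * majorant k"
      unfolding err_def by linarith
  qed
qed

section \<open>Growth of the accumulated rates, and separation of weight and frontier\<close>

definition log_growth :: "(nat \<Rightarrow> step_kind) \<Rightarrow> nat \<Rightarrow> real" where
  "log_growth \<omega> i = (\<Sum>r<i. rate \<omega> r / c)"

text \<open>A bounded difference is essential: supersolutions then grow linearly in time up to a
  constant factor. One summand is \<open>rate / c = (W' - W) / W + (w / c) * (X' - X) / W\<close>,
  with \<open>X\<close> the drift noise; the first part sums to the logarithm of the weight, the
  second is summed by parts.\<close>

lemma log_growth_ln:
  assumes "0 \<le> L"
  obtains C where "0 \<le> C"
    "\<And>\<omega> N i. regular L \<omega> N \<Longrightarrow> i \<le> N \<Longrightarrow> \<bar>log_growth \<omega> i - ln (real i + 1)\<bar> \<le> C"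
proof -
  define p where "p r = (real r + 1) powr (- (5 / 4))" for r
  obtain P :: real where P_nn: "0 \<le> P" and sump: "\<And>i. (\<Sum>r<i. p r) \<le> P"
    using bounded_sum_powr unfolding p_def by blast
  define a where "a = (1 + \<delta>)\<^sup>2 / w_low\<^sup>2"
  define b where "b = w / c * ((1 + \<delta>) * L * (1 + \<delta>) / w_low\<^sup>2)"
  define e where "e = w / c * ((1 + \<delta>) * L / w_low)"
  have nn: "0 \<le> a" "0 \<le> b" "0 \<le> e"
    using w_pos c_pos \<delta> assms w_low_pos by (auto simp: a_def b_def e_def)
  \<comment> \<open>The initial weight is the same for all kinds; a constant sequence stands in so
    that \<open>C\<close> does not depend on \<omega>.\<close>
  define C where "C = (a + b) * P + e + \<bar>ln w_low\<bar> + \<bar>ln w_up\<bar> + \<bar>ln (weight (\<lambda>_. To_New) 0)\<bar>"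
  have C: "\<bar>log_growth \<omega> i - ln (real i + 1)\<bar> \<le> C"
    if reg: "regular L \<omega> N" and iN: "i \<le> N" for \<omega> N i
  proof -
    define X where "X = drift_noise \<omega>"
    have X: "\<bar>X r\<bar> \<le> (1 + \<delta>) * L * real r powr (3 / 4)" if "r \<le> N" for r
    proof -
      have "\<bar>X r\<bar> \<le> (1 + \<delta>) * deviation \<omega> r" unfolding X_def by (rule abs_noise_coeffs)
      also have "\<dots> \<le> (1 + \<delta>) * (L * real r powr (3 / 4))"
        using reg that \<delta> by (intro mult_left_mono) (auto simp: regular_def)
      finally show ?thesis by (simp add: mult_ac)
    qed
    \<comment> \<open>Both the logarithm and the boundary term of the summation by parts are
      removed, which leaves increments \<open>x - ln (1 + x)\<close> and
      \<open>X' * (1 / W - 1 / W')\<close>, both of summable order.\<close>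
    define R where "R i = log_growth \<omega> i - ln (weight \<omega> i) - w / c * (X i / weight \<omega> i)" for i
    have step: "\<bar>R (Suc r) - R r\<bar> \<le> (a + b) * p r" if "r < i" for r
    proof -
      let ?W = "weight \<omega> r" and ?W' = "weight \<omega> (Suc r)"
      define x where "x = (?W' - ?W) / ?W"
      have Wp: "0 < ?W" "0 < ?W'" by (rule weight_pos)+
      have W_low: "w_low * (real r + 1) \<le> ?W" "w_low * (real r + 1) \<le> ?W'"
        using weight_ge[of r \<omega>] weight_Suc_ge[of \<omega> r] by auto
      have lowp: "0 < w_low * (real r + 1)" using w_low_pos by simp
      have x0: "0 \<le> x" using Wp weight_Suc_ge[of \<omega> r] by (simp add: x_def)
      have xle: "x \<le> (1 + \<delta>) / (w_low * (real r + 1))"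
        unfolding x_def using W_low(1) weight_Suc_le[of \<omega> r] lowp \<delta>
        by (intro frac_le) auto
      have x2: "x\<^sup>2 \<le> a / (real r + 1)\<^sup>2"
        using power_mono[OF xle x0, of 2] by (simp add: a_def power_mult_distrib power_divide)
      have W'eq: "ln ?W' - ln ?W = ln (1 + x)"
      proof -
        have "1 + x = ?W' / ?W" using Wp by (simp add: x_def field_simps)
        then show ?thesis using Wp by (simp add: ln_div)
      qed
      have lnx: "0 \<le> x - ln (1 + x)" "x - ln (1 + x) \<le> x\<^sup>2"
      proof -
        show "0 \<le> x - ln (1 + x)" using ln_add_one_self_le_self[OF x0] by simp
        show "x - ln (1 + x) \<le> x\<^sup>2"
        proof (cases "x \<le> 1")
          case True
          then show ?thesis using ln_one_plus_pos_lower_bound[OF x0] by simp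
        next
          case False
          then have "x * 1 \<le> x * x" by (intro mult_left_mono) auto
          moreover have "0 \<le> ln (1 + x)" using x0 by simp
          ultimately show ?thesis by (simp add: power2_eq_square)
        qed
      qed
      have rc: "rate \<omega> r / c = x + w / c * ((X (Suc r) - X r) / ?W)"
      proof -
        have "w * (X (Suc r) - X r) = of_bool (\<omega> r \<noteq> To_New) - c * (?W' - ?W)"
          using w_pos by (auto simp: X_def drift_noise_def field_simps)
        then have "w / c * ((X (Suc r) - X r) / ?W) = (of_bool (\<omega> r \<noteq> To_New) - c * (?W' - ?W)) / (c * ?W)"
          by simp
        also have "\<dots> = of_bool (\<omega> r \<noteq> To_New) / ?W / c - x"
          using Wp c_pos by (simp add: x_def field_simps)
        finally show ?thesis by (simp add: rate_def)
      qed
      have "R (Suc r) - R r = x - ln (1 + x) + w / c * (X (Suc r) * (1 / ?W - 1 / ?W'))"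
        unfolding R_def log_growth_def sum.lessThan_Suc rc W'eq[symmetric]
        by (simp add: algebra_simps diff_divide_distrib)
      moreover have "\<bar>w / c * (X (Suc r) * (1 / ?W - 1 / ?W'))\<bar> \<le> b * p r"
      proof -
        have d: "1 / ?W - 1 / ?W' = (?W' - ?W) / (?W * ?W')" using Wp by (simp add: field_simps)
        have "\<bar>1 / ?W - 1 / ?W'\<bar> = (?W' - ?W) / (?W * ?W')"
          unfolding d using Wp weight_Suc_ge[of \<omega> r] by simp
        also have "\<dots> \<le> (1 + \<delta>) / ((w_low * (real r + 1)) * (w_low * (real r + 1)))"
          using W_low lowp \<delta> Wp weight_Suc_le[of \<omega> r] by (intro frac_le mult_mono) auto
        finally have "\<bar>X (Suc r)\<bar> * \<bar>1 / ?W - 1 / ?W'\<bar>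
            \<le> ((1 + \<delta>) * L * (real r + 1) powr (3 / 4)) * ((1 + \<delta>) / ((w_low * (real r + 1)) * (w_low * (real r + 1))))"
          using X[of "Suc r"] \<open>r < i\<close> iN by (intro mult_mono) (auto simp: add.commute)
        also have "\<dots> = (1 + \<delta>) * L * (1 + \<delta>) / w_low\<^sup>2 * ((real r + 1) powr (3 / 4) / (real r + 1)\<^sup>2)"
          by (simp add: power2_eq_square mult_ac)
        also have "(real r + 1) powr (3 / 4) / (real r + 1)\<^sup>2 = p r"
        proof -
          have "(real r + 1)\<^sup>2 = (real r + 1) powr 2" by simp
          then show ?thesis by (simp add: p_def powr_diff[symmetric] del: powr_numeral)
        qed
        finally have "w / c * (\<bar>X (Suc r)\<bar> * \<bar>1 / ?W - 1 / ?W'\<bar>)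
            \<le> w / c * ((1 + \<delta>) * L * (1 + \<delta>) / w_low\<^sup>2 * p r)"
          using w_pos c_pos by (intro mult_left_mono) auto
        then show ?thesis using w_pos c_pos by (simp add: abs_mult b_def mult_ac)
      qed
      moreover have "x\<^sup>2 \<le> a * p r"
      proof -
        have "1 / (real r + 1)\<^sup>2 = (real r + 1) powr (- 2)" by (simp add: powr_minus_divide)
        also have "\<dots> \<le> p r" unfolding p_def by (intro powr_mono) auto
        finally have "a * (1 / (real r + 1)\<^sup>2) \<le> a * p r" using nn by (intro mult_left_mono)
        then show ?thesis using x2 by simp
      qed
      ultimately show ?thesis using lnx unfolding distrib_right by linarith
    qed
    have "\<bar>R i - R 0\<bar> = \<bar>\<Sum>r<i. R (Suc r) - R r\<bar>" by (simp add: sum_lessThan_telescope)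
    also have "\<dots> \<le> (\<Sum>r<i. (a + b) * p r)" using step by (intro order_trans[OF sum_abs] sum_mono) auto
    also have "\<dots> = (a + b) * (\<Sum>r<i. p r)" by (simp add: sum_distrib_left)
    also have "\<dots> \<le> (a + b) * P" using nn sump[of i] by (intro mult_left_mono) auto
    finally have "\<bar>R i - R 0\<bar> \<le> (a + b) * P" .
    moreover have "R 0 = - ln (weight (\<lambda>_. To_New) 0)"
      by (simp add: R_def log_growth_def X_def drift_noise_def weight_def)
    moreover have "\<bar>w / c * (X i / weight \<omega> i)\<bar> \<le> e"
    proof -
      have "real i powr (3 / 4) \<le> real i + 1"
      proof (cases "i = 0")
        case False
        then have "real i powr (3 / 4) \<le> real i powr 1" by (intro powr_mono) auto
        then show ?thesis by simp
      qed simp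
      then have "(1 + \<delta>) * L * real i powr (3 / 4) \<le> (1 + \<delta>) * L * (real i + 1)"
        using assms \<delta> by (intro mult_left_mono) auto
      then have "\<bar>X i\<bar> / weight \<omega> i \<le> ((1 + \<delta>) * L * (real i + 1)) / (w_low * (real i + 1))"
        using X[OF iN] weight_ge[of i \<omega>] w_low_pos by (intro frac_le) auto
      then have "w / c * (\<bar>X i\<bar> / weight \<omega> i) \<le> e"
        unfolding e_def using w_pos c_pos by (intro mult_left_mono) auto
      then show ?thesis using w_pos c_pos weight_pos[of \<omega> i] by (simp add: abs_mult)
    qed
    moreover have "ln (weight \<omega> i) \<le> ln w_up + ln (real i + 1)"
      using weight_le[of \<omega> i] weight_pos[of \<omega> i] w_up_ge_1 by (subst ln_mult_pos[symmetric]) auto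
    moreover have "ln w_low + ln (real i + 1) \<le> ln (weight \<omega> i)"
      using weight_ge[of i \<omega>] weight_pos[of \<omega> i] w_low_pos by (subst ln_mult_pos[symmetric]) auto
    ultimately show ?thesis unfolding C_def R_def by linarith
  qed
  moreover have "0 \<le> C" using nn P_nn by (simp add: C_def)
  ultimately show ?thesis using that by blast
qed

text \<open>The weight grows at speed \<open>w = 1 + \<delta> * (\<alpha> + \<gamma>)\<close> and
  the frontier at speed \<open>1 - \<gamma>\<close>. The difference \<gamma> + \<delta> * (\<alpha>
  + \<gamma>) is positive, which yields the first estimate; the second holds since
  \<open>1 - \<gamma>\<close> is positive.\<close>

lemma frontier_regular:
  obtains i0 :: nat and C :: real where "0 < C"
    "\<And>\<omega> N i. regular L \<omega> N \<Longrightarrow> i0 \<le> i \<Longrightarrow> i \<le> N \<Longrightarrow> real (frontier \<omega> i) + 1 + \<delta> \<le> weight \<omega> i"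
    "\<And>\<omega> N i. regular L \<omega> N \<Longrightarrow> i \<le> N \<Longrightarrow> real i + 1 \<le> C * (real (frontier \<omega> i) + 1)"
proof -
  have "0 < \<gamma> + \<delta> * (\<alpha> + \<gamma>)"
  proof (cases "\<gamma> = 0")
    case True
    then show ?thesis using \<alpha>\<gamma> \<gamma>\<delta> by simp
  next
    case False
    then show ?thesis using \<gamma> \<delta> \<alpha>\<gamma> by (simp add: add_pos_nonneg)
  qed
  then have "\<forall>\<^sub>F i in sequentially. 2 + \<delta> + (1 + \<delta>) * L * real i powr (3 / 4) \<le> (\<gamma> + \<delta> * (\<alpha> + \<gamma>)) * real i"
    by real_asymp
  moreover have "\<forall>\<^sub>F i in sequentially. L * real i powr (3 / 4) + (1 - \<gamma>) / 2 \<le> (1 - \<gamma>) / 2 * real i"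
    using \<gamma>_less_1 by real_asymp
  ultimately have "\<forall>\<^sub>F i in sequentially.
      2 + \<delta> + (1 + \<delta>) * L * real i powr (3 / 4) \<le> (\<gamma> + \<delta> * (\<alpha> + \<gamma>)) * real i
      \<and> L * real i powr (3 / 4) + (1 - \<gamma>) / 2 \<le> (1 - \<gamma>) / 2 * real i"
    by (rule eventually_conj)
  then obtain i0 where i0: "\<And>i. i0 \<le> i \<Longrightarrow>
      2 + \<delta> + (1 + \<delta>) * L * real i powr (3 / 4) \<le> (\<gamma> + \<delta> * (\<alpha> + \<gamma>)) * real i"
      "\<And>i. i0 \<le> i \<Longrightarrow> L * real i powr (3 / 4) + (1 - \<gamma>) / 2 \<le> (1 - \<gamma>) / 2 * real i"
    unfolding eventually_sequentially by blast
  define C where "C = 2 / (1 - \<gamma>) + real i0 + 1"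
  show ?thesis
  proof (rule that[of C i0])
    show "0 < C" using \<gamma>_less_1 by (simp add: C_def add_nonneg_pos)
    fix \<omega> N i assume reg: "regular L \<omega> N" "i \<le> N"
    then have dev: "deviation \<omega> i \<le> L * real i powr (3 / 4)" by (simp add: regular_def)
    let ?A = "cnt From_New \<omega> i - \<alpha> * real i" and ?G = "cnt To_New \<omega> i - \<gamma> * real i"
    have AG: "\<bar>?A\<bar> + \<bar>?G\<bar> \<le> L * real i powr (3 / 4)" using dev by (simp add: deviation_def)
    show "real (frontier \<omega> i) + 1 + \<delta> \<le> weight \<omega> i" if "i0 \<le> i"
    proof -
      have "weight \<omega> i - real (frontier \<omega> i) - 1 - \<delta>
          = (\<gamma> + \<delta> * (\<alpha> + \<gamma>)) * real i + \<delta> * real n0 + (?G + \<delta> * (?A + ?G)) - 2 - \<delta>"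
        by (simp add: weight_def real_frontier algebra_simps)
      moreover have "- (?G + \<delta> * (?A + ?G)) \<le> (1 + \<delta>) * (L * real i powr (3 / 4))"
      proof -
        have "\<delta> * (- (?A + ?G)) \<le> \<delta> * (L * real i powr (3 / 4))" using AG \<delta> by (intro mult_left_mono) auto
        then show ?thesis using AG by (simp add: algebra_simps)
      qed
      moreover have "0 \<le> \<delta> * real n0" using \<delta> by simp
      ultimately show ?thesis using i0(1)[OF that] by (simp add: mult.assoc)
    qed
    show "real i + 1 \<le> C * (real (frontier \<omega> i) + 1)"
    proof (cases "i0 \<le> i")
      case True
      have "(1 - \<gamma>) / 2 * (real i + 1) \<le> (1 - \<gamma>) * real i - L * real i powr (3 / 4)"
        using i0(2)[OF True] by (simp add: field_simps)
      also have "\<dots> \<le> real (frontier \<omega> i) + 1"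
        using AG by (simp add: real_frontier algebra_simps)
      finally have "real i + 1 \<le> 2 / (1 - \<gamma>) * (real (frontier \<omega> i) + 1)"
        using \<gamma>_less_1 by (simp add: field_simps)
      also have "\<dots> \<le> C * (real (frontier \<omega> i) + 1)"
        by (intro mult_right_mono) (auto simp: C_def)
      finally show ?thesis .
    next
      case False
      then have "real i + 1 \<le> (real i0 + 1) * 1" by simp
      also have "\<dots> \<le> C * (real (frontier \<omega> i) + 1)"
        using \<gamma>_less_1 by (intro mult_mono) (auto simp: C_def)
      finally show ?thesis .
    qed
  qed
qed

end

section \<open>Elementary sums\<close>

lemma sum_flux: "(\<Sum>k\<le>m. flux \<delta> u k) = - (real m + \<delta>) * u m"
  by (induction m) (auto simp: algebra_simps)

lemma sum_inverse_sqrt_le: "(\<Sum>r<i. 1 / sqrt (real r + 1)) \<le> 2 * sqrt (real i)"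
proof (induction i)
  case (Suc i)
  define a where "a = sqrt (real i)"
  define b where "b = sqrt (real i + 1)"
  have ab: "a \<le> b" "0 \<le> a" "0 < b" "b * b - a * a = 1" by (auto simp: a_def b_def)
  have "1 = (b - a) * (b + a)" using ab(4) by (simp add: algebra_simps)
  also have "\<dots> \<le> (b - a) * (2 * b)" using ab by (intro mult_left_mono) auto
  finally have "1 \<le> (2 * b - 2 * a) * b" by (simp add: algebra_simps)
  then have "1 / b \<le> 2 * b - 2 * a" using pos_divide_le_eq[OF ab(3)] by blast
  moreover have "sqrt (real (Suc i)) = b" by (simp add: b_def add.commute)
  ultimately show ?case using Suc by (simp add: a_def[symmetric] b_def[symmetric])
qed simp

lemma sum_three_halves_tail:
  assumes "a \<le> n"
  shows "(\<Sum>r=a..<n. 1 / ((real r + 1) * sqrt (real r + 1))) \<le> 4 / sqrt (real a + 1)"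
proof -
  have step: "1 / ((real r + 1) * sqrt (real r + 1)) \<le> 4 / sqrt (real r + 1) - 4 / sqrt (real (Suc r) + 1)" for r
  proof -
    define x where "x = sqrt (real r + 1)"
    define y where "y = sqrt (real (Suc r) + 1)"
    have x: "1 \<le> x" "real r + 1 = x * x" and y: "0 < y" "y * y = x * x + 1"
      by (auto simp: x_def y_def)
    have le: "y * y \<le> (3 / 2 * x) * (3 / 2 * x)" using x y mult_mono[OF x(1) x(1)] by (simp add: algebra_simps)
    have yx: "y \<le> 3 / 2 * x"
    proof (rule ccontr)
      assume "\<not> y \<le> 3 / 2 * x"
      then have "(3 / 2 * x) * (3 / 2 * x) < y * y" using x(1) by (intro mult_strict_mono) auto
      with le show False by simp
    qed
    \<comment> \<open>The product on the right is \<open>15 / 4 * x * x\<close>, which is the origin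
      of the constant 4.\<close>
    have "y * (x + y) \<le> (3 / 2 * x) * (x + 3 / 2 * x)" using yx x(1) y(1) by (intro mult_mono) auto
    also have "\<dots> \<le> 4 * (x * x)" by (simp add: algebra_simps)
    finally have "y * (x + y) \<le> 4 * x * x * ((y - x) * (x + y))" using y(2) by (simp add: algebra_simps)
    then have "y \<le> 4 * x * x * (y - x)" using x(1) y(1)
      by (metis add_pos_pos less_le_trans mult.assoc mult_le_cancel_right_pos zero_less_one)
    then have "1 / (x * x * x) \<le> 4 / x - 4 / y" using x(1) y(1) by (simp add: field_simps)
    then show ?thesis unfolding x(2) x_def[symmetric] y_def[symmetric] using x(1)
      by (simp add: x_def[symmetric])
  qed
  have "(\<Sum>r=a..<n. 1 / ((real r + 1) * sqrt (real r + 1)))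
      \<le> (\<Sum>r=a..<n. 4 / sqrt (real r + 1) - 4 / sqrt (real (Suc r) + 1))"
    by (rule sum_mono) (rule step)
  also have "\<dots> = 4 / sqrt (real a + 1) - 4 / sqrt (real n + 1)"
    using sum_Suc_diff'[OF assms, of "\<lambda>r. - 4 / sqrt (real r + 1)"] by simp
  finally show ?thesis by (simp add: order_trans)
qed

section \<open>Comparison for the error recursion and an error bound of the order of the
  means\<close>

context attachment
begin

text \<open>What the deterministic analysis takes from the graph process. The bounds on
  \<open>mean\<close> come from its meaning as an expected number of vertices, see
  \<open>admissible_initial\<close>.\<close>

definition admissible :: "(nat \<Rightarrow> real) \<Rightarrow> (nat \<Rightarrow> step_kind) \<Rightarrow> nat \<Rightarrow> bool" where
  "admissible \<pi> \<omega> N \<longleftrightarrow> (\<forall>k>t0. \<pi> k = 0) \<and>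
     (\<forall>i\<le>N. \<forall>k. 0 \<le> mean \<pi> \<omega> i k \<and> mean \<pi> \<omega> i k \<le> real n0 + real i)"

text \<open>For \<open>k\<close> up to one above the frontier the coefficients \<open>p\<close> and
  \<open>q\<close> of the recursion are nonnegative, so bounds propagate. The part \<open>u\<close>
  follows the recursion itself, the part \<open>majorant k * s\<close> is enlarged to a multiple of
  the majorant, and the forcing joins the latter.\<close>

lemma err_step:
  assumes noise: "\<And>k. \<bar>flux \<delta> (noise \<omega> i) k\<bar> \<le> \<Lambda> * deviation \<omega> i * majorant k"
    and fr: "\<omega> i \<noteq> To_New \<Longrightarrow> real (frontier \<omega> i) + 1 + \<delta> \<le> weight \<omega> i"
    and s: "0 \<le> s"
    and bound: "\<And>k. k \<le> frontier \<omega> i + 1 \<Longrightarrow> \<bar>err \<pi> \<omega> i k\<bar> \<le> u k + majorant k * s"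
    and k: "k \<le> frontier \<omega> i + 1"
  shows "\<bar>err \<pi> \<omega> (Suc i) k\<bar> \<le> u k + rate \<omega> i * flux \<delta> u k
     + majorant k * (s * (1 + rate \<omega> i / c) + \<Lambda> * deviation \<omega> i / weight \<omega> i)"
proof -
  let ?r = "rate \<omega> i"
  define q where "q = 1 - ?r * (real k + \<delta>)"
  define p where "p = (if k = 0 then 0 else ?r * (real k - 1 + \<delta>))"
  have q: "0 \<le> q"
  proof (cases "\<omega> i = To_New")
    case False
    have "real k + \<delta> \<le> real (frontier \<omega> i) + 1 + \<delta>" using k by simp
    then have "real k + \<delta> \<le> weight \<omega> i" using fr[OF False] by linarith
    then show ?thesis using False weight_pos[of \<omega> i] by (simp add: q_def rate_def)
  qed (simp add: q_def rate_def)
  have p: "0 \<le> p" using rate_nonneg \<delta> by (auto simp: p_def)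
  have split: "v k + ?r * flux \<delta> v k = q * v k + p * v (k - 1)" for v
    by (simp add: q_def p_def flux_def algebra_simps)
  have "\<bar>err \<pi> \<omega> (Suc i) k\<bar> \<le> \<bar>q * err \<pi> \<omega> i k + p * err \<pi> \<omega> i (k - 1)\<bar> + \<bar>?r * flux \<delta> (noise \<omega> i) k\<bar>"
    unfolding err_Suc split by (rule abs_triangle_ineq)
  also have "\<bar>?r * flux \<delta> (noise \<omega> i) k\<bar> \<le> 1 / weight \<omega> i * (\<Lambda> * deviation \<omega> i * majorant k)"
    unfolding abs_mult using noise[of k] rate_le[of \<omega> i] rate_nonneg[of \<omega> i] weight_pos[of \<omega> i]
    by (intro mult_mono) auto
  also have "\<bar>q * err \<pi> \<omega> i k + p * err \<pi> \<omega> i (k - 1)\<bar>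
      \<le> q * \<bar>err \<pi> \<omega> i k\<bar> + p * \<bar>err \<pi> \<omega> i (k - 1)\<bar>"
    using abs_triangle_ineq[of "q * err \<pi> \<omega> i k" "p * err \<pi> \<omega> i (k - 1)"] q p by (simp add: abs_mult)
  also have "\<dots> \<le> q * (u k + majorant k * s) + p * (u (k - 1) + majorant (k - 1) * s)"
    using bound[of k] bound[of "k - 1"] k p q by (intro add_mono mult_left_mono) auto
  also have "\<dots> = (q * u k + p * u (k - 1)) + s * (q * majorant k + p * majorant (k - 1))"
    by (simp add: algebra_simps)
  also have "\<dots> = u k + ?r * flux \<delta> u k + s * (majorant k + ?r * flux \<delta> majorant k)"
    unfolding split ..
  also have "s * (majorant k + ?r * flux \<delta> majorant k) \<le> s * (majorant k + ?r * (majorant k / c))"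
    using flux_majorant_le[of k] s rate_nonneg[of \<omega> i] by (intro mult_left_mono add_left_mono)
  finally show ?thesis by (simp add: algebra_simps)
qed

lemma err_beyond_frontier:
  assumes "admissible \<pi> \<omega> N"
    and "\<bar>mean \<pi> \<omega> i k - err \<pi> \<omega> i k\<bar> \<le> b" "frontier \<omega> i < k"
  shows "\<bar>err \<pi> \<omega> i k\<bar> \<le> b"
  using assms mean_eq_0[of \<pi> \<omega> i k] by (simp add: admissible_def)

text \<open>Takes the place of the product of the factors \<open>1 + rate / c\<close>, which it
  dominates by \<open>growth_Suc\<close>; the exponential form makes \<open>log_growth_ln\<close>
  applicable.\<close>

definition growth :: "(nat \<Rightarrow> step_kind) \<Rightarrow> nat \<Rightarrow> real" where
  "growth \<omega> i = exp (log_growth \<omega> i)"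

lemma growth_pos [simp]: "0 < growth \<omega> i"
  by (simp add: growth_def)

lemma growth_Suc: "growth \<omega> i * (1 + rate \<omega> i / c) \<le> growth \<omega> (Suc i)"
  using exp_ge_add_one_self[of "rate \<omega> i / c"]
  by (simp add: growth_def log_growth_def exp_add)

lemma growth_bounds:
  assumes "0 \<le> L"
  obtains E where "1 \<le> E"
    "\<And>\<omega> N i. regular L \<omega> N \<Longrightarrow> i \<le> N \<Longrightarrow> growth \<omega> i \<le> E * (real i + 1)"
    "\<And>\<omega> N i. regular L \<omega> N \<Longrightarrow> i \<le> N \<Longrightarrow> real i + 1 \<le> E * growth \<omega> i"
proof -
  obtain C where C: "0 \<le> C"
    "\<And>\<omega> N i. regular L \<omega> N \<Longrightarrow> i \<le> N \<Longrightarrow> \<bar>log_growth \<omega> i - ln (real i + 1)\<bar> \<le> C"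
    using log_growth_ln[OF assms] by blast
  show ?thesis
  proof (rule that[of "exp C"])
    show "1 \<le> exp C" using C by simp
    fix \<omega> N i assume "regular L \<omega> N" "i \<le> N"
    then have "log_growth \<omega> i \<le> C + ln (real i + 1)" "ln (real i + 1) \<le> C + log_growth \<omega> i"
      using C(2)[of \<omega> N i] by linarith+
    then have "exp (log_growth \<omega> i) \<le> exp (C + ln (real i + 1))"
      "exp (ln (real i + 1)) \<le> exp (C + log_growth \<omega> i)"
      by (simp_all only: exp_le_cancel_iff)
    then show "growth \<omega> i \<le> exp C * (real i + 1)" "real i + 1 \<le> exp C * growth \<omega> i"
      by (simp_all add: exp_add growth_def)
  qed
qed

text \<open>Relative to \<open>growth\<close>, the forcing at time \<open>r\<close> has order
  \<open>r powr (- (5 / 4))\<close>, which is summable; so the error stays of the order of the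
  means. This starts the finer argument at a fixed time and bounds the means from above.\<close>

lemma err_crude:
  assumes L: "0 \<le> L"
  obtains C :: real and i0 :: nat where "0 < C"
    "\<And>\<pi> \<omega> N i k. regular L \<omega> N \<Longrightarrow> admissible \<pi> \<omega> N \<Longrightarrow> i0 \<le> i \<Longrightarrow> i \<le> N \<Longrightarrow>
       \<bar>err \<pi> \<omega> i k\<bar> \<le> C * (real i + 1) * majorant k"
proof -
  obtain \<Lambda> where \<Lambda>: "0 < \<Lambda>"
    "\<And>\<omega> i k. \<bar>flux \<delta> (noise \<omega> i) k\<bar> \<le> \<Lambda> * deviation \<omega> i * majorant k"
    using noise_bounds by metis
  obtain D where D: "0 < D"
    "\<And>\<pi> \<omega> N i k. regular L \<omega> N \<Longrightarrow> i \<le> N \<Longrightarrow>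
       \<bar>mean \<pi> \<omega> i k - err \<pi> \<omega> i k\<bar> \<le> D * (real i + 1) * majorant k"
    using abs_mean_minus_err[OF L] by blast
  obtain E where E: "1 \<le> E"
    "\<And>\<omega> N i. regular L \<omega> N \<Longrightarrow> i \<le> N \<Longrightarrow> growth \<omega> i \<le> E * (real i + 1)"
    "\<And>\<omega> N i. regular L \<omega> N \<Longrightarrow> i \<le> N \<Longrightarrow> real i + 1 \<le> E * growth \<omega> i"
    using growth_bounds[OF L] by blast
  obtain i0 :: nat where i0:
    "\<And>\<omega> N i. regular L \<omega> N \<Longrightarrow> i0 \<le> i \<Longrightarrow> i \<le> N \<Longrightarrow> real (frontier \<omega> i) + 1 + \<delta> \<le> weight \<omega> i"
    using frontier_regular by metis
  obtain P :: real where P: "0 \<le> P" "\<And>i. (\<Sum>r<i. (real r + 1) powr (- (5 / 4))) \<le> P"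
    using bounded_sum_powr by blast
  define p where "p r = (real r + 1) powr (- (5 / 4))" for r
  \<comment> \<open>At time \<open>i0\<close> only degrees up to \<open>t0 + 1 + i0\<close> lie
    below the frontier, so finitely many reciprocals turn the trivial bound \<open>n0 + i0\<close>
    on \<open>mean\<close> into a multiple of \<open>majorant\<close>.\<close>
  define H where "H = (\<Sum>k\<le>t0 + 1 + i0. 1 / majorant k)"
  define S0 where "S0 = E * (D + (real n0 + real i0) * H)"
  define A where "A = \<Lambda> * L * E / w_low"
  define S where "S i = S0 + A * (\<Sum>r<i. p r)" for i
  have H: "1 \<le> H * majorant k" if "k \<le> t0 + 1 + i0" for k
  proof -
    have "1 / majorant k \<le> H" unfolding H_def
      using that majorant_pos by (intro member_le_sum) (auto simp: less_imp_le)
    then show ?thesis using majorant_pos[of k] by (simp add: divide_le_eq)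
  qed
  have H_nn: "0 \<le> H" unfolding H_def using majorant_pos by (intro sum_nonneg) (auto simp: less_imp_le)
  have A_nn: "0 \<le> A" using \<Lambda> L E w_low_pos by (simp add: A_def)
  have S_ge: "S0 \<le> S i" for i using A_nn by (auto simp: S_def p_def intro!: mult_nonneg_nonneg sum_nonneg)
  have S0_nn: "0 \<le> S0" using E D H_nn by (simp add: S0_def)
  define C where "C = E * (S0 + A * P) + 1"
  show ?thesis
  proof (rule that[of C i0])
    show "0 < C" using E S0_nn A_nn P by (auto simp: C_def intro!: add_nonneg_pos)
    fix \<pi> \<omega> N i k
    assume reg: "regular L \<omega> N" and adm: "admissible \<pi> \<omega> N" and i: "i0 \<le> i" "i \<le> N"
    have S0_ge: "(D + (real n0 + real i0) * H) * (real i + 1) \<le> growth \<omega> i * S i" if "i \<le> N" for i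
    proof -
      have "(D + (real n0 + real i0) * H) * (real i + 1) \<le> (D + (real n0 + real i0) * H) * (E * growth \<omega> i)"
        using E(3)[OF reg that] D H_nn by (intro mult_left_mono) auto
      also have "\<dots> = growth \<omega> i * S0" by (simp add: S0_def)
      also have "\<dots> \<le> growth \<omega> i * S i" using S_ge by (intro mult_left_mono) (auto simp: less_imp_le)
      finally show ?thesis .
    qed
    have D_le: "D * (real i + 1) * majorant k \<le> majorant k * (growth \<omega> i * S i)" if "i \<le> N" for i k
    proof -
      have "D * (real i + 1) \<le> (D + (real n0 + real i0) * H) * (real i + 1)"
        using H_nn by (intro mult_right_mono) auto
      then have "D * (real i + 1) \<le> growth \<omega> i * S i" using S0_ge[OF that] by linarith
      then show ?thesis using majorant_pos[of k] by (simp add: mult.commute)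
    qed
    have far: "\<bar>err \<pi> \<omega> i k\<bar> \<le> majorant k * (growth \<omega> i * S i)" if "i \<le> N" "frontier \<omega> i < k" for i k
      using err_beyond_frontier[OF adm D(2)[OF reg that(1)] that(2)] D_le[OF that(1), of k] by linarith
    have "\<bar>err \<pi> \<omega> i k\<bar> \<le> majorant k * (growth \<omega> i * S i)" for k
      using i
    proof (induction i arbitrary: k rule: dec_induct)
      case base
      show ?case
      proof (cases "frontier \<omega> i0 < k")
        case True
        then show ?thesis using far base by blast
      next
        case False
        then have k: "k \<le> t0 + 1 + i0" using frontier_le[of \<omega> i0] by linarith
        have "\<bar>mean \<pi> \<omega> i0 k\<bar> \<le> (real n0 + real i0) * 1"
          using adm base by (simp add: admissible_def)
        also have "\<dots> \<le> (real n0 + real i0) * (H * majorant k)" using H[OF k] by (intro mult_left_mono) auto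
        also have "\<dots> \<le> (real n0 + real i0) * (H * majorant k) * (real i0 + 1)"
          using mult_left_mono[of 1 "real i0 + 1" "(real n0 + real i0) * (H * majorant k)"]
            H_nn majorant_pos[of k] by simp
        finally have "\<bar>err \<pi> \<omega> i0 k\<bar> \<le> (real n0 + real i0) * (H * majorant k) * (real i0 + 1) + D * (real i0 + 1) * majorant k"
          using D(2)[OF reg base, of \<pi> k] by linarith
        also have "\<dots> = majorant k * ((D + (real n0 + real i0) * H) * (real i0 + 1))" by (simp add: algebra_simps)
        also have "\<dots> \<le> majorant k * (growth \<omega> i0 * S i0)"
          using S0_ge[OF base] majorant_pos[of k] by (intro mult_left_mono) auto
        finally show ?thesis .
      qed
    next
      case (step i)
      show ?case
      proof (cases "k \<le> frontier \<omega> i + 1")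
        case False
        then show ?thesis using far[of "Suc i" k] step.prems by (auto simp: frontier_Suc split: if_splits)
      next
        case True
        let ?b = "\<Lambda> * deviation \<omega> i / weight \<omega> i"
        have "?b \<le> \<Lambda> * (L * (real i + 1) powr (3 / 4)) / (w_low * (real i + 1))"
        proof (intro frac_le mult_left_mono weight_ge)
          have "deviation \<omega> i \<le> L * real i powr (3 / 4)" using reg step.prems by (simp add: regular_def)
          also have "\<dots> \<le> L * (real i + 1) powr (3 / 4)" using L by (intro mult_left_mono powr_mono2) auto
          finally show "deviation \<omega> i \<le> L * (real i + 1) powr (3 / 4)" .
        qed (use \<Lambda> L w_low_pos in auto)
        also have "\<dots> = (\<Lambda> * L / w_low) * ((real i + 1) powr (3 / 4) / (real i + 1))" by simp
        also have "(real i + 1) powr (3 / 4) / (real i + 1) = p i * (real i + 1)"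
        proof -
          have "(real i + 1) powr (3 / 4) / (real i + 1) powr 1 = p i * (real i + 1) powr 1"
            unfolding p_def powr_diff[symmetric] powr_add[symmetric] by simp
          then show ?thesis by simp
        qed
        also have "(\<Lambda> * L / w_low) * (p i * (real i + 1)) \<le> (\<Lambda> * L / w_low) * (p i * (E * growth \<omega> (Suc i)))"
          using E(3)[OF reg step.prems] \<Lambda> L w_low_pos by (intro mult_left_mono) (auto simp: p_def)
        finally have b: "?b \<le> growth \<omega> (Suc i) * (A * p i)" by (simp add: A_def mult_ac)
        have "\<bar>err \<pi> \<omega> (Suc i) k\<bar> \<le> 0 + rate \<omega> i * flux \<delta> (\<lambda>_. 0) k
            + majorant k * (growth \<omega> i * S i * (1 + rate \<omega> i / c) + ?b)"
        proof (rule err_step[where u = "\<lambda>_. 0"])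
          show "real (frontier \<omega> i) + 1 + \<delta> \<le> weight \<omega> i" using i0[OF reg] step by simp
          show "0 \<le> growth \<omega> i * S i" using S0_nn S_ge[of i] by (simp add: less_imp_le)
          show "\<bar>err \<pi> \<omega> i k\<bar> \<le> 0 + majorant k * (growth \<omega> i * S i)" for k
            using step by simp
        qed (use \<Lambda> True in auto)
        also have "\<dots> = majorant k * (growth \<omega> i * (1 + rate \<omega> i / c) * S i + ?b)"
          by (simp add: flux_def mult_ac)
        also have "\<dots> \<le> majorant k * (growth \<omega> (Suc i) * S i + growth \<omega> (Suc i) * (A * p i))"
          using b growth_Suc S0_nn S_ge[of i] majorant_pos[of k]
          by (intro mult_left_mono add_mono mult_right_mono) (auto simp: less_imp_le)
        also have "\<dots> = majorant k * (growth \<omega> (Suc i) * S (Suc i))" by (simp add: S_def algebra_simps)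
        finally show ?thesis .
      qed
    qed
    also have "majorant k * (growth \<omega> i * S i) \<le> majorant k * (E * (real i + 1) * (S0 + A * P))"
      using E(1) E(2)[OF reg i(2)] P(2)[of i] A_nn S0_nn S_ge[of i] majorant_pos[of k]
      by (intro mult_left_mono mult_mono) (auto simp: S_def p_def intro!: mult_left_mono)
    also have "\<dots> \<le> C * (real i + 1) * majorant k"
      using majorant_pos[of k] by (simp add: C_def algebra_simps)
    finally show "\<bar>err \<pi> \<omega> i k\<bar> \<le> C * (real i + 1) * majorant k" .
  qed
qed

section \<open>Mass and majorant parts of the error, and closeness of the means to the limit\<close>

lemma sum_frontier_le:
  assumes "\<And>k. 0 \<le> g k"
  shows "(\<Sum>r<i. of_bool (\<omega> r \<noteq> To_New) * g (Suc (frontier \<omega> r))) \<le> (\<Sum>k\<le>frontier \<omega> i. g k :: real)"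
  using assms by (induction i) (auto simp: frontier_Suc sum_nonneg)

text \<open>
  The error is split into a part of bounded total mass, which the recursion does not increase, and a
  part dominated by a multiple of the majorant, which grows linearly in time.
\<close>
definition dominated :: "(nat \<Rightarrow> real) \<Rightarrow> (nat \<Rightarrow> step_kind) \<Rightarrow> nat \<Rightarrow> real \<Rightarrow> real \<Rightarrow> bool" where
  "dominated \<pi> \<omega> i U s \<longleftrightarrow> (\<exists>u. (\<forall>k\<le>frontier \<omega> i. 0 \<le> u k \<and> \<bar>err \<pi> \<omega> i k\<bar> \<le> u k + majorant k * s)
     \<and> (\<Sum>k\<le>frontier \<omega> i. u k) \<le> U)"

lemma dominated_mono:
  assumes "dominated \<pi> \<omega> i U s" "U \<le> U'" "s \<le> s'"
  shows "dominated \<pi> \<omega> i U' s'"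
proof -
  have "majorant k * s \<le> majorant k * s'" for k
    using assms(3) majorant_pos[of k] by (intro mult_left_mono) auto
  then show ?thesis using assms unfolding dominated_def by (meson add_left_mono order_trans)
qed

text \<open>The majorant is summable, so a multiple of it can be booked as mass instead of being
  amplified in later steps.\<close>

lemma dominated_to_mass:
  assumes "dominated \<pi> \<omega> i U s" "0 \<le> s" "\<And>n. (\<Sum>k\<le>n. majorant k) \<le> M"
  shows "dominated \<pi> \<omega> i (U + M * s) 0"
proof -
  obtain u where u: "\<And>k. k \<le> frontier \<omega> i \<Longrightarrow> 0 \<le> u k \<and> \<bar>err \<pi> \<omega> i k\<bar> \<le> u k + majorant k * s"
    "(\<Sum>k\<le>frontier \<omega> i. u k) \<le> U" using assms(1) unfolding dominated_def by blast
  have "(\<Sum>k\<le>frontier \<omega> i. majorant k * s) \<le> M * s"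
    unfolding sum_distrib_right[symmetric] using assms by (intro mult_right_mono)
  moreover have "0 \<le> majorant k * s" for k using majorant_pos[of k] assms(2) by simp
  ultimately show ?thesis unfolding dominated_def using u
    by (intro exI[of _ "\<lambda>k. u k + majorant k * s"]) (auto simp: sum.distrib)
qed

text \<open>The flux telescopes to minus the outflow at the top, so the recursion adds no mass. Mass
  enters only when the frontier advances: the error at the new index, at most \<open>R\<close>, is
  then counted in full.\<close>

lemma dominated_step:
  assumes dom: "dominated \<pi> \<omega> i U s"
    and noise: "\<And>k. \<bar>flux \<delta> (noise \<omega> i) k\<bar> \<le> \<Lambda> * deviation \<omega> i * majorant k" and "0 \<le> \<Lambda>"
    and fr: "real (frontier \<omega> i) + 1 + \<delta> \<le> weight \<omega> i"
    and s: "0 \<le> s"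
    and R: "\<bar>err \<pi> \<omega> i (Suc (frontier \<omega> i))\<bar> \<le> R"
  shows "dominated \<pi> \<omega> (Suc i) (U + of_bool (\<omega> i \<noteq> To_New) * R)
    (s * (1 + rate \<omega> i / c) + \<Lambda> * deviation \<omega> i / weight \<omega> i)"
proof -
  let ?F = "frontier \<omega> i" and ?s' = "s * (1 + rate \<omega> i / c) + \<Lambda> * deviation \<omega> i / weight \<omega> i"
  have b: "0 \<le> \<Lambda> * deviation \<omega> i / weight \<omega> i" using assms(3) weight_pos[of \<omega> i] by simp
  show ?thesis
  proof (cases "\<omega> i = To_New")
    case True
    then have "err \<pi> \<omega> (Suc i) = err \<pi> \<omega> i" by (auto simp: err_Suc rate_def)
    then have "dominated \<pi> \<omega> (Suc i) U s"
      using dom True by (simp add: dominated_def frontier_Suc)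
    then show ?thesis by (rule dominated_mono) (use True b in \<open>auto simp: rate_def\<close>)
  next
    case False
    obtain u where u: "\<And>k. k \<le> ?F \<Longrightarrow> 0 \<le> u k \<and> \<bar>err \<pi> \<omega> i k\<bar> \<le> u k + majorant k * s"
      "(\<Sum>k\<le>?F. u k) \<le> U" using dom unfolding dominated_def by blast
    define v where "v = u(Suc ?F := R)"
    have R0: "0 \<le> R" using R by linarith
    have v: "0 \<le> v k" "\<bar>err \<pi> \<omega> i k\<bar> \<le> v k + majorant k * s" if "k \<le> Suc ?F" for k
      using u(1)[of k] that R R0 s majorant_pos[of k] by (auto simp: v_def le_Suc_eq intro: add_increasing2)
    have nn: "0 \<le> v k + rate \<omega> i * flux \<delta> v k" if "k \<le> Suc ?F" for k
    proof -
      have "real k + \<delta> \<le> weight \<omega> i" using that fr by linarith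
      then have "0 \<le> 1 - rate \<omega> i * (real k + \<delta>)" using False weight_pos[of \<omega> i] by (simp add: rate_def)
      then have "0 \<le> (1 - rate \<omega> i * (real k + \<delta>)) * v k + (if k = 0 then 0 else rate \<omega> i * (real k - 1 + \<delta>) * v (k - 1))"
        using v(1)[of k] v(1)[of "k - 1"] that rate_nonneg[of \<omega> i] \<delta> by (auto intro!: add_nonneg_nonneg)
      then show ?thesis by (simp add: flux_def algebra_simps split: if_splits)
    qed
    have step: "\<bar>err \<pi> \<omega> (Suc i) k\<bar> \<le> v k + rate \<omega> i * flux \<delta> v k + majorant k * ?s'" if "k \<le> Suc ?F" for k
      by (rule err_step) (use noise fr s v that in auto)
    have "(\<Sum>k\<le>Suc ?F. v k + rate \<omega> i * flux \<delta> v k)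
        = (\<Sum>k\<le>Suc ?F. v k) + rate \<omega> i * (\<Sum>k\<le>Suc ?F. flux \<delta> v k)"
      by (simp only: sum.distrib sum_distrib_left)
    also have "\<dots> \<le> (\<Sum>k\<le>Suc ?F. v k)"
    proof -
      have "rate \<omega> i * (- (real (Suc ?F) + \<delta>) * v (Suc ?F)) \<le> 0"
        using rate_nonneg v(1)[of "Suc ?F"] \<delta> by (intro mult_nonneg_nonpos mult_nonpos_nonneg) auto
      then show ?thesis unfolding sum_flux by simp
    qed
    also have "\<dots> = (\<Sum>k\<le>?F. u k) + R" by (simp add: v_def)
    also have "\<dots> \<le> U + R" using u(2) by simp
    finally show ?thesis unfolding dominated_def using False nn step
      by (intro exI[of _ "\<lambda>k. v k + rate \<omega> i * flux \<delta> v k"]) (simp add: frontier_Suc)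
  qed
qed

text \<open>
  With \<open>x = majorant d * (N + 1)\<close>, perturbations before time \<open>x\<close> are bounded by their total mass and
  later ones by a multiple of the majorant; both contribute at most \<open>O(\<kappa> * sqrt x)\<close>.
\<close>

lemma mean_close:
  assumes L: "0 \<le> L"
  obtains C :: real and i0 :: nat where "0 < C"
    "\<And>\<pi> \<omega> N d \<kappa>. regular L \<omega> N \<Longrightarrow> admissible \<pi> \<omega> N \<Longrightarrow> i0 \<le> N \<Longrightarrow> 1 \<le> \<kappa> \<Longrightarrow>
       (\<And>i. i \<le> N \<Longrightarrow> deviation \<omega> i \<le> \<kappa> * sqrt (real i)) \<Longrightarrow>
       1 \<le> majorant d * (real N + 1) \<Longrightarrow>
       \<bar>mean \<pi> \<omega> N d - f d * (real t0 + real N)\<bar> \<le> C * \<kappa> * sqrt (majorant d * (real N + 1))"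
proof -
  obtain \<Lambda> where \<Lambda>: "0 < \<Lambda>"
    "\<And>\<omega> i k. \<bar>noise \<omega> i k\<bar> \<le> \<Lambda> * deviation \<omega> i * majorant k"
    "\<And>\<omega> i k. \<bar>flux \<delta> (noise \<omega> i) k\<bar> \<le> \<Lambda> * deviation \<omega> i * majorant k"
    using noise_bounds by metis
  obtain D where D: "0 < D"
    "\<And>\<pi> \<omega> N i k. regular L \<omega> N \<Longrightarrow> i \<le> N \<Longrightarrow>
       \<bar>mean \<pi> \<omega> i k - err \<pi> \<omega> i k\<bar> \<le> D * (real i + 1) * majorant k"
    by (rule abs_mean_minus_err[OF L], rule that; blast)
  obtain E where E: "1 \<le> E"
    "\<And>\<omega> N i. regular L \<omega> N \<Longrightarrow> i \<le> N \<Longrightarrow> growth \<omega> i \<le> E * (real i + 1)"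
    "\<And>\<omega> N i. regular L \<omega> N \<Longrightarrow> i \<le> N \<Longrightarrow> real i + 1 \<le> E * growth \<omega> i"
    by (rule growth_bounds[OF L], rule that; blast)
  obtain i1 :: nat and C1 where i1: "0 < C1"
    "\<And>\<omega> N i. regular L \<omega> N \<Longrightarrow> i1 \<le> i \<Longrightarrow> i \<le> N \<Longrightarrow> real (frontier \<omega> i) + 1 + \<delta> \<le> weight \<omega> i"
    "\<And>\<omega> N i. regular L \<omega> N \<Longrightarrow> i \<le> N \<Longrightarrow> real i + 1 \<le> C1 * (real (frontier \<omega> i) + 1)"
    by (rule frontier_regular[of L], rule that; blast)
  obtain C2 :: real and i2 :: nat where C2: "0 < C2"
    "\<And>\<pi> \<omega> N i k. regular L \<omega> N \<Longrightarrow> admissible \<pi> \<omega> N \<Longrightarrow> i2 \<le> i \<Longrightarrow> i \<le> N \<Longrightarrow>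
       \<bar>err \<pi> \<omega> i k\<bar> \<le> C2 * (real i + 1) * majorant k"
    by (rule err_crude[OF L], rule that; blast)
  obtain M where M: "0 < M" "\<And>n. (\<Sum>k\<le>n. (real k + 1) * majorant k) \<le> M"
    using sum_weighted_majorant_bounded by blast
  have majorant_le: "(real k + 1) * majorant k \<le> M" for k
  proof -
    have "(real k + 1) * majorant k \<le> (\<Sum>j\<le>k. (real j + 1) * majorant j)"
      using majorant_pos by (intro member_le_sum) (auto simp: less_imp_le)
    then show ?thesis using M(2)[of k] by linarith
  qed
  have majorant_le1: "majorant k \<le> (real k + 1) * majorant k" for k
    using majorant_pos[of k] by (simp add: distrib_right)
  have sum_majorant: "(\<Sum>k\<le>n. majorant k) \<le> M" for n
    by (rule order_trans[OF sum_mono[OF majorant_le1] M(2)])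
  define i0 where "i0 = max i1 i2"
  define B where "B = \<Lambda> / w_low"
  define U0 where "U0 = C2 * (real i0 + 1) * M"
  \<comment> \<open>The price of comparing with \<open>f d * t\<close> instead of
    \<open>f d * weight / w\<close>: their initial values differ.\<close>
  define K0 where "K0 = \<bar>real t0 + \<delta> * real n0 - w * real t0\<bar>"
  define CU where "CU = U0 + M * B * 2 * (sqrt (real i0) + 1) + D * C1 * M"
  define C where "C = CU + 4 * E\<^sup>2 * B + D * sqrt (C1 * M) + \<Lambda> * sqrt M + \<delta> * sqrt M + M * K0"
  have B: "0 < B" using \<Lambda>(1) w_low_pos by (simp add: B_def)
  have nn: "0 < B" "0 < U0" "0 \<le> K0" "0 \<le> \<delta> * sqrt M" "0 < sqrt M" "0 < \<Lambda> * sqrt M" "0 < D * sqrt (C1 * M)"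
    "0 < D * C1 * M" "0 < M * B * 2 * (sqrt (real i0) + 1)"
    unfolding U0_def K0_def using B \<Lambda>(1) C2(1) M(1) D(1) i1(1) \<delta>
    by (auto intro!: mult_pos_pos add_nonneg_pos)
  have CB: "0 \<le> 4 * E\<^sup>2 * B" using B by simp
  have CU: "0 < CU" unfolding CU_def by (intro add_pos_pos nn)
  have C: "0 < C" unfolding C_def
    by (intro add_pos_nonneg mult_nonneg_nonneg CU nn CB less_imp_le[OF nn(6)] less_imp_le[OF nn(7)] less_imp_le[OF M(1)])
  show ?thesis
  proof (rule that[of C i0])
    show "0 < C" by (rule C)
    fix \<pi> \<omega> N d and \<kappa> :: real
    assume reg: "regular L \<omega> N" and adm: "admissible \<pi> \<omega> N" and N: "i0 \<le> N" and \<kappa>: "1 \<le> \<kappa>"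
      and dev: "\<And>i. i \<le> N \<Longrightarrow> deviation \<omega> i \<le> \<kappa> * sqrt (real i)"
      and x1: "1 \<le> majorant d * (real N + 1)"
    define x where "x = majorant d * (real N + 1)"
    define R where "R r = D * (real r + 1) * majorant (Suc (frontier \<omega> r))" for r
    define Rs where "Rs i = (\<Sum>r<i. of_bool (\<omega> r \<noteq> To_New) * R r)" for i
    define b where "b r = \<Lambda> * deviation \<omega> r / weight \<omega> r" for r
    have x: "1 \<le> x" "1 \<le> sqrt x" using x1 by (simp_all add: x_def)
    have R_nn: "0 \<le> R r" for r using D(1) majorant_pos[of "Suc (frontier \<omega> r)"] by (simp add: R_def)
    have b_nn: "0 \<le> b r" for r using \<Lambda>(1) weight_pos[of \<omega> r] by (simp add: b_def)
    \<comment> \<open>All mass entering at the frontier is bounded: time is at most a multiple of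
      the frontier, the frontier passes each degree at most once, and \<open>majorant\<close> has a
      finite first moment.\<close>
    have Rs_le: "Rs N \<le> D * C1 * M"
    proof -
      have "Rs N \<le> (\<Sum>r<N. of_bool (\<omega> r \<noteq> To_New) *
          (D * C1 * ((real (Suc (frontier \<omega> r)) + 1) * majorant (Suc (frontier \<omega> r)))))"
        unfolding Rs_def R_def
      proof (intro sum_mono mult_left_mono)
        fix r assume "r \<in> {..<N}"
        then have "real r + 1 \<le> C1 * (real (frontier \<omega> r) + 1)" using i1(3)[OF reg, of r] by simp
        also have "\<dots> \<le> C1 * (real (Suc (frontier \<omega> r)) + 1)" using i1(1) by (intro mult_left_mono) auto
        finally have "D * (real r + 1) * majorant (Suc (frontier \<omega> r))
            \<le> D * (C1 * (real (Suc (frontier \<omega> r)) + 1)) * majorant (Suc (frontier \<omega> r))"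
          using D(1) majorant_pos[of "Suc (frontier \<omega> r)"] by (intro mult_right_mono mult_left_mono) auto
        then show "D * (real r + 1) * majorant (Suc (frontier \<omega> r))
            \<le> D * C1 * ((real (Suc (frontier \<omega> r)) + 1) * majorant (Suc (frontier \<omega> r)))"
          by (simp only: mult_ac)
      qed auto
      also have "\<dots> \<le> (\<Sum>k\<le>frontier \<omega> N. D * C1 * ((real k + 1) * majorant k))"
        using D(1) i1(1) majorant_pos by (intro sum_frontier_le) (auto simp: less_imp_le)
      also have "\<dots> = D * C1 * (\<Sum>k\<le>frontier \<omega> N. (real k + 1) * majorant k)"
        by (simp add: sum_distrib_left)
      also have "\<dots> \<le> D * C1 * M" using D(1) i1(1) by (intro mult_left_mono M(2)) auto
      finally show ?thesis .
    qed
    have b_le: "b r \<le> B * \<kappa> * (1 / sqrt (real r + 1))" if "r < N" for r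
    proof -
      have "b r \<le> \<Lambda> * (\<kappa> * sqrt (real r + 1)) / (w_low * (real r + 1))"
        unfolding b_def
      proof (intro frac_le mult_left_mono weight_ge)
        have "deviation \<omega> r \<le> \<kappa> * sqrt (real r)" using dev that by simp
        also have "\<dots> \<le> \<kappa> * sqrt (real r + 1)" using \<kappa> by (intro mult_left_mono) auto
        finally show "deviation \<omega> r \<le> \<kappa> * sqrt (real r + 1)" .
      qed (use \<Lambda>(1) \<kappa> w_low_pos in auto)
      also have "\<dots> = B * \<kappa> * (sqrt (real r + 1) / (real r + 1))" by (simp add: B_def)
      also have "sqrt (real r + 1) / (real r + 1) = 1 / sqrt (real r + 1)"
        using real_div_sqrt[of "real r + 1"] by (simp add: field_simps)
      finally show ?thesis .
    qed
    have propagate: "dominated \<pi> \<omega> (Suc i) (U + of_bool (\<omega> i \<noteq> To_New) * R i) (s * (1 + rate \<omega> i / c) + b i)"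
      if "dominated \<pi> \<omega> i U s" "0 \<le> s" "i0 \<le> i" "i < N" for i U s
      unfolding b_def
    proof (rule dominated_step[OF that(1) \<Lambda>(3)])
      show "real (frontier \<omega> i) + 1 + \<delta> \<le> weight \<omega> i" using i1(2)[OF reg, of i] that by (simp add: i0_def)
      show "\<bar>err \<pi> \<omega> i (Suc (frontier \<omega> i))\<bar> \<le> R i"
        unfolding R_def by (rule err_beyond_frontier[OF adm D(2)[OF reg]]) (use that in auto)
    qed (use \<Lambda>(1) that in auto)
    \<comment> \<open>The forcing of each step is turned into mass at once, so the majorant part
      stays 0.\<close>
    have phase1: "dominated \<pi> \<omega> i (U0 + M * (\<Sum>r<i. b r) + Rs i) 0" if "i0 \<le> i" "i \<le> N" for i
      using that
    proof (induction i rule: dec_induct)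
      case base
      have "dominated \<pi> \<omega> i0 U0 0"
        unfolding dominated_def
      proof (intro exI[of _ "\<lambda>k. C2 * (real i0 + 1) * majorant k"] conjI allI impI)
        show "\<bar>err \<pi> \<omega> i0 k\<bar> \<le> C2 * (real i0 + 1) * majorant k + majorant k * 0" for k
          using C2(2)[OF reg adm, of i0 k] N by (simp add: i0_def)
        show "0 \<le> C2 * (real i0 + 1) * majorant k" for k using C2(1) majorant_pos[of k] by simp
        show "(\<Sum>k\<le>frontier \<omega> i0. C2 * (real i0 + 1) * majorant k) \<le> U0"
          unfolding U0_def sum_distrib_left[symmetric] using C2(1) by (intro mult_left_mono sum_majorant) auto
      qed
      moreover have "0 \<le> M * (\<Sum>r<i0. b r) + Rs i0"
        using M(1) b_nn R_nn by (auto simp: Rs_def intro!: add_nonneg_nonneg mult_nonneg_nonneg sum_nonneg)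
      ultimately show ?case by (elim dominated_mono) auto
    next
      case (step i)
      then have "dominated \<pi> \<omega> (Suc i) (U0 + M * (\<Sum>r<i. b r) + Rs i + of_bool (\<omega> i \<noteq> To_New) * R i) (b i)"
        using propagate[of i _ 0]
        by fastforce
      from dominated_to_mass[OF this b_nn sum_majorant]
      show ?case by (rule dominated_mono) (auto simp: Rs_def algebra_simps)
    qed
    \<comment> \<open>Switching at time \<open>j\<close> costs \<open>sqrt j\<close> from the early
      perturbations and \<open>x / sqrt j\<close> from the late ones, up to constants and \<kappa>;
      these balance at \<open>j\<close> near \<open>x\<close>.\<close>
    define j where "j = max i0 (min N (nat \<lfloor>x\<rfloor>))"
    have j: "i0 \<le> j" "j \<le> N" using N by (auto simp: j_def)
    \<comment> \<open>Variation of constants: the forcing at time \<open>r\<close> is amplified from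
      time \<open>r + 1\<close> on.\<close>
    have phase2: "dominated \<pi> \<omega> i (U0 + M * (\<Sum>r<j. b r) + Rs i) (growth \<omega> i * (\<Sum>r=j..<i. b r / growth \<omega> (Suc r)))"
      if "j \<le> i" "i \<le> N" for i
      using that
    proof (induction i rule: dec_induct)
      case base
      then show ?case using phase1[OF j] by simp
    next
      case (step i)
      let ?S = "\<Sum>r=j..<i. b r / growth \<omega> (Suc r)"
      have S: "0 \<le> ?S" using b_nn by (intro sum_nonneg) (simp add: less_imp_le)
      have "dominated \<pi> \<omega> (Suc i) (U0 + M * (\<Sum>r<j. b r) + Rs i + of_bool (\<omega> i \<noteq> To_New) * R i)
          (growth \<omega> i * ?S * (1 + rate \<omega> i / c) + b i)"
        using step S j by (intro propagate)
          (auto simp: less_imp_le)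
      moreover have "growth \<omega> i * ?S * (1 + rate \<omega> i / c) + b i
          \<le> growth \<omega> (Suc i) * (\<Sum>r=j..<Suc i. b r / growth \<omega> (Suc r))"
      proof -
        have "growth \<omega> i * (1 + rate \<omega> i / c) * ?S \<le> growth \<omega> (Suc i) * ?S"
          using growth_Suc S by (rule mult_right_mono)
        then have "growth \<omega> i * ?S * (1 + rate \<omega> i / c) \<le> growth \<omega> (Suc i) * ?S"
          by (simp only: mult_ac)
        moreover have "growth \<omega> (Suc i) * (b i / growth \<omega> (Suc i)) = b i"
          using growth_pos[of \<omega> "Suc i"] by (simp del: growth_pos)
        moreover have "(\<Sum>r=j..<Suc i. b r / growth \<omega> (Suc r)) = ?S + b i / growth \<omega> (Suc i)"
          using step.hyps by simp
        ultimately show ?thesis by (simp only: distrib_left)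
      qed
      ultimately show ?case by (elim dominated_mono) (auto simp: Rs_def)
    qed
    have err_le: "\<bar>err \<pi> \<omega> N d\<bar> \<le> (CU + 4 * E\<^sup>2 * B + D * sqrt (C1 * M)) * \<kappa> * sqrt x"
    proof (cases "d \<le> frontier \<omega> N")
      case True
      define s where "s = growth \<omega> N * (\<Sum>r=j..<N. b r / growth \<omega> (Suc r))"
      obtain u where u: "\<And>k. k \<le> frontier \<omega> N \<Longrightarrow> 0 \<le> u k \<and> \<bar>err \<pi> \<omega> N k\<bar> \<le> u k + majorant k * s"
        "(\<Sum>k\<le>frontier \<omega> N. u k) \<le> U0 + M * (\<Sum>r<j. b r) + Rs N"
        using phase2[OF j(2) order_refl] unfolding dominated_def s_def by blast
      have "u d \<le> (\<Sum>k\<le>frontier \<omega> N. u k)" using u(1) True by (intro member_le_sum) auto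
      also note u(2)
      also have "(\<Sum>r<j. b r) \<le> B * \<kappa> * (2 * sqrt (real j))"
      proof -
        have "(\<Sum>r<j. b r) \<le> (\<Sum>r<j. B * \<kappa> * (1 / sqrt (real r + 1)))"
          using j by (intro sum_mono b_le) auto
        also have "\<dots> = B * \<kappa> * (\<Sum>r<j. 1 / sqrt (real r + 1))" by (simp only: sum_distrib_left)
        also have "\<dots> \<le> B * \<kappa> * (2 * sqrt (real j))"
          using nn \<kappa> by (intro mult_left_mono sum_inverse_sqrt_le) auto
        finally show ?thesis .
      qed
      also have "sqrt (real j) \<le> (sqrt (real i0) + 1) * sqrt x"
      proof -
        have "real j \<le> real i0 + x" using x(1) by (auto simp: j_def max_def min_def) linarith+
        then have "sqrt (real j) \<le> sqrt (real i0 + x)" by simp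
        also have "\<dots> \<le> sqrt (real i0) + sqrt x" using x by (intro sqrt_add_le_add_sqrt) auto
        also have "\<dots> \<le> sqrt (real i0) * sqrt x + sqrt x"
          using mult_left_mono[OF x(2), of "sqrt (real i0)"] by simp
        finally show ?thesis by (simp add: algebra_simps)
      qed
      finally have ud: "u d \<le> U0 + M * (B * \<kappa> * (2 * ((sqrt (real i0) + 1) * sqrt x))) + Rs N"
        using nn \<kappa> M(1) by (auto simp: mult_left_mono)
      have lx: "1 \<le> \<kappa> * sqrt x" using mult_mono[OF \<kappa> x(2)] \<kappa> by simp
      have "U0 + Rs N \<le> (U0 + D * C1 * M) * 1" using Rs_le by simp
      also have "\<dots> \<le> (U0 + D * C1 * M) * (\<kappa> * sqrt x)" using lx nn by (intro mult_left_mono) auto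
      finally have ud': "u d \<le> CU * \<kappa> * sqrt x" using ud by (simp add: CU_def algebra_simps)
      have sd: "majorant d * s \<le> 4 * E\<^sup>2 * B * \<kappa> * sqrt x"
      proof (cases "j < N")
        case False
        then have "s = 0" by (simp add: s_def)
        then show ?thesis using nn \<kappa> x by simp
      next
        case True
        then have xj: "x \<le> real j + 1" by (auto simp: j_def) linarith+
        have "(\<Sum>r=j..<N. b r / growth \<omega> (Suc r))
            \<le> (\<Sum>r=j..<N. B * \<kappa> * E * (1 / ((real r + 1) * sqrt (real r + 1))))"
        proof (rule sum_mono)
          fix r assume r: "r \<in> {j..<N}"
          have "(real r + 1) / E \<le> growth \<omega> (Suc r)"
            using E(3)[OF reg, of "Suc r"] r E(1) by (simp add: divide_le_eq mult.commute)
          then have "b r / growth \<omega> (Suc r) \<le> (B * \<kappa> * (1 / sqrt (real r + 1))) / ((real r + 1) / E)"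
            using b_le[of r] r E(1) nn \<kappa> by (intro frac_le) auto
          also have "\<dots> = B * \<kappa> * E * (1 / ((real r + 1) * sqrt (real r + 1)))" by (simp add: mult_ac)
          finally show "b r / growth \<omega> (Suc r) \<le> B * \<kappa> * E * (1 / ((real r + 1) * sqrt (real r + 1)))" .
        qed
        also have "\<dots> = B * \<kappa> * E * (\<Sum>r=j..<N. 1 / ((real r + 1) * sqrt (real r + 1)))"
          by (simp only: sum_distrib_left)
        also have "\<dots> \<le> B * \<kappa> * E * (4 / sqrt (real j + 1))"
          using nn \<kappa> E(1) by (intro mult_left_mono sum_three_halves_tail j) auto
        also have "\<dots> \<le> B * \<kappa> * E * (4 / sqrt x)"
          using nn \<kappa> E(1) xj x by (intro mult_left_mono divide_left_mono) auto
        finally have "s \<le> E * (real N + 1) * (B * \<kappa> * E * (4 / sqrt x))"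
          unfolding s_def using E(2)[OF reg order_refl] E(1) b_nn
          by (intro mult_mono) (auto intro!: sum_nonneg simp: less_imp_le)
        then have "majorant d * s \<le> majorant d * (E * (real N + 1) * (B * \<kappa> * E * (4 / sqrt x)))"
          using majorant_pos[of d] by (intro mult_left_mono) auto
        also have "\<dots> = 4 * E\<^sup>2 * B * \<kappa> * (x / sqrt x)" by (simp add: x_def power2_eq_square)
        also have "x / sqrt x = sqrt x" using x by (simp add: real_div_sqrt)
        finally show ?thesis .
      qed
      have "0 \<le> D * sqrt (C1 * M) * \<kappa> * sqrt x" using nn D(1) i1(1) M(1) \<kappa> x by (intro mult_nonneg_nonneg) auto
      then show ?thesis using u(1)[OF True] ud' sd by (simp add: distrib_right)
    next
      case False
      have "\<bar>err \<pi> \<omega> N d\<bar> \<le> D * (real N + 1) * majorant d"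
        by (rule err_beyond_frontier[OF adm D(2)[OF reg]]) (use False in auto)
      also have "\<dots> = D * (sqrt x * sqrt x)" using x by (simp add: x_def)
      also have "\<dots> \<le> D * (sqrt (C1 * M) * sqrt x)"
      proof -
        \<comment> \<open>For \<open>d\<close> above the frontier, \<open>N + 1\<close> is at most
          \<open>C1 * (d + 1)\<close>. Hence \<open>x\<close> is bounded, and the linear bound in
          \<open>x\<close> becomes one in \<open>sqrt x\<close>.\<close>
        have "x \<le> C1 * (real (frontier \<omega> N) + 1) * majorant d"
          using i1(3)[OF reg order_refl] majorant_pos[of d] unfolding x_def
          by (subst mult.commute) (intro mult_right_mono, auto)
        also have "\<dots> \<le> C1 * ((real d + 1) * majorant d)"
          using False i1(1) majorant_pos[of d] by (simp add: mult.assoc)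
        also have "\<dots> \<le> C1 * M" using majorant_le i1(1) by (intro mult_left_mono) auto
        finally show ?thesis using D(1) x by (intro mult_left_mono mult_right_mono) auto
      qed
      also have "\<dots> \<le> (D * sqrt (C1 * M) * sqrt x) * \<kappa>"
        using mult_left_mono[OF \<kappa>, of "D * sqrt (C1 * M) * sqrt x"] nn x by simp
      finally have "\<bar>err \<pi> \<omega> N d\<bar> \<le> D * sqrt (C1 * M) * \<kappa> * sqrt x" by (simp only: mult_ac)
      moreover have "0 \<le> (CU + 4 * E\<^sup>2 * B) * \<kappa> * sqrt x"
        using nn \<kappa> x by (intro mult_nonneg_nonneg) (use CU in auto)
      ultimately show ?thesis by (simp add: distrib_right)
    qed
    \<comment> \<open>One factor \<open>sqrt (majorant d)\<close> combines with
      \<open>sqrt N\<close> to give \<open>sqrt x\<close>; the other is bounded by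
      \<open>sqrt M\<close>.\<close>
    have sqrtN: "sqrt (real N) * majorant d \<le> sqrt M * sqrt x"
    proof -
      have "sqrt (real N) * majorant d \<le> sqrt (real N + 1) * (sqrt (majorant d) * sqrt (majorant d))"
        using majorant_pos[of d] by (intro mult_mono) auto
      also have "\<dots> = sqrt (majorant d) * sqrt x" by (simp add: x_def real_sqrt_mult mult_ac)
      also have "\<dots> \<le> sqrt M * sqrt x"
        using majorant_le[of d] majorant_le1[of d] x by (intro mult_right_mono) auto
      finally show ?thesis .
    qed
    have devN: "deviation \<omega> N * majorant d \<le> \<kappa> * (sqrt M * sqrt x)"
    proof -
      have "deviation \<omega> N * majorant d \<le> (\<kappa> * sqrt (real N)) * majorant d"
        using dev majorant_pos[of d] by (intro mult_right_mono) auto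
      also have "\<dots> \<le> \<kappa> * (sqrt M * sqrt x)" unfolding mult.assoc using sqrtN \<kappa> by (intro mult_left_mono) auto
      finally show ?thesis .
    qed
    have noise_le: "\<bar>noise \<omega> N d\<bar> \<le> \<Lambda> * sqrt M * \<kappa> * sqrt x"
    proof -
      have "\<bar>noise \<omega> N d\<bar> \<le> \<Lambda> * (deviation \<omega> N * majorant d)" using \<Lambda>(2)[of \<omega> N d] by (simp add: mult.assoc)
      also have "\<dots> \<le> \<Lambda> * (\<kappa> * (sqrt M * sqrt x))" using devN \<Lambda>(1) by (intro mult_left_mono) auto
      finally show ?thesis by (simp add: mult_ac)
    qed
    have weight_le: "\<bar>f d * weight \<omega> N / w - f d * (real t0 + real N)\<bar> \<le> (\<delta> * sqrt M + M * K0) * \<kappa> * sqrt x"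
    proof -
      let ?e = "weight \<omega> N - w * real t0 - w * real N"
      have "?e = (weight \<omega> N - weight \<omega> 0 - w * real N) + (real t0 + \<delta> * real n0 - w * real t0)"
        by (simp add: weight_def)
      then have e: "\<bar>?e\<bar> \<le> \<delta> * deviation \<omega> N + K0"
        using weight_diff_deviation[of \<omega> N] unfolding K0_def by linarith
      have "f d * weight \<omega> N / w - f d * (real t0 + real N) = f d * (?e / w)"
        using w_pos by (simp add: field_simps)
      also have "\<bar>\<dots>\<bar> \<le> majorant d * \<bar>?e\<bar>"
        unfolding abs_mult
      proof (intro mult_mono)
        show "\<bar>f d\<bar> \<le> majorant d" using f_nonneg[of d] f_le_majorant[of d] by simp
        show "\<bar>?e / w\<bar> \<le> \<bar>?e\<bar>" using w_ge_1 divide_left_mono[OF w_ge_1, of "\<bar>?e\<bar>"] by simp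
      qed (use majorant_pos[of d] in auto)
      also have "\<dots> \<le> majorant d * (\<delta> * deviation \<omega> N + K0)"
        using e majorant_pos[of d] by (intro mult_left_mono) auto
      also have "\<dots> = \<delta> * (deviation \<omega> N * majorant d) + majorant d * K0" by (simp add: algebra_simps)
      also have "\<dots> \<le> \<delta> * (\<kappa> * (sqrt M * sqrt x)) + M * K0 * (\<kappa> * sqrt x)"
      proof (intro add_mono mult_left_mono devN \<delta>)
        have "1 \<le> \<kappa> * sqrt x" using mult_mono[OF \<kappa> x(2)] \<kappa> by simp
        then have "M * K0 * 1 \<le> M * K0 * (\<kappa> * sqrt x)" using M(1) nn by (intro mult_left_mono) auto
        moreover have "majorant d * K0 \<le> M * K0"
          using majorant_le[of d] majorant_le1[of d] nn by (intro mult_right_mono) auto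
        ultimately show "majorant d * K0 \<le> M * K0 * (\<kappa> * sqrt x)" by simp
      qed
      finally show ?thesis by (simp add: algebra_simps)
    qed
    have "mean \<pi> \<omega> N d - f d * (real t0 + real N)
        = err \<pi> \<omega> N d + noise \<omega> N d + (f d * weight \<omega> N / w - f d * (real t0 + real N))"
      by (simp add: err_def)
    then have "\<bar>mean \<pi> \<omega> N d - f d * (real t0 + real N)\<bar>
        \<le> (CU + 4 * E\<^sup>2 * B + D * sqrt (C1 * M)) * \<kappa> * sqrt x + \<Lambda> * sqrt M * \<kappa> * sqrt x
          + (\<delta> * sqrt M + M * K0) * \<kappa> * sqrt x"
      using err_le noise_le weight_le by linarith
    then show "\<bar>mean \<pi> \<omega> N d - f d * (real t0 + real N)\<bar> \<le> C * \<kappa> * sqrt (majorant d * (real N + 1))"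
      unfolding x_def[symmetric] by (simp add: C_def algebra_simps)
  qed
qed

text \<open>Covers also the degrees with \<open>majorant d * (N + 1) < 1\<close>, to which
  \<open>mean_close\<close> does not apply.\<close>

lemma mean_le_majorant:
  assumes L: "0 \<le> L"
  obtains C :: real and i0 :: nat where "0 < C"
    "\<And>\<pi> \<omega> N k. regular L \<omega> N \<Longrightarrow> admissible \<pi> \<omega> N \<Longrightarrow> i0 \<le> N \<Longrightarrow>
       mean \<pi> \<omega> N k \<le> C * (majorant k * (real N + 1))"
proof -
  obtain C1 i0 where 1: "0 < C1"
    "\<And>\<pi> \<omega> N i k. regular L \<omega> N \<Longrightarrow> admissible \<pi> \<omega> N \<Longrightarrow> i0 \<le> i \<Longrightarrow> i \<le> N \<Longrightarrow>
       \<bar>err \<pi> \<omega> i k\<bar> \<le> C1 * (real i + 1) * majorant k"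
    using err_crude[OF L] by blast
  obtain D where 2: "0 < D"
    "\<And>\<pi> \<omega> N i k. regular L \<omega> N \<Longrightarrow> i \<le> N \<Longrightarrow>
       \<bar>mean \<pi> \<omega> i k - err \<pi> \<omega> i k\<bar> \<le> D * (real i + 1) * majorant k"
    using abs_mean_minus_err[OF L] by blast
  show ?thesis
  proof (rule that[of "C1 + D" i0])
    show "0 < C1 + D" using 1 2 by simp
    fix \<pi> \<omega> N k assume "regular L \<omega> N" "admissible \<pi> \<omega> N" "i0 \<le> N"
    then show "mean \<pi> \<omega> N k \<le> (C1 + D) * (majorant k * (real N + 1))"
      using 1(2)[of \<omega> N \<pi> N k] 2(2)[of \<omega> N N \<pi> k] by (simp add: algebra_simps)
  qed
qed

end

section \<open>The random graph for given step kinds\<close>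

lemma expectation_bind_finite:
  fixes h :: "'b \<Rightarrow> real"
  assumes "finite (set_pmf p)" "\<And>x. x \<in> set_pmf p \<Longrightarrow> finite (set_pmf (f x))"
  shows "measure_pmf.expectation (bind_pmf p f) h
    = measure_pmf.expectation p (\<lambda>x. measure_pmf.expectation (f x) h)"
  using assms
  by (subst pmf_expectation_bind[of "set_pmf p"]) (auto simp: integral_measure_pmf[of "set_pmf p"])

lemma expectation_mono_finite:
  fixes f g :: "'a \<Rightarrow> real"
  assumes "finite (set_pmf p)" "\<And>x. x \<in> set_pmf p \<Longrightarrow> f x \<le> g x"
  shows "measure_pmf.expectation p f \<le> measure_pmf.expectation p g"
  using assms by (intro integral_mono_AE integrable_measure_pmf_finite) (auto simp: AE_measure_pmf_iff)

lemma expectation_cong_pmf: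
  assumes "\<And>x. x \<in> set_pmf p \<Longrightarrow> f x = g x"
  shows "measure_pmf.expectation p f = measure_pmf.expectation p g"
  using assms by (intro integral_cong_AE) (auto simp: AE_measure_pmf_iff)

text \<open>
  The variance is half of the double sum of \<open>q u * q v * (D u - D v)\<^sup>2\<close>, in which only \<open>u \<noteq> v\<close> count.
\<close>
lemma weighted_variance_le:
  fixes q D :: "'a \<Rightarrow> real"
  assumes fin: "finite V" and q: "\<And>v. v \<in> V \<Longrightarrow> 0 \<le> q v" and sum1: "(\<Sum>v\<in>V. q v) = 1"
  shows "(\<Sum>v\<in>V. q v * (D v)\<^sup>2) - (\<Sum>v\<in>V. q v * D v)\<^sup>2 \<le> 2 * (\<Sum>v\<in>V. q v * (1 - q v) * (D v)\<^sup>2)"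
proof -
  let ?s = "\<Sum>v\<in>V. q v * (D v)\<^sup>2" and ?m = "\<Sum>v\<in>V. q v * D v"
  have pull: "(\<Sum>u\<in>V. \<Sum>v\<in>V. q u * q v * a u) = (\<Sum>u\<in>V. q u * a u)"
    "(\<Sum>u\<in>V. \<Sum>v\<in>V. q u * q v * a v) = (\<Sum>u\<in>V. q u * a u)" for a
  proof -
    have "(\<Sum>u\<in>V. \<Sum>v\<in>V. q u * q v * a u) = (\<Sum>u\<in>V. (q u * a u) * (\<Sum>v\<in>V. q v))"
      by (simp add: sum_distrib_left mult_ac)
    then show "(\<Sum>u\<in>V. \<Sum>v\<in>V. q u * q v * a u) = (\<Sum>u\<in>V. q u * a u)" by (simp add: sum1)
    have "(\<Sum>u\<in>V. \<Sum>v\<in>V. q u * q v * a v) = (\<Sum>u\<in>V. q u) * (\<Sum>v\<in>V. q v * a v)"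
      by (simp add: sum_product mult_ac)
    then show "(\<Sum>u\<in>V. \<Sum>v\<in>V. q u * q v * a v) = (\<Sum>u\<in>V. q u * a u)" by (simp add: sum1)
  qed
  have "(\<Sum>u\<in>V. \<Sum>v\<in>V. q u * q v * (D u - D v)\<^sup>2)
      = (\<Sum>u\<in>V. \<Sum>v\<in>V. q u * q v * (D u)\<^sup>2 + q u * q v * (D v)\<^sup>2 - 2 * ((q u * D u) * (q v * D v)))"
    by (simp add: power2_eq_square algebra_simps)
  also have "\<dots> = 2 * ?s - 2 * ?m\<^sup>2"
    by (simp add: sum.distrib sum_subtractf pull power2_eq_square sum_product flip: sum_distrib_left)
  finally have 1: "(\<Sum>u\<in>V. \<Sum>v\<in>V. q u * q v * (D u - D v)\<^sup>2) = 2 * ?s - 2 * ?m\<^sup>2" .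
  have "(\<Sum>u\<in>V. \<Sum>v\<in>V. q u * q v * (D u - D v)\<^sup>2)
      \<le> (\<Sum>u\<in>V. \<Sum>v\<in>V. 2 * (q u * q v * (D u)\<^sup>2 + q u * q v * (D v)\<^sup>2)
          - (if u = v then 4 * (q v)\<^sup>2 * (D v)\<^sup>2 else 0))"
  proof (intro sum_mono)
    fix u v assume uv: "u \<in> V" "v \<in> V"
    have "0 \<le> q u * q v * (D u + D v)\<^sup>2" using q uv by simp
    then show "q u * q v * (D u - D v)\<^sup>2 \<le> 2 * (q u * q v * (D u)\<^sup>2 + q u * q v * (D v)\<^sup>2)
          - (if u = v then 4 * (q v)\<^sup>2 * (D v)\<^sup>2 else 0)"
      by (auto simp: power2_eq_square algebra_simps)
  qed
  also have "\<dots> = 2 * (\<Sum>u\<in>V. \<Sum>v\<in>V. q u * q v * (D u)\<^sup>2 + q u * q v * (D v)\<^sup>2)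
      - (\<Sum>u\<in>V. \<Sum>v\<in>V. if u = v then 4 * (q v)\<^sup>2 * (D v)\<^sup>2 else 0)"
    by (simp only: sum_subtractf sum_distrib_left)
  also have "\<dots> = 4 * ?s - 4 * (\<Sum>v\<in>V. (q v)\<^sup>2 * (D v)\<^sup>2)"
    unfolding sum.distrib pull using fin by (simp add: sum_distrib_left mult.assoc)
  finally have "?s - ?m\<^sup>2 \<le> 2 * (?s - (\<Sum>v\<in>V. (q v)\<^sup>2 * (D v)\<^sup>2))" unfolding 1 by simp
  also have "?s - (\<Sum>v\<in>V. (q v)\<^sup>2 * (D v)\<^sup>2) = (\<Sum>v\<in>V. q v * (1 - q v) * (D v)\<^sup>2)"
    by (simp add: power2_eq_square algebra_simps flip: sum_subtractf)
  finally show ?thesis .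
qed

section \<open>Sums over the vertices and the effect of a new arc on them\<close>

definition vertex_sum :: "(nat \<Rightarrow> real) \<Rightarrow> ('a, 'b) pre_digraph \<Rightarrow> real" where
  "vertex_sum h G = (\<Sum>v\<in>verts G. h (in_degree G v))"

lemma vertex_sum_add: "vertex_sum (\<lambda>k. g k + h k) G = vertex_sum g G + vertex_sum h G"
  by (simp add: vertex_sum_def sum.distrib)

lemma vertex_sum_cmult: "vertex_sum (\<lambda>k. r * h k) G = r * vertex_sum h G"
  by (simp add: vertex_sum_def sum_distrib_left)

lemma vertex_sum_nonneg: "(\<And>k. 0 \<le> h k) \<Longrightarrow> 0 \<le> vertex_sum h G"
  by (simp add: vertex_sum_def sum_nonneg)

lemma n_in_eq_vertex_sum:
  "finite (verts G) \<Longrightarrow> real (n_in G d) = vertex_sum (\<lambda>k. of_bool (k = d)) G"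
  by (simp add: n_in_def vertex_sum_def Int_def of_bool_def sum.If_cases)

context fin_digraph
begin

lemma in_degree_not_vert: "v \<notin> verts G \<Longrightarrow> in_degree G v = 0"
  using head_in_verts by (auto simp: in_degree_def in_arcs_def)

lemma in_degree_le_card_arcs: "in_degree G v \<le> card (arcs G)"
  unfolding in_degree_def by (rule card_mono) (auto simp: in_arcs_def)

end

lemma fin_digraph_new_arc:
  fixes G :: "('x::infinite, 'y::infinite) pre_digraph"
  assumes "fin_digraph G"
  shows "fin_digraph (new_arc G v w)"
proof -
  interpret fin_digraph G by fact
  show ?thesis
    by unfold_locales (auto simp: new_arc_def Let_def split: if_splits)
qed

lemma card_arcs_new_arc: "fin_digraph G \<Longrightarrow> card (arcs (new_arc G v w)) = Suc (card (arcs G))"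
  by (simp add: new_arc_def Let_def fresh_notin fin_digraph.finite_arcs)

lemma verts_new_arc: "verts (new_arc G v w) = insert v (insert w (verts G))"
  by (auto simp: new_arc_def Let_def)

lemma in_degree_new_arc:
  assumes "fin_digraph G"
  shows "in_degree (new_arc G v w) u = in_degree G u + of_bool (u = w)"
proof -
  interpret fin_digraph G by fact
  let ?e = "fresh (arcs G)"
  have e: "?e \<notin> arcs G" by (simp add: fresh_notin)
  have "in_arcs (new_arc G v w) u = (if u = w then insert ?e (in_arcs G u) else in_arcs G u)"
    using e by (auto simp: in_arcs_def new_arc_def Let_def)
  moreover have "card (insert ?e (in_arcs G u)) = Suc (card (in_arcs G u))"
    using e by (intro card_insert_disjoint) auto
  ultimately show ?thesis by (cases "u = w") (simp_all add: in_degree_def)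
qed

lemma vertex_sum_new_arc_old:
  assumes "fin_digraph G" "v \<in> verts G" "w \<in> verts G"
  shows "vertex_sum h (new_arc G v w)
    = vertex_sum h G + (h (in_degree G w + 1) - h (in_degree G w))"
proof -
  interpret fin_digraph G by fact
  have "verts (new_arc G v w) = verts G" using assms by (auto simp: verts_new_arc)
  then have "vertex_sum h (new_arc G v w) = (\<Sum>u\<in>verts G. h (in_degree G u + of_bool (u = w)))"
    by (simp add: vertex_sum_def in_degree_new_arc[OF assms(1)])
  also have "\<dots> = (\<Sum>u\<in>verts G. h (in_degree G u)
      + (if u = w then h (in_degree G w + 1) - h (in_degree G w) else 0))"
    by (intro sum.cong) auto
  also have "\<dots> = vertex_sum h G + (h (in_degree G w + 1) - h (in_degree G w))"
    using assms(3) by (simp add: sum.distrib vertex_sum_def)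
  finally show ?thesis .
qed

lemma vertex_sum_new_arc_from_new:
  assumes "fin_digraph G" "v \<notin> verts G" "w \<in> verts G"
  shows "vertex_sum h (new_arc G v w)
    = vertex_sum h G + (h (in_degree G w + 1) - h (in_degree G w)) + h 0"
proof -
  interpret fin_digraph G by fact
  have "verts (new_arc G v w) = insert v (verts G)" using assms by (auto simp: verts_new_arc)
  then have "vertex_sum h (new_arc G v w)
      = h (in_degree G v) + (\<Sum>u\<in>verts G. h (in_degree G u + of_bool (u = w)))"
    using assms by (auto simp add: vertex_sum_def in_degree_new_arc[OF assms(1)])
  also have "(\<Sum>u\<in>verts G. h (in_degree G u + of_bool (u = w))) = (\<Sum>u\<in>verts G. h (in_degree G u)
      + (if u = w then h (in_degree G w + 1) - h (in_degree G w) else 0))"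
    by (intro sum.cong) auto
  also have "\<dots> = vertex_sum h G + (h (in_degree G w + 1) - h (in_degree G w))"
    using assms(3) by (simp add: sum.distrib vertex_sum_def)
  finally show ?thesis using in_degree_not_vert[OF assms(2)] by simp
qed

lemma vertex_sum_new_arc_to_new:
  assumes "fin_digraph G" "v \<in> verts G" "w \<notin> verts G"
  shows "vertex_sum h (new_arc G v w) = vertex_sum h G + h 1"
proof -
  interpret fin_digraph G by fact
  have "verts (new_arc G v w) = insert w (verts G)" using assms by (auto simp: verts_new_arc)
  moreover have "in_degree (new_arc G v w) u = in_degree G u" if "u \<in> verts G" for u
    using that assms by (auto simp: in_degree_new_arc[OF assms(1)])
  ultimately have "vertex_sum h (new_arc G v w) = h (in_degree (new_arc G v w) w) + vertex_sum h G"
    using assms by (simp add: vertex_sum_def)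
  then show ?thesis using in_degree_not_vert[OF assms(3)] by (simp add: in_degree_new_arc[OF assms(1)])
qed

section \<open>The process with prescribed kinds\<close>

locale graph_process = attachment \<alpha> \<beta> \<gamma> \<delta>_in "card (arcs G0)" "card (verts G0)"
  for \<alpha> \<beta> \<gamma> \<delta>_in :: real and G0 :: "('a::infinite, 'b::infinite) pre_digraph" +
  fixes \<delta>_out :: real
  assumes \<delta>_out: "0 \<le> \<delta>_out"
    and G0: "fin_digraph G0" "verts G0 \<noteq> {}" "\<delta>_in = 0 \<or> \<delta>_out = 0 \<Longrightarrow> arcs G0 \<noteq> {}"
begin

definition kind_step :: "step_kind \<Rightarrow> ('a, 'b) pre_digraph \<Rightarrow> ('a, 'b) pre_digraph pmf" where
  "kind_step k G = (case k of
       From_New \<Rightarrow> map_pmf (\<lambda>w. new_arc G (fresh (verts G)) w) (choose_in \<delta>_in G)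
     | Between_Old \<Rightarrow> map_pmf (\<lambda>(v, w). new_arc G v w)
                        (pair_pmf (choose_out \<delta>_out G) (choose_in \<delta>_in G))
     | To_New \<Rightarrow> map_pmf (\<lambda>v. new_arc G v (fresh (verts G))) (choose_out \<delta>_out G))"

primrec graph_of_kinds :: "(nat \<Rightarrow> step_kind) \<Rightarrow> nat \<Rightarrow> ('a, 'b) pre_digraph pmf" where
  "graph_of_kinds \<omega> 0 = return_pmf G0"
| "graph_of_kinds \<omega> (Suc i) = bind_pmf (graph_of_kinds \<omega> i) (kind_step (\<omega> i))"

definition reachable :: "(nat \<Rightarrow> step_kind) \<Rightarrow> nat \<Rightarrow> ('a, 'b) pre_digraph \<Rightarrow> bool" where
  "reachable \<omega> i G \<longleftrightarrow> fin_digraph G \<and> verts G \<noteq> {} \<and> (\<delta>_in = 0 \<or> \<delta>_out = 0 \<longrightarrow> arcs G \<noteq> {})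
     \<and> card (arcs G) = card (arcs G0) + i
     \<and> real (card (verts G)) = real (card (verts G0)) + cnt From_New \<omega> i + cnt To_New \<omega> i"

context
  fixes \<omega> i G
  assumes reach: "reachable \<omega> i G"
begin

interpretation fin_digraph G
  using reach by (simp add: reachable_def)

lemma fin_G: "fin_digraph G"
  using reach by (simp add: reachable_def)

lemma total_weight: "real (card (arcs G)) + \<delta>_in * real (card (verts G)) = weight \<omega> i"
  using reach by (simp add: reachable_def weight_def)

lemma pmf_choose_in_reachable:
  "pmf (choose_in \<delta>_in G) v = (if v \<in> verts G then (real (in_degree G v) + \<delta>_in) / weight \<omega> i else 0)"
  using pmf_choose_vertex[of G \<delta>_in in_degree v] sum_in_degree[OF fin_G] \<delta> weight_pos[of \<omega> i]
  by (simp add: total_weight)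

lemma set_choose_in: "set_pmf (choose_in \<delta>_in G) \<subseteq> verts G"
  by (auto simp: set_pmf_iff pmf_choose_in_reachable split: if_splits)

lemma set_choose_out: "set_pmf (choose_out \<delta>_out G) \<subseteq> verts G"
proof -
  have "0 < real (card (arcs G)) + \<delta>_out * real (card (verts G))"
    using reach \<delta>_out unfolding reachable_def by (intro total_weight_pos) blast+
  then show ?thesis
    using pmf_choose_vertex[of G \<delta>_out out_degree] sum_out_degree[OF fin_G] \<delta>_out
    by (auto simp: set_pmf_iff split: if_splits)
qed

lemma fresh_vert: "fresh (verts G) \<notin> verts G"
  by (rule fresh_notin) simp

lemma finite_kind_step: "finite (set_pmf (kind_step k G))"
  using finite_subset[OF set_choose_in finite_verts] finite_subset[OF set_choose_out finite_verts]
  by (cases k) (auto simp: kind_step_def)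

lemma reachable_kind_step:
  assumes "G' \<in> set_pmf (kind_step (\<omega> i) G)"
  shows "reachable \<omega> (Suc i) G'"
proof -
  obtain v w where vw: "G' = new_arc G v w"
    "\<omega> i = From_New \<Longrightarrow> v = fresh (verts G) \<and> w \<in> verts G"
    "\<omega> i = Between_Old \<Longrightarrow> v \<in> verts G \<and> w \<in> verts G"
    "\<omega> i = To_New \<Longrightarrow> v \<in> verts G \<and> w = fresh (verts G)"
    using assms set_choose_in set_choose_out by (cases "\<omega> i") (auto simp: kind_step_def)
  have "card (verts G') = card (verts G) + of_bool (\<omega> i \<noteq> Between_Old)"
    using vw fresh_vert by (cases "\<omega> i") (auto simp: verts_new_arc insert_absorb)
  moreover have "arcs G' \<noteq> {}" by (simp add: vw(1) new_arc_def Let_def)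
  moreover have "verts G' \<noteq> {}" by (simp add: vw(1) verts_new_arc)
  moreover have "of_bool (\<omega> i \<noteq> Between_Old) = of_bool (\<omega> i = From_New) + (of_bool (\<omega> i = To_New) :: real)"
    by (cases "\<omega> i") auto
  ultimately show ?thesis
    using reach fin_digraph_new_arc[OF fin_G] card_arcs_new_arc[OF fin_G]
    by (simp add: reachable_def vw(1))
qed

end

section \<open>First and second moments of one step\<close>

definition jump :: "(nat \<Rightarrow> real) \<Rightarrow> ('a, 'b) pre_digraph \<Rightarrow> 'a \<Rightarrow> real" where
  "jump h G v = h (in_degree G v + 1) - h (in_degree G v)"

definition birth :: "step_kind \<Rightarrow> (nat \<Rightarrow> real) \<Rightarrow> real" where
  "birth k h = (case k of From_New \<Rightarrow> h 0 | Between_Old \<Rightarrow> 0 | To_New \<Rightarrow> h 1)"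

text \<open>The backward operator: adjoint to taking \<open>v\<close> to
  \<open>v + r * flux v\<close>. It is the expected value of \<open>h\<close> at a vertex that moves
  up with probability \<open>r * (k + \<delta>_in)\<close>.\<close>

definition shift :: "real \<Rightarrow> (nat \<Rightarrow> real) \<Rightarrow> nat \<Rightarrow> real" where
  "shift r h k = h k + r * (real k + \<delta>_in) * (h (k + 1) - h k)"

text \<open>In-degrees do not depend on the tail of the new arc, so the choice by out-degree
  projects away, and a \<open>To_New\<close> step acts deterministically.\<close>

lemma map_vertex_sum_kind_step:
  assumes "reachable \<omega> i G"
  shows "map_pmf (vertex_sum h) (kind_step k G) = (if k = To_New then return_pmf (vertex_sum h G + h 1)
    else map_pmf (\<lambda>w. vertex_sum h G + jump h G w + birth k h) (choose_in \<delta>_in G))"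
proof (cases k)
  case From_New
  then show ?thesis
    using set_choose_in[OF assms] fresh_vert[OF assms] fin_G[OF assms]
    by (auto simp: kind_step_def map_pmf_comp jump_def birth_def vertex_sum_new_arc_from_new
        intro!: map_pmf_cong)
next
  case Between_Old
  have "map_pmf (vertex_sum h) (kind_step k G)
      = map_pmf (\<lambda>p. vertex_sum h G + jump h G (snd p)) (pair_pmf (choose_out \<delta>_out G) (choose_in \<delta>_in G))"
    unfolding Between_Old kind_step_def step_kind.case map_pmf_comp
    using set_choose_in[OF assms] set_choose_out[OF assms] fin_G[OF assms]
    by (intro map_pmf_cong refl) (clarsimp simp: jump_def, subst vertex_sum_new_arc_old, auto)
  also have "\<dots> = map_pmf (\<lambda>w. vertex_sum h G + jump h G w)
      (map_pmf snd (pair_pmf (choose_out \<delta>_out G) (choose_in \<delta>_in G)))"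
    by (simp add: map_pmf_comp)
  finally show ?thesis using Between_Old by (simp add: map_snd_pair_pmf birth_def)
next
  case To_New
  have "map_pmf (vertex_sum h) (kind_step k G) = map_pmf (\<lambda>_. vertex_sum h G + h 1) (choose_out \<delta>_out G)"
    unfolding To_New kind_step_def step_kind.case map_pmf_comp
    using set_choose_out[OF assms] fresh_vert[OF assms] fin_G[OF assms]
    by (intro map_pmf_cong) (auto simp: vertex_sum_new_arc_to_new)
  then show ?thesis using To_New by (simp add: map_pmf_const)
qed

lemma expectation_kind_step:
  fixes g :: "real \<Rightarrow> real"
  assumes r: "reachable \<omega> i G" and k: "\<omega> i \<noteq> To_New"
  shows "measure_pmf.expectation (kind_step (\<omega> i) G) (\<lambda>G'. g (vertex_sum h G'))
    = (\<Sum>v\<in>verts G. rate \<omega> i * (real (in_degree G v) + \<delta>_in) * g (vertex_sum h G + jump h G v + birth (\<omega> i) h))"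
proof -
  have fin: "finite (verts G)" using fin_G[OF r] by (simp add: fin_digraph.finite_verts)
  have "measure_pmf.expectation (kind_step (\<omega> i) G) (\<lambda>G'. g (vertex_sum h G'))
      = measure_pmf.expectation (map_pmf (vertex_sum h) (kind_step (\<omega> i) G)) g"
    by simp
  also have "\<dots> = measure_pmf.expectation (choose_in \<delta>_in G) (\<lambda>v. g (vertex_sum h G + jump h G v + birth (\<omega> i) h))"
    unfolding map_vertex_sum_kind_step[OF r] using k by simp
  also have "\<dots> = (\<Sum>v\<in>verts G. pmf (choose_in \<delta>_in G) v *\<^sub>R g (vertex_sum h G + jump h G v + birth (\<omega> i) h))"
    using set_choose_in[OF r] by (intro integral_measure_pmf fin) auto
  finally show ?thesis
    using k by (simp add: pmf_choose_in_reachable[OF r] rate_def cong: sum.cong)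
qed

lemma expectation_kind_step_To_New:
  fixes g :: "real \<Rightarrow> real"
  assumes r: "reachable \<omega> i G" and k: "\<omega> i = To_New"
  shows "measure_pmf.expectation (kind_step (\<omega> i) G) (\<lambda>G'. g (vertex_sum h G')) = g (vertex_sum h G + h 1)"
proof -
  have "measure_pmf.expectation (kind_step (\<omega> i) G) (\<lambda>G'. g (vertex_sum h G'))
      = measure_pmf.expectation (map_pmf (vertex_sum h) (kind_step (\<omega> i) G)) g"
    by simp
  then show ?thesis unfolding map_vertex_sum_kind_step[OF r] using k by simp
qed

lemma sum_choice_probabilities:
  assumes r: "reachable \<omega> i G" and k: "\<omega> i \<noteq> To_New"
  shows "(\<Sum>v\<in>verts G. rate \<omega> i * (real (in_degree G v) + \<delta>_in)) = 1"
proof -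
  have "(\<Sum>v\<in>verts G. pmf (choose_in \<delta>_in G) v) = 1"
    using set_choose_in[OF r] fin_G[OF r] by (intro sum_pmf_eq_1) (auto simp: fin_digraph.finite_verts)
  then show ?thesis
    using k by (simp add: pmf_choose_in_reachable[OF r] rate_def cong: sum.cong)
qed

lemma vertex_sum_shift:
  "vertex_sum (shift r h) G
     = vertex_sum h G + (\<Sum>v\<in>verts G. r * (real (in_degree G v) + \<delta>_in) * jump h G v)"
  by (simp add: vertex_sum_def shift_def[abs_def] jump_def sum.distrib)

lemma expectation_vertex_sum_step:
  assumes r: "reachable \<omega> i G"
  shows "measure_pmf.expectation (kind_step (\<omega> i) G) (vertex_sum h)
    = vertex_sum (shift (rate \<omega> i) h) G + birth (\<omega> i) h"
proof (cases "\<omega> i = To_New")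
  case True
  then show ?thesis using expectation_kind_step_To_New[OF r True, of "\<lambda>x. x" h]
    by (simp add: birth_def vertex_sum_shift rate_def)
next
  case False
  let ?q = "\<lambda>v. rate \<omega> i * (real (in_degree G v) + \<delta>_in)"
  have "measure_pmf.expectation (kind_step (\<omega> i) G) (vertex_sum h)
      = (\<Sum>v\<in>verts G. ?q v * (vertex_sum h G + birth (\<omega> i) h) + ?q v * jump h G v)"
    unfolding expectation_kind_step[OF r False, of "\<lambda>x. x"] by (intro sum.cong) (auto simp: algebra_simps)
  also have "\<dots> = (\<Sum>v\<in>verts G. ?q v) * (vertex_sum h G + birth (\<omega> i) h) + (\<Sum>v\<in>verts G. ?q v * jump h G v)"
    by (simp only: sum.distrib sum_distrib_right)
  finally show ?thesis by (simp add: sum_choice_probabilities[OF r False] vertex_sum_shift)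
qed

text \<open>At a vertex that moves up with probability \<open>q\<close>, the value of
  \<open>h\<close> has variance \<open>q * (1 - q) * D^2\<close>, which equals \<open>shift\<close>
  of \<open>h^2\<close> minus the square of \<open>shift\<close> of \<open>h\<close>. By
  \<open>weighted_variance_le\<close> the choice of a single vertex costs at most twice what
  independent moves would.\<close>

lemma expectation_square_step:
  assumes r: "reachable \<omega> i G"
  shows "measure_pmf.expectation (kind_step (\<omega> i) G) (\<lambda>G'. (vertex_sum h G' - \<mu>)\<^sup>2)
    \<le> (vertex_sum (shift (rate \<omega> i) h) G + birth (\<omega> i) h - \<mu>)\<^sup>2
      + 2 * (vertex_sum (shift (rate \<omega> i) (\<lambda>k. (h k)\<^sup>2)) G - vertex_sum (\<lambda>k. (shift (rate \<omega> i) h k)\<^sup>2) G)"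
proof (cases "\<omega> i = To_New")
  case True
  have "shift (rate \<omega> i) h = h" for h using True by (simp add: shift_def[abs_def] rate_def)
  then show ?thesis using expectation_kind_step_To_New[OF r True, of "\<lambda>x. (x - \<mu>)\<^sup>2" h] True
    by (simp add: birth_def)
next
  case False
  define q where "q v = rate \<omega> i * (real (in_degree G v) + \<delta>_in)" for v
  define D where "D = jump h G"
  define a where "a = vertex_sum h G + birth (\<omega> i) h - \<mu>"
  define m where "m = (\<Sum>v\<in>verts G. q v * D v)"
  define S where "S = (\<Sum>v\<in>verts G. q v * (D v)\<^sup>2)"
  have q1: "(\<Sum>v\<in>verts G. q v) = 1" unfolding q_def by (rule sum_choice_probabilities[OF r False])
  have "measure_pmf.expectation (kind_step (\<omega> i) G) (\<lambda>G'. (vertex_sum h G' - \<mu>)\<^sup>2)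
      = (\<Sum>v\<in>verts G. q v * a\<^sup>2 + (q v * D v) * (2 * a) + q v * (D v)\<^sup>2)"
    unfolding expectation_kind_step[OF r False, of "\<lambda>x. (x - \<mu>)\<^sup>2"] q_def[symmetric] D_def[symmetric]
    by (intro sum.cong) (auto simp: a_def power2_eq_square algebra_simps)
  also have "\<dots> = (\<Sum>v\<in>verts G. q v) * a\<^sup>2 + m * (2 * a) + S"
    by (simp only: sum.distrib sum_distrib_right m_def S_def)
  also have "\<dots> = (a + m)\<^sup>2 + (S - m\<^sup>2)" by (simp add: q1 power2_eq_square algebra_simps)
  also have "S - m\<^sup>2 \<le> 2 * (\<Sum>v\<in>verts G. q v * (1 - q v) * (D v)\<^sup>2)"
    unfolding S_def m_def using fin_G[OF r] q1 rate_nonneg \<delta>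
    by (intro weighted_variance_le) (auto simp: q_def fin_digraph.finite_verts)
  also have "(\<Sum>v\<in>verts G. q v * (1 - q v) * (D v)\<^sup>2)
      = vertex_sum (shift (rate \<omega> i) (\<lambda>k. (h k)\<^sup>2)) G - vertex_sum (\<lambda>k. (shift (rate \<omega> i) h k)\<^sup>2) G"
    unfolding vertex_sum_def sum_subtractf[symmetric]
  proof (intro sum.cong refl)
    fix v
    have "Q * (1 - Q) * (y - x)\<^sup>2 = x\<^sup>2 + Q * (y\<^sup>2 - x\<^sup>2) - (x + Q * (y - x))\<^sup>2" for Q x y :: real
      by (simp add: power2_eq_square algebra_simps)
    then show "q v * (1 - q v) * (D v)\<^sup>2
        = shift (rate \<omega> i) (\<lambda>k. (h k)\<^sup>2) (in_degree G v) - (shift (rate \<omega> i) h (in_degree G v))\<^sup>2"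
      by (simp add: shift_def q_def D_def jump_def)
  qed
  also have "a + m = vertex_sum (shift (rate \<omega> i) h) G + birth (\<omega> i) h - \<mu>"
    by (simp add: a_def m_def vertex_sum_shift q_def D_def)
  finally show ?thesis by simp
qed

section \<open>Mean and variance at all times, and tail bounds for the counts\<close>

lemma reachable_graph_of_kinds: "G \<in> set_pmf (graph_of_kinds \<omega> i) \<Longrightarrow> reachable \<omega> i G"
proof (induction i arbitrary: G)
  case 0
  then show ?case using G0 by (simp add: reachable_def)
next
  case (Suc i)
  then obtain G' where "reachable \<omega> i G'" "G \<in> set_pmf (kind_step (\<omega> i) G')" by auto
  then show ?case by (rule reachable_kind_step)
qed

lemma finite_graph_of_kinds: "finite (set_pmf (graph_of_kinds \<omega> i))"
  by (induction i) (auto simp: finite_kind_step[OF reachable_graph_of_kinds])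

definition expected_sum :: "(nat \<Rightarrow> step_kind) \<Rightarrow> nat \<Rightarrow> (nat \<Rightarrow> real) \<Rightarrow> real" where
  "expected_sum \<omega> i h = measure_pmf.expectation (graph_of_kinds \<omega> i) (vertex_sum h)"

lemma expectation_graph_Suc:
  fixes g :: "('a, 'b) pre_digraph \<Rightarrow> real"
  shows "measure_pmf.expectation (graph_of_kinds \<omega> (Suc i)) g
    = measure_pmf.expectation (graph_of_kinds \<omega> i) (\<lambda>G. measure_pmf.expectation (kind_step (\<omega> i) G) g)"
  by (simp add: expectation_bind_finite[OF finite_graph_of_kinds] finite_kind_step[OF reachable_graph_of_kinds])

lemma integrable_graph [simp]: "integrable (measure_pmf (graph_of_kinds \<omega> i)) (g :: _ \<Rightarrow> real)"
  by (rule integrable_measure_pmf_finite[OF finite_graph_of_kinds])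

lemma expected_sum_Suc:
  "expected_sum \<omega> (Suc i) h = expected_sum \<omega> i (shift (rate \<omega> i) h) + birth (\<omega> i) h"
proof -
  have "expected_sum \<omega> (Suc i) h = measure_pmf.expectation (graph_of_kinds \<omega> i)
      (\<lambda>G. vertex_sum (shift (rate \<omega> i) h) G + birth (\<omega> i) h)"
    unfolding expected_sum_def expectation_graph_Suc
    by (rule expectation_cong_pmf) (rule expectation_vertex_sum_step[OF reachable_graph_of_kinds])
  then show ?thesis by (simp add: expected_sum_def)
qed

lemma expected_sum_nonneg: "(\<And>k. 0 \<le> h k) \<Longrightarrow> 0 \<le> expected_sum \<omega> i h"
  unfolding expected_sum_def by (intro Bochner_Integration.integral_nonneg) (simp add: vertex_sum_nonneg)

text \<open>The induction runs over all \<open>h\<close> because a step replaces \<open>h\<close> by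
  its shift. The hypothesis contributes twice the expected sum of the squared shift, which is
  exactly the term that \<open>expectation_square_step\<close> subtracts; the shifted square
  remains, and births only increase its sum.\<close>

lemma variance_vertex_sum_le:
  "measure_pmf.expectation (graph_of_kinds \<omega> i) (\<lambda>G. (vertex_sum h G - expected_sum \<omega> i h)\<^sup>2)
     \<le> 2 * expected_sum \<omega> i (\<lambda>k. (h k)\<^sup>2)"
proof (induction i arbitrary: h)
  case 0
  show ?case using vertex_sum_nonneg[of "\<lambda>k. (h k)\<^sup>2" G0] by (simp add: expected_sum_def)
next
  case (Suc i)
  let ?s = "shift (rate \<omega> i)" and ?h2 = "\<lambda>k. (h k)\<^sup>2"
  let ?E = "measure_pmf.expectation (graph_of_kinds \<omega> i)"
  have "measure_pmf.expectation (graph_of_kinds \<omega> (Suc i)) (\<lambda>G. (vertex_sum h G - expected_sum \<omega> (Suc i) h)\<^sup>2)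
      \<le> ?E (\<lambda>G. (vertex_sum (?s h) G - expected_sum \<omega> i (?s h))\<^sup>2
          + 2 * (vertex_sum (?s ?h2) G - vertex_sum (\<lambda>k. (?s h k)\<^sup>2) G))"
    unfolding expectation_graph_Suc
  proof (rule expectation_mono_finite[OF finite_graph_of_kinds])
    fix G assume "G \<in> set_pmf (graph_of_kinds \<omega> i)"
    from expectation_square_step[OF reachable_graph_of_kinds[OF this], of h "expected_sum \<omega> (Suc i) h"]
    show "measure_pmf.expectation (kind_step (\<omega> i) G) (\<lambda>G. (vertex_sum h G - expected_sum \<omega> (Suc i) h)\<^sup>2)
        \<le> (vertex_sum (?s h) G - expected_sum \<omega> i (?s h))\<^sup>2
          + 2 * (vertex_sum (?s ?h2) G - vertex_sum (\<lambda>k. (?s h k)\<^sup>2) G)"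
      by (simp add: expected_sum_Suc)
  qed
  also have "\<dots> = ?E (\<lambda>G. (vertex_sum (?s h) G - expected_sum \<omega> i (?s h))\<^sup>2)
      + 2 * (expected_sum \<omega> i (?s ?h2) - expected_sum \<omega> i (\<lambda>k. (?s h k)\<^sup>2))"
    by (simp add: expected_sum_def)
  also have "\<dots> \<le> 2 * expected_sum \<omega> i (?s ?h2)" using Suc[of "?s h"] by simp
  also have "\<dots> \<le> 2 * expected_sum \<omega> (Suc i) ?h2"
    by (auto simp: expected_sum_Suc birth_def split: step_kind.split)
  finally show ?case .
qed

definition initial :: "nat \<Rightarrow> real" where
  "initial k = real (n_in G0 k)"

text \<open>Duality of \<open>shift\<close> and \<open>flux\<close>, tested on indicators; this
  links the random graph to the deterministic recursion.\<close>

lemma expected_count_eq_mean: "expected_sum \<omega> i (\<lambda>j. of_bool (j = k)) = mean initial \<omega> i k"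
proof (induction i arbitrary: k)
  case 0
  show ?case using G0(1)
    by (simp add: expected_sum_def initial_def n_in_eq_vertex_sum fin_digraph.finite_verts)
next
  case (Suc i)
  let ?r = "rate \<omega> i"
  have lin: "expected_sum \<omega> i (\<lambda>j. p * of_bool (j = a) + q * of_bool (j = b)) = p * mean initial \<omega> i a + q * mean initial \<omega> i b"
    for p q a b
  proof -
    have "(vertex_sum (\<lambda>j. p * of_bool (j = a) + q * of_bool (j = b)) :: ('a, 'b) pre_digraph \<Rightarrow> real)
        = (\<lambda>G. p * vertex_sum (\<lambda>j. of_bool (j = a)) G + q * vertex_sum (\<lambda>j. of_bool (j = b)) G)"
      by (rule ext) (simp only: vertex_sum_add vertex_sum_cmult)
    then show ?thesis unfolding Suc[symmetric] expected_sum_def by simp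
  qed
  \<comment> \<open>For \<open>k = 0\<close> truncated subtraction makes \<open>k - 1\<close> equal
    to 0, so the second coefficient has to vanish there.\<close>
  have "shift ?r (\<lambda>j. of_bool (j = k)) = (\<lambda>j. (1 - ?r * (real k + \<delta>_in)) * of_bool (j = k)
      + (if k = 0 then 0 else ?r * (real k - 1 + \<delta>_in)) * of_bool (j = k - 1))"
    by (rule ext) (auto simp: shift_def algebra_simps)
  then have "expected_sum \<omega> i (shift ?r (\<lambda>j. of_bool (j = k))) = (1 - ?r * (real k + \<delta>_in)) * mean initial \<omega> i k
      + (if k = 0 then 0 else ?r * (real k - 1 + \<delta>_in)) * mean initial \<omega> i (k - 1)"
    by (simp only: lin)
  also have "\<dots> = mean initial \<omega> i k + ?r * flux \<delta>_in (mean initial \<omega> i) k"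
    by (simp add: flux_def algebra_simps)
  finally show ?case
    unfolding expected_sum_Suc by (cases "\<omega> i") (auto simp: birth_def)
qed

lemma initial_beyond:
  assumes "card (arcs G0) < k"
  shows "initial k = 0"
proof -
  have "in_degree G0 v \<noteq> k" for v
    using fin_digraph.in_degree_le_card_arcs[OF G0(1), of v] assms by linarith
  then show ?thesis by (simp add: initial_def n_in_def)
qed

lemma admissible_initial: "admissible initial \<omega> N"
  unfolding admissible_def
proof (intro conjI allI impI)
  show "initial k = 0" if "card (arcs G0) < k" for k using initial_beyond[OF that] .
  fix i k
  show "0 \<le> mean initial \<omega> i k"
    unfolding expected_count_eq_mean[symmetric] by (rule expected_sum_nonneg) simp
  have "expected_sum \<omega> i (\<lambda>j. of_bool (j = k))
      \<le> measure_pmf.expectation (graph_of_kinds \<omega> i) (\<lambda>_. real (card (verts G0)) + real i)"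
    unfolding expected_sum_def
  proof (rule expectation_mono_finite[OF finite_graph_of_kinds])
    fix G assume "G \<in> set_pmf (graph_of_kinds \<omega> i)"
    then have "reachable \<omega> i G" by (rule reachable_graph_of_kinds)
    moreover have "cnt From_New \<omega> i + cnt To_New \<omega> i \<le> real i" by (induction i) auto
    moreover have "vertex_sum (\<lambda>j. of_bool (j = k)) G \<le> (\<Sum>v\<in>verts G. 1)"
      unfolding vertex_sum_def by (intro sum_mono) auto
    ultimately show "vertex_sum (\<lambda>j. of_bool (j = k)) G \<le> real (card (verts G0)) + real i"
      by (simp add: reachable_def)
  qed
  then show "mean initial \<omega> i k \<le> real (card (verts G0)) + real i"
    by (simp add: expected_count_eq_mean)
qed

lemma prob_deviation_le:
  assumes "0 < e"
  shows "measure_pmf.prob (graph_of_kinds \<omega> i) {G. e \<le> \<bar>real (n_in G k) - mean initial \<omega> i k\<bar>}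
    \<le> 2 * mean initial \<omega> i k / e\<^sup>2"
proof -
  let ?h = "\<lambda>j. of_bool (j = k) :: real"
  let ?M = "measure_pmf (graph_of_kinds \<omega> i)"
  have "measure_pmf.prob (graph_of_kinds \<omega> i) {G. e \<le> \<bar>real (n_in G k) - mean initial \<omega> i k\<bar>}
      = measure_pmf.prob (graph_of_kinds \<omega> i) {G. e \<le> \<bar>vertex_sum ?h G - expected_sum \<omega> i ?h\<bar>}"
  proof (intro measure_pmf.finite_measure_eq_AE)
    show "AE G in ?M. (G \<in> {G. e \<le> \<bar>real (n_in G k) - mean initial \<omega> i k\<bar>})
        = (G \<in> {G. e \<le> \<bar>vertex_sum ?h G - expected_sum \<omega> i ?h\<bar>})"
      unfolding AE_measure_pmf_iff
      by (auto simp: expected_count_eq_mean n_in_eq_vertex_sum fin_digraph.finite_verts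
          dest!: reachable_graph_of_kinds fin_G)
  qed auto
  also have "\<dots> \<le> measure_pmf.expectation (graph_of_kinds \<omega> i) (\<lambda>G. (vertex_sum ?h G - expected_sum \<omega> i ?h)\<^sup>2) / e\<^sup>2"
    using measure_pmf.Chebyshev_inequality[of "vertex_sum ?h" "graph_of_kinds \<omega> i" e] assms
    by (simp add: expected_sum_def)
  also have "\<dots> \<le> 2 * expected_sum \<omega> i (\<lambda>j. (?h j)\<^sup>2) / e\<^sup>2"
    by (intro divide_right_mono variance_vertex_sum_le) simp
  \<comment> \<open>An indicator is its own square; thus the variance bound becomes twice the
    mean.\<close>
  also have "(\<lambda>j. (?h j)\<^sup>2) = ?h" by auto
  finally show ?thesis by (simp add: expected_count_eq_mean)
qed

lemma prob_large_le:
  assumes "0 < e"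
  shows "measure_pmf.prob (graph_of_kinds \<omega> i) {G. e \<le> real (n_in G k)} \<le> mean initial \<omega> i k / e"
proof -
  have "measure_pmf.expectation (graph_of_kinds \<omega> i) (\<lambda>G. real (n_in G k)) = mean initial \<omega> i k"
    unfolding expected_count_eq_mean[symmetric] expected_sum_def
    by (rule expectation_cong_pmf)
      (auto simp: n_in_eq_vertex_sum fin_digraph.finite_verts dest!: reachable_graph_of_kinds fin_G)
  moreover have "measure_pmf.prob (graph_of_kinds \<omega> i) {G \<in> space (measure_pmf (graph_of_kinds \<omega> i)). e \<le> real (n_in G k)}
      \<le> measure_pmf.expectation (graph_of_kinds \<omega> i) (\<lambda>G. real (n_in G k)) / e"
    by (rule integral_Markov_inequality_measure[where A = "{}"]) (use assms in auto)
  ultimately show ?thesis by simp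
qed

end

section \<open>Random step kinds\<close>

lemma measure_bind_le:
  assumes fin: "finite (set_pmf p)" "\<And>x. x \<in> set_pmf p \<Longrightarrow> finite (set_pmf (f x))"
    and bound: "\<And>x. x \<in> set_pmf p \<Longrightarrow> x \<notin> A \<Longrightarrow> measure_pmf.prob (f x) B \<le> r"
    and r: "0 \<le> r"
  shows "measure_pmf.prob (bind_pmf p f) B \<le> measure_pmf.prob p A + r"
proof -
  have "measure_pmf.prob (bind_pmf p f) B = measure_pmf.expectation (bind_pmf p f) (indicat_real B)"
    by simp
  also have "\<dots> = measure_pmf.expectation p (\<lambda>x. measure_pmf.expectation (f x) (indicat_real B))"
    by (rule expectation_bind_finite[OF fin])
  also have "\<dots> \<le> measure_pmf.expectation p (\<lambda>x. indicat_real A x + r)"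
  proof (rule expectation_mono_finite[OF fin(1)])
    fix x assume "x \<in> set_pmf p"
    then show "measure_pmf.expectation (f x) (indicat_real B) \<le> indicat_real A x + r"
      using bound[of x] r order_trans[OF measure_pmf.prob_le_1[of "f x" B], of "1 + r"]
      by (cases "x \<in> A") auto
  qed
  also have "\<dots> = measure_pmf.prob p A + r"
    by (subst Bochner_Integration.integral_add) (auto intro: integrable_measure_pmf_finite[OF fin(1)])
  finally show ?thesis .
qed

lemma UNIV_step_kind: "UNIV = {From_New, Between_Old, To_New}"
proof -
  have "k \<in> {From_New, Between_Old, To_New}" for k by (cases k) auto
  then show ?thesis by blast
qed

lemma finite_step_kind: "finite (A :: step_kind set)"
  by (rule finite_subset[OF subset_UNIV]) (simp add: UNIV_step_kind)

section \<open>Drawing all kinds in advance\<close>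

context graph_process
begin

definition kinds :: "nat \<Rightarrow> (nat \<Rightarrow> step_kind) pmf" where
  "kinds N = Pi_pmf {..<N} From_New (\<lambda>_. step_kind_pmf \<alpha> \<beta> \<gamma>)"

lemma graph_of_kinds_cong:
  "(\<And>j. j < i \<Longrightarrow> \<omega> j = \<omega>' j) \<Longrightarrow> graph_of_kinds \<omega> i = graph_of_kinds \<omega>' i"
  by (induction i) auto

lemma graph_step_eq: "graph_step \<alpha> \<beta> \<gamma> \<delta>_in \<delta>_out G = bind_pmf (step_kind_pmf \<alpha> \<beta> \<gamma>) (\<lambda>k. kind_step k G)"
  by (simp add: graph_step_def kind_step_def)

text \<open>Kinds are chosen independently of the past, so the draw of the next kind commutes with
  the construction of the graph and can be moved into the product law.\<close>

lemma random_graph_eq: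
  "random_graph \<alpha> \<beta> \<gamma> \<delta>_in \<delta>_out G0 (card (arcs G0) + N)
     = bind_pmf (kinds N) (\<lambda>\<omega>. graph_of_kinds \<omega> N)"
proof (induction N)
  case 0
  show ?case by (simp add: random_graph_def kinds_def pmf_Pi_empty bind_return_pmf)
next
  case (Suc N)
  let ?k = "step_kind_pmf \<alpha> \<beta> \<gamma>"
  have "random_graph \<alpha> \<beta> \<gamma> \<delta>_in \<delta>_out G0 (card (arcs G0) + Suc N)
      = bind_pmf (bind_pmf (kinds N) (\<lambda>\<omega>. graph_of_kinds \<omega> N)) (graph_step \<alpha> \<beta> \<gamma> \<delta>_in \<delta>_out)"
    using Suc by (simp add: random_graph_def)
  also have "\<dots> = bind_pmf (kinds N) (\<lambda>\<omega>. bind_pmf (graph_of_kinds \<omega> N) (\<lambda>G. bind_pmf ?k (\<lambda>k. kind_step k G)))"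
    by (simp add: bind_assoc_pmf graph_step_eq[abs_def])
  also have "\<dots> = bind_pmf (kinds N) (\<lambda>\<omega>. bind_pmf ?k (\<lambda>k. bind_pmf (graph_of_kinds \<omega> N) (kind_step k)))"
    by (subst bind_commute_pmf) simp
  also have "\<dots> = bind_pmf ?k (\<lambda>k. bind_pmf (kinds N) (\<lambda>\<omega>. bind_pmf (graph_of_kinds \<omega> N) (kind_step k)))"
    by (rule bind_commute_pmf)
  also have "\<dots> = bind_pmf ?k (\<lambda>k. bind_pmf (kinds N) (\<lambda>\<omega>. graph_of_kinds (fun_upd \<omega> N k) (Suc N)))"
  proof -
    have "graph_of_kinds \<omega> N = graph_of_kinds (fun_upd \<omega> N k) N" for \<omega> k
      by (rule graph_of_kinds_cong) simp
    then show ?thesis by simp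
  qed
  also have "\<dots> = bind_pmf (kinds (Suc N)) (\<lambda>\<omega>. graph_of_kinds \<omega> (Suc N))"
    unfolding kinds_def lessThan_Suc
    by (subst Pi_pmf_insert') (simp_all add: bind_assoc_pmf bind_return_pmf del: graph_of_kinds.simps)
  finally show ?case .
qed

lemma finite_kinds: "finite (set_pmf (kinds N))"
  unfolding kinds_def by (subst set_Pi_pmf) (auto intro!: finite_PiE_dflt finite_step_kind)

lemma kinds_component:
  "j < N \<Longrightarrow> map_pmf (\<lambda>\<omega>. \<omega> j) (kinds N) = step_kind_pmf \<alpha> \<beta> \<gamma>"
  by (simp add: kinds_def Pi_pmf_component)

text \<open>An exclusion on the whole support; it serves the case \<alpha> = 0, where
  \<open>f 0 = 0\<close>.\<close>

lemma kinds_ne_From_New: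
  assumes "\<alpha> = 0" "\<omega> \<in> set_pmf (kinds N)" "j < N"
  shows "\<omega> j \<noteq> From_New"
proof -
  have "\<omega> j \<in> set_pmf (map_pmf (\<lambda>\<omega>. \<omega> j) (kinds N))" using assms by auto
  then have "pmf (step_kind_pmf \<alpha> \<beta> \<gamma>) (\<omega> j) \<noteq> 0"
    using assms(3) by (simp add: kinds_component set_pmf_iff)
  then show ?thesis using pmf_step_kind(1)[OF \<alpha> \<beta> \<gamma> sum1] assms(1) by auto
qed

section \<open>Deviations of the step counts\<close>

lemma prob_cnt_deviation:
  assumes i: "0 < i" "i \<le> N" and e: "0 \<le> e" and p: "p = pmf (step_kind_pmf \<alpha> \<beta> \<gamma>) k"
  shows "measure_pmf.prob (kinds N) {\<omega>. e \<le> \<bar>cnt k \<omega> i - p * real i\<bar>} \<le> 2 * exp (- 2 * e\<^sup>2 / real i)"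
proof -
  let ?M = "measure_pmf (kinds N)"
  let ?X = "\<lambda>j \<omega>. of_bool (\<omega> j = k) :: real"
  have exp: "measure_pmf.expectation (kinds N) (?X j) = p" if "j < i" for j
  proof -
    have "measure_pmf.expectation (kinds N) (?X j)
        = measure_pmf.expectation (map_pmf (\<lambda>\<omega>. \<omega> j) (kinds N)) (\<lambda>y. of_bool (y = k))"
      by simp
    also have "\<dots> = measure_pmf.expectation (step_kind_pmf \<alpha> \<beta> \<gamma>) (indicat_real {k})"
      using that i by (simp add: kinds_component indicator_def[abs_def])
    finally show ?thesis by (simp add: p measure_pmf_single)
  qed
  have "prob_space.indep_vars ?M (\<lambda>_. count_space UNIV) (\<lambda>j \<omega>. \<omega> j) {..<N}"
    unfolding kinds_def by (rule indep_vars_Pi_pmf) simp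
  then have "prob_space.indep_vars ?M (\<lambda>_. count_space UNIV) (\<lambda>j \<omega>. \<omega> j) {..<i}"
    using i by (elim prob_space.indep_vars_subset[OF measure_pmf.prob_space_axioms]) auto
  then have ind: "prob_space.indep_vars ?M (\<lambda>_. borel) ?X {..<i}"
    by (rule prob_space.indep_vars_compose2[OF measure_pmf.prob_space_axioms]) auto
  interpret Hoeffding_ineq ?M "{..<i}" ?X "\<lambda>_. 0" "\<lambda>_. 1" "\<Sum>j<i. measure_pmf.expectation (kinds N) (?X j)"
    by unfold_locales (auto simp: ind)
  have "measure_pmf.prob (kinds N) {\<omega> \<in> space ?M. e \<le> \<bar>(\<Sum>j<i. ?X j \<omega>) - (\<Sum>j<i. measure_pmf.expectation (kinds N) (?X j))\<bar>}
      \<le> 2 * exp (- 2 * e\<^sup>2 / (\<Sum>j<i. (1 - 0)\<^sup>2))"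
    by (rule Hoeffding_ineq_abs_ge) (use e i in auto)
  moreover have "(\<Sum>j<i. measure_pmf.expectation (kinds N) (?X j)) = p * real i"
  proof -
    have "(\<Sum>j<i. measure_pmf.expectation (kinds N) (?X j)) = (\<Sum>j<i. p)"
      by (intro sum.cong refl exp) auto
    then show ?thesis by simp
  qed
  ultimately show ?thesis by (simp add: cnt_def)
qed

lemma prob_deviation_large:
  assumes i: "0 < i" "i \<le> N" and e: "0 \<le> e"
  shows "measure_pmf.prob (kinds N) {\<omega>. e < deviation \<omega> i} \<le> 4 * exp (- (e\<^sup>2 / (2 * real i)))"
proof -
  let ?A = "\<lambda>k p. {\<omega>. e / 2 \<le> \<bar>cnt k \<omega> i - p * real i\<bar>}"
  have "{\<omega>. e < deviation \<omega> i} \<subseteq> ?A From_New \<alpha> \<union> ?A To_New \<gamma>"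
    by (auto simp: deviation_def)
  then have "measure_pmf.prob (kinds N) {\<omega>. e < deviation \<omega> i}
      \<le> measure_pmf.prob (kinds N) (?A From_New \<alpha> \<union> ?A To_New \<gamma>)"
    by (intro measure_pmf.finite_measure_mono) auto
  also have "\<dots> \<le> measure_pmf.prob (kinds N) (?A From_New \<alpha>) + measure_pmf.prob (kinds N) (?A To_New \<gamma>)"
    by (rule measure_Un_le) auto
  also have "\<dots> \<le> 2 * exp (- 2 * (e / 2)\<^sup>2 / real i) + 2 * exp (- 2 * (e / 2)\<^sup>2 / real i)"
    using i e pmf_step_kind[OF \<alpha> \<beta> \<gamma> sum1] by (intro add_mono prob_cnt_deviation) auto
  finally show ?thesis by (simp add: power_divide)
qed

lemma prob_ex_deviation_large:
  assumes e: "\<And>i. 0 \<le> e i"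
  shows "measure_pmf.prob (kinds N) {\<omega>. \<exists>i\<le>N. e i < deviation \<omega> i}
    \<le> (\<Sum>i=1..N. 4 * exp (- ((e i)\<^sup>2 / (2 * real i))))"
proof -
  have "{\<omega>. \<exists>i\<le>N. e i < deviation \<omega> i} \<subseteq> (\<Union>i\<in>{1..N}. {\<omega>. e i < deviation \<omega> i})"
  proof
    fix \<omega> assume "\<omega> \<in> {\<omega>. \<exists>i\<le>N. e i < deviation \<omega> i}"
    then obtain i where i: "i \<le> N" "e i < deviation \<omega> i" by blast
    have "i \<noteq> 0"
    proof
      assume "i = 0"
      then show False using i(2) e[of 0] by (simp add: deviation_def)
    qed
    then show "\<omega> \<in> (\<Union>i\<in>{1..N}. {\<omega>. e i < deviation \<omega> i})" using i by auto
  qed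
  then have "measure_pmf.prob (kinds N) {\<omega>. \<exists>i\<le>N. e i < deviation \<omega> i}
      \<le> measure_pmf.prob (kinds N) (\<Union>i\<in>{1..N}. {\<omega>. e i < deviation \<omega> i})"
    by (intro measure_pmf.finite_measure_mono) auto
  also have "\<dots> \<le> (\<Sum>i=1..N. measure_pmf.prob (kinds N) {\<omega>. e i < deviation \<omega> i})"
    by (intro measure_pmf.finite_measure_subadditive_finite) auto
  also have "\<dots> \<le> (\<Sum>i=1..N. 4 * exp (- ((e i)\<^sup>2 / (2 * real i))))"
    using e by (intro sum_mono prob_deviation_large) auto
  finally show ?thesis .
qed

text \<open>The Hoeffding bounds are summable over all times, so the estimate is uniform in
  \<open>N\<close>, and \<open>L\<close> can be fixed before \<open>N\<close> grows.\<close>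

lemma prob_not_regular_le:
  obtains K :: real where "0 < K"
    "\<And>L N. 1 \<le> L \<Longrightarrow> measure_pmf.prob (kinds N) {\<omega>. \<not> regular L \<omega> N} \<le> K / L"
proof -
  have s: "summable (\<lambda>i. 1 / (real i)\<^sup>2)"
    using inverse_power_summable[of 2, where 'a = real] by (simp add: inverse_eq_divide)
  define K where "K = 4 * 4096 * (suminf (\<lambda>i. 1 / (real i)\<^sup>2) + 1)"
  show ?thesis
  proof (rule that[of K])
    have "0 \<le> suminf (\<lambda>i. 1 / (real i)\<^sup>2)" by (rule suminf_nonneg[OF s]) simp
    then show "0 < K" by (simp add: K_def)
    fix L :: real and N :: nat assume L: "1 \<le> L"
    have "{\<omega>. \<not> regular L \<omega> N} = {\<omega>. \<exists>i\<le>N. L * real i powr (3 / 4) < deviation \<omega> i}"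
      by (auto simp: regular_def not_le)
    then have "measure_pmf.prob (kinds N) {\<omega>. \<not> regular L \<omega> N}
        \<le> (\<Sum>i=1..N. 4 * exp (- ((L * real i powr (3 / 4))\<^sup>2 / (2 * real i))))"
      using prob_ex_deviation_large[of "\<lambda>i. L * real i powr (3 / 4)" N] L by simp
    also have "\<dots> \<le> (\<Sum>i=1..N. 4 * 4096 / L * (1 / (real i)\<^sup>2))"
    proof (rule sum_mono)
      fix i assume i: "i \<in> {1..N}"
      define y where "y = (L * real i powr (3 / 4))\<^sup>2 / (2 * real i)"
      have "(real i powr (3 / 4))\<^sup>2 = real i powr (3 / 2)"
        using i by (simp add: power2_eq_square powr_add[symmetric])
      also have "\<dots> = real i * sqrt (real i)"
        using i by (simp add: powr_half_sqrt[symmetric] powr_mult_base)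
      finally have y: "y = L\<^sup>2 * sqrt (real i) / 2"
        using i by (simp add: y_def power_mult_distrib)
      have y_nn: "0 < y" using i L by (simp add: y)
      \<comment> \<open>The fourth power turns \<open>sqrt i\<close> into the summable order
        \<open>i ^ 2\<close>; as \<open>y / 4\<close> is \<open>L^2 * sqrt i / 8\<close>, the
        constant is \<open>8 ^ 4 = 4096\<close>.\<close>
      have "(y / 4) ^ 4 \<le> (1 + y / 4) ^ 4" using y_nn by (intro power_mono) auto
      also have "\<dots> \<le> exp y" using exp_ge_one_plus_x_over_n_power_n[of 4 y] y_nn by simp
      finally have "1 / exp y \<le> 1 / (y / 4) ^ 4" using y_nn by (intro divide_left_mono) auto
      also have "(y / 4) ^ 4 = L ^ 8 * (real i)\<^sup>2 / 4096"
      proof -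
        have "sqrt (real i) ^ 4 = (real i)\<^sup>2"
          using power_mult[of "sqrt (real i)" 2 2] by simp
        moreover have "(L\<^sup>2) ^ 4 = L ^ 8" using power_mult[of L 2 4] by simp
        ultimately show ?thesis by (simp add: y power_mult_distrib power_divide)
      qed
      also have "1 / (L ^ 8 * (real i)\<^sup>2 / 4096) = 4096 / L ^ 8 * (1 / (real i)\<^sup>2)" by simp
      also have "\<dots> \<le> 4096 / L * (1 / (real i)\<^sup>2)"
        using L power_increasing[of 1 8 L] by (intro mult_right_mono divide_left_mono) auto
      finally show "4 * exp (- ((L * real i powr (3 / 4))\<^sup>2 / (2 * real i))) \<le> 4 * 4096 / L * (1 / (real i)\<^sup>2)"
        unfolding y_def[symmetric] by (simp add: exp_minus inverse_eq_divide)
    qed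
    also have "\<dots> = 4 * 4096 / L * (\<Sum>i=1..N. 1 / (real i)\<^sup>2)" by (simp only: sum_distrib_left)
    also have "\<dots> \<le> 4 * 4096 / L * (suminf (\<lambda>i. 1 / (real i)\<^sup>2) + 1)"
      using sum_le_suminf[OF s, of "{1..N}"] L by (intro mult_left_mono) auto
    finally show "measure_pmf.prob (kinds N) {\<omega>. \<not> regular L \<omega> N} \<le> K / L"
      by (simp add: K_def)
  qed
qed

lemma prob_ex_deviation_sqrt:
  assumes "0 \<le> \<kappa>"
  shows "measure_pmf.prob (kinds N) {\<omega>. \<exists>i\<le>N. \<kappa> * sqrt (real i) < deviation \<omega> i}
    \<le> 4 * real N * exp (- (\<kappa>\<^sup>2 / 2))"
proof -
  have "measure_pmf.prob (kinds N) {\<omega>. \<exists>i\<le>N. \<kappa> * sqrt (real i) < deviation \<omega> i}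
      \<le> (\<Sum>i=1..N. 4 * exp (- ((\<kappa> * sqrt (real i))\<^sup>2 / (2 * real i))))"
    using assms by (intro prob_ex_deviation_large) auto
  also have "\<dots> = (\<Sum>i=1..N. 4 * exp (- (\<kappa>\<^sup>2 / 2)))"
    by (intro sum.cong) (auto simp: power_mult_distrib)
  finally show ?thesis by simp
qed

text \<open>In the absence of \<open>From_New\<close> steps no vertex is born with in-degree 0, and
  such vertices can only be lost.\<close>

lemma mean_0_le_initial:
  assumes "\<And>j. j < i \<Longrightarrow> \<omega> j \<noteq> From_New"
  shows "mean initial \<omega> i 0 \<le> initial 0"
  using assms
proof (induction i)
  case (Suc i)
  have "0 \<le> rate \<omega> i * (\<delta>_in * mean initial \<omega> i 0)"
    using rate_nonneg \<delta> admissible_initial[of \<omega> i] by (simp add: admissible_def)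
  moreover have "\<omega> i \<noteq> From_New" using Suc.prems by simp
  ultimately show ?case using Suc by simp
qed simp

section \<open>Typical kinds and the final estimate\<close>

definition fluctuation :: "nat \<Rightarrow> real" where
  "fluctuation N = ln (real N) powr (3 / 4)"

text \<open>The exponent \<open>3 / 4\<close> in \<open>fluctuation\<close> lies above
  \<open>1 / 2\<close>, so \<open>N * exp (- (fluctuation N)^2 / 2)\<close> tends to 0, and below 1,
  so that \<open>fluctuation N\<close> is negligible against \<open>ln N\<close>.\<close>

definition typical :: "real \<Rightarrow> (nat \<Rightarrow> step_kind) \<Rightarrow> nat \<Rightarrow> bool" where
  "typical L \<omega> N \<longleftrightarrow> regular L \<omega> N \<and> (\<forall>i\<le>N. deviation \<omega> i \<le> fluctuation N * sqrt (real i))"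

definition atypical_graphs :: "real \<Rightarrow> nat \<Rightarrow> nat \<Rightarrow> ('a, 'b) pre_digraph set" where
  "atypical_graphs \<epsilon> d t = {G. \<not> \<bar>real (n_in G d) - f d * real t\<bar>
     \<le> (sqrt (f d * real t) + (real d + 1) powr (- 1 / 2 + \<epsilon>)) * ln (real t)}"

text \<open>The excluded case is \<open>d = 0\<close> with \<alpha> = 0, where
  \<open>f 0 = 0\<close> but \<open>majorant 0 = f 1\<close> is positive.\<close>

lemma majorant_le_f:
  obtains C where "1 \<le> C" "\<And>d. 0 < d \<or> 0 < \<alpha> \<Longrightarrow> majorant d \<le> C * f d"
proof (cases "\<alpha> = 0")
  case True
  show ?thesis
  proof (rule that[of 1])
    fix d :: nat assume "0 < d \<or> 0 < \<alpha>"
    with True have "d \<noteq> 0" by auto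
    then show "majorant d \<le> 1 * f d" by (simp add: majorant_def)
  qed simp
next
  case False
  then have "0 < \<alpha>" using \<alpha> by simp
  moreover have "0 < 1 + c * \<delta>_in" using c_pos \<delta> by (simp add: add_pos_nonneg)
  ultimately have f0: "0 < f 0" using f_0 by (metis zero_less_mult_pos)
  show ?thesis
  proof (rule that[of "max 1 (majorant 0 / f 0)"])
    fix d
    have "majorant 0 = majorant 0 / f 0 * f 0" using f0 by simp
    also have "\<dots> \<le> max 1 (majorant 0 / f 0) * f 0" using f0 by (intro mult_right_mono) auto
    finally have "majorant 0 \<le> max 1 (majorant 0 / f 0) * f 0" .
    moreover have "f d \<le> max 1 (majorant 0 / f 0) * f d"
      using mult_right_mono[of 1 "max 1 (majorant 0 / f 0)" "f d"] f_nonneg[of d] by simp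
    ultimately show "majorant d \<le> max 1 (majorant 0 / f 0) * f d" by (cases "d = 0") (auto simp: majorant_def)
  qed simp
qed

lemma prob_atypical_given_kinds:
  assumes L: "0 \<le> L"
  obtains \<rho> :: "nat \<Rightarrow> real" where "\<rho> \<longlonglongrightarrow> 0" "\<And>N. 0 \<le> \<rho> N"
    "\<forall>\<^sub>F N in sequentially. \<forall>\<omega> d. typical L \<omega> N \<longrightarrow> (\<alpha> = 0 \<longrightarrow> (\<forall>j<N. \<omega> j \<noteq> From_New)) \<longrightarrow>
       measure_pmf.prob (graph_of_kinds \<omega> N) (atypical_graphs \<epsilon> d (card (arcs G0) + N)) \<le> \<rho> N"
proof -
  let ?t0 = "card (arcs G0)"
  obtain C1 :: real and i1 :: nat where C1: "0 < C1"
    "\<And>\<pi> \<omega> N d \<kappa>. regular L \<omega> N \<Longrightarrow> admissible \<pi> \<omega> N \<Longrightarrow> i1 \<le> N \<Longrightarrow> 1 \<le> \<kappa> \<Longrightarrow>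
       (\<And>i. i \<le> N \<Longrightarrow> deviation \<omega> i \<le> \<kappa> * sqrt (real i)) \<Longrightarrow>
       1 \<le> majorant d * (real N + 1) \<Longrightarrow>
       \<bar>mean \<pi> \<omega> N d - f d * (real ?t0 + real N)\<bar> \<le> C1 * \<kappa> * sqrt (majorant d * (real N + 1))"
    by (rule mean_close[OF L], rule that; blast)
  obtain C2 :: real and i2 :: nat where C2: "0 < C2"
    "\<And>\<pi> \<omega> N k. regular L \<omega> N \<Longrightarrow> admissible \<pi> \<omega> N \<Longrightarrow> i2 \<le> N \<Longrightarrow>
       mean \<pi> \<omega> N k \<le> C2 * (majorant k * (real N + 1))"
    by (rule mean_le_majorant[OF L], rule that; blast)
  obtain C3 where C3: "1 \<le> C3" "\<And>d. 0 < d \<or> 0 < \<alpha> \<Longrightarrow> majorant d \<le> C3 * f d"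
    using majorant_le_f by blast
  define T where "T N = ln (real ?t0 + real N)" for N
  \<comment> \<open>Both constants come from \<open>m \<le> 2 * C2 * C3 * z\<close>: Chebyshev at
    distance \<open>sqrt z * T / 2\<close> gives \<open>2 * m * 4 / (z * T^2)\<close>, and Markov at
    \<open>sqrt z * T\<close> leaves a factor \<open>sqrt z \<le> sqrt (t0 + 1)\<close>.\<close>
  define a where "a = 16 * C2 * C3"
  define b where "b = 2 * C2 * C3 * sqrt (real ?t0 + 1)"
  define \<rho> where "\<rho> N = a / (T N)\<^sup>2 + b / \<bar>T N\<bar> + initial 0 / \<bar>T N\<bar>" for N
  have nn: "0 \<le> a" "0 \<le> b" "0 \<le> initial 0" using C2(1) C3(1) by (auto simp: a_def b_def initial_def)
  have "\<rho> \<longlonglongrightarrow> 0" unfolding \<rho>_def T_def by real_asymp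
  moreover have "0 \<le> \<rho> N" for N using nn by (simp add: \<rho>_def)
  moreover have "\<forall>\<^sub>F N in sequentially. 1 \<le> fluctuation N" unfolding fluctuation_def by real_asymp
  moreover have "\<forall>\<^sub>F N in sequentially. C1 * fluctuation N * sqrt (2 * C3) \<le> T N / 2"
    unfolding fluctuation_def T_def by real_asymp
  moreover have "\<forall>\<^sub>F N in sequentially. sqrt (real ?t0 + 1) < T N" unfolding T_def by real_asymp
  moreover have "\<forall>\<^sub>F N in sequentially. max 1 (max i1 i2) \<le> N" by (rule eventually_ge_at_top)
  ultimately show ?thesis
  proof (intro that[of \<rho>], goal_cases)
    case 3
    from 3(3-6) show ?case
    proof eventually_elim
      case (elim N)
      show ?case
      proof (intro allI impI)
        fix \<omega> d
        assume typical: "typical L \<omega> N" and no: "\<alpha> = 0 \<longrightarrow> (\<forall>j<N. \<omega> j \<noteq> From_New)"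
        define t where "t = ?t0 + N"
        define z where "z = f d * real t"
        define x where "x = majorant d * (real N + 1)"
        define m where "m = mean initial \<omega> N d"
        have reg: "regular L \<omega> N" and dev: "\<And>i. i \<le> N \<Longrightarrow> deviation \<omega> i \<le> fluctuation N * sqrt (real i)"
          using typical by (auto simp: typical_def)
        have Tt: "ln (real t) = T N" by (simp add: T_def t_def)
        have sq: "1 \<le> sqrt (real ?t0 + 1)" by simp
        have T1: "1 < T N" using elim(3) sq by linarith
        have z_nn: "0 \<le> z" using f_nonneg[of d] by (simp add: z_def)
        have bad: "sqrt z * T N < \<bar>real (n_in G d) - z\<bar>"
          "(real d + 1) powr (- 1 / 2 + \<epsilon>) * T N < \<bar>real (n_in G d) - z\<bar>"
          if "G \<in> atypical_graphs \<epsilon> d t" for G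
        proof -
          have "(sqrt z + (real d + 1) powr (- 1 / 2 + \<epsilon>)) * T N < \<bar>real (n_in G d) - z\<bar>"
            using that by (simp add: atypical_graphs_def Tt z_def)
          moreover have "0 \<le> sqrt z * T N" "0 \<le> (real d + 1) powr (- 1 / 2 + \<epsilon>) * T N"
            using z_nn T1 by auto
          ultimately show "sqrt z * T N < \<bar>real (n_in G d) - z\<bar>"
            "(real d + 1) powr (- 1 / 2 + \<epsilon>) * T N < \<bar>real (n_in G d) - z\<bar>"
            unfolding distrib_right by linarith+
        qed
        have "measure_pmf.prob (graph_of_kinds \<omega> N) (atypical_graphs \<epsilon> d t) \<le> \<rho> N"
        proof (cases "0 < d \<or> 0 < \<alpha>")
          case False
          \<comment> \<open>Here \<open>z = 0\<close> and the second summand, equal to 1 at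
            \<open>d = 0\<close>, carries the bound: the count would have to exceed
            \<open>T N\<close>, while its mean never exceeds the initial count.\<close>
          then have d: "d = 0" "\<alpha> = 0" using \<alpha> by auto
          then have "f 0 = 0" using f_0 c_pos \<delta> by (simp add: add_pos_nonneg less_imp_neq[THEN not_sym])
          then have "z = 0" using d by (simp add: z_def)
          then have "atypical_graphs \<epsilon> d t \<subseteq> {G. T N \<le> real (n_in G d)}"
            using bad(2) d(1) by fastforce
          then have "measure_pmf.prob (graph_of_kinds \<omega> N) (atypical_graphs \<epsilon> d t)
              \<le> measure_pmf.prob (graph_of_kinds \<omega> N) {G. T N \<le> real (n_in G d)}"
            by (intro measure_pmf.finite_measure_mono) auto
          also have "\<dots> \<le> mean initial \<omega> N d / T N" using T1 by (intro prob_large_le) auto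
          also have "\<dots> \<le> initial 0 / T N"
            using mean_0_le_initial[of N \<omega>] no d T1 by (intro divide_right_mono) auto
          also have "\<dots> \<le> \<rho> N" using nn T1 by (simp add: \<rho>_def)
          finally show ?thesis .
        next
          case True
          have f: "0 < f d" using C3 True majorant_pos[of d]
            by (metis less_le_trans zero_less_mult_pos zero_less_one)
          have t: "real N + 1 \<le> 2 * real t" using elim(4) by (simp add: t_def)
          have z: "0 < z" using f elim(4) by (simp add: z_def t_def)
          have "x \<le> (C3 * f d) * (2 * real t)"
            unfolding x_def using C3(1) C3(2)[OF True] f t by (intro mult_mono) auto
          then have xz: "x \<le> 2 * C3 * z" by (simp add: z_def mult_ac)
          have m: "m \<le> C2 * x" unfolding m_def x_def
            by (rule C2(2)[OF reg admissible_initial]) (use elim(4) in simp)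
          also have "\<dots> \<le> C2 * (2 * C3 * z)" using xz C2(1) by (intro mult_left_mono) auto
          finally have mz: "m \<le> 2 * C2 * C3 * z" by (simp add: mult_ac)
          show ?thesis
          proof (cases "1 \<le> x")
            case True
            have "\<bar>m - z\<bar> \<le> C1 * fluctuation N * sqrt x"
              using C1(2)[OF reg admissible_initial _ elim(1) dev, of d] True elim(4)
              by (simp add: m_def z_def t_def x_def)
            also have "\<dots> \<le> C1 * fluctuation N * sqrt (2 * C3 * z)"
              using xz C1(1) elim(1) by (intro mult_left_mono) auto
            also have "\<dots> = (C1 * fluctuation N * sqrt (2 * C3)) * sqrt z" by (simp add: real_sqrt_mult)
            also have "\<dots> \<le> T N / 2 * sqrt z" using elim(2) z_nn by (intro mult_right_mono) auto
            finally have close: "\<bar>m - z\<bar> \<le> T N / 2 * sqrt z" .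
            let ?e = "sqrt z * T N / 2"
            have "atypical_graphs \<epsilon> d t \<subseteq> {G. ?e \<le> \<bar>real (n_in G d) - m\<bar>}"
            proof
              fix G assume "G \<in> atypical_graphs \<epsilon> d t"
              from bad(1)[OF this] close have "?e \<le> \<bar>real (n_in G d) - m\<bar>" by argo
              then show "G \<in> {G. ?e \<le> \<bar>real (n_in G d) - m\<bar>}" by simp
            qed
            then have "measure_pmf.prob (graph_of_kinds \<omega> N) (atypical_graphs \<epsilon> d t)
                \<le> measure_pmf.prob (graph_of_kinds \<omega> N) {G. ?e \<le> \<bar>real (n_in G d) - m\<bar>}"
              by (intro measure_pmf.finite_measure_mono) auto
            also have "\<dots> \<le> 2 * m / ?e\<^sup>2"
              unfolding m_def using z T1 by (intro prob_deviation_le) auto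
            also have "\<dots> \<le> 2 * (2 * C2 * C3 * z) / ?e\<^sup>2" using mz by (intro divide_right_mono) auto
            also have "\<dots> = a / (T N)\<^sup>2" using z by (simp add: a_def power_mult_distrib power_divide)
            also have "\<dots> \<le> \<rho> N" using nn T1 by (simp add: \<rho>_def)
            finally show ?thesis .
          next
            case False
            \<comment> \<open>As \<open>x < 1\<close>, \<open>z\<close> is at most
              \<open>t0 + 1\<close> and \<open>z < sqrt z * T N\<close>. The count cannot fall below
              \<open>z\<close> by that much, so an atypical graph has more than
              \<open>sqrt z * T N\<close> such vertices, and Markov's inequality with a mean of
              order \<open>z\<close> suffices.\<close>
            have "z \<le> majorant d * ((real ?t0 + 1) * (real N + 1))"
              unfolding z_def using f_le_majorant f majorant_pos[of d] by (intro mult_mono) (auto simp: t_def algebra_simps)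
            also have "\<dots> = (real ?t0 + 1) * x" by (simp add: x_def mult_ac)
            also have "\<dots> \<le> (real ?t0 + 1) * 1" using False by (intro mult_left_mono) auto
            finally have z_le: "sqrt z \<le> sqrt (real ?t0 + 1)" by simp
            have zsq: "z = sqrt z * sqrt z" using z by simp
            have zle: "z \<le> sqrt z * sqrt (real ?t0 + 1)"
              using mult_left_mono[OF z_le, of "sqrt z"] z zsq by simp
            have zT: "z < sqrt z * T N"
            proof -
              have "sqrt z * sqrt (real ?t0 + 1) < sqrt z * T N"
                using elim(3) z by (intro mult_strict_left_mono) auto
              then show ?thesis using zle by linarith
            qed
            let ?e = "max 1 (sqrt z * T N)"
            have sub: "atypical_graphs \<epsilon> d t \<subseteq> {G. ?e \<le> real (n_in G d)}"
            proof
              fix G assume "G \<in> atypical_graphs \<epsilon> d t"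
              from bad(1)[OF this] have *: "sqrt z * T N < \<bar>real (n_in G d) - z\<bar>" .
              then have "sqrt z * T N < real (n_in G d)" using zT z_nn by (simp add: abs_if split: if_splits)
              moreover have "0 < sqrt z * T N" using z T1 by simp
              ultimately have "0 < real (n_in G d)" by linarith
              then have "1 \<le> real (n_in G d)" by simp
              then show "G \<in> {G. ?e \<le> real (n_in G d)}" using \<open>sqrt z * T N < real (n_in G d)\<close> by simp
            qed
            then have "measure_pmf.prob (graph_of_kinds \<omega> N) (atypical_graphs \<epsilon> d t)
                \<le> measure_pmf.prob (graph_of_kinds \<omega> N) {G. ?e \<le> real (n_in G d)}"
              by (intro measure_pmf.finite_measure_mono) auto
            also have "\<dots> \<le> m / ?e" unfolding m_def by (intro prob_large_le) auto
            also have "\<dots> \<le> (2 * C2 * C3 * z) / (sqrt z * T N)"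
              using mz z T1 C2(1) C3(1) by (intro frac_le) auto
            also have "\<dots> \<le> (2 * C2 * C3 * (sqrt z * sqrt (real ?t0 + 1))) / (sqrt z * T N)"
              using zle z T1 C2(1) C3(1) by (intro divide_right_mono mult_left_mono) auto
            also have "\<dots> = b / T N" using z by (simp add: b_def)
            also have "\<dots> \<le> \<rho> N" using nn T1 by (simp add: \<rho>_def)
            finally show ?thesis .
          qed
        qed
        then show "measure_pmf.prob (graph_of_kinds \<omega> N) (atypical_graphs \<epsilon> d (?t0 + N)) \<le> \<rho> N"
          by (simp add: t_def)
      qed
    qed
  qed auto
qed

text \<open>The order of choices matters: \<open>L\<close> is fixed from \<eta> first, making
  irregular kinds unlikely for all \<open>N\<close> at once, and only then does \<open>N\<close>
  grow, since \<rho> and the thresholds depend on \<open>L\<close>.\<close>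

lemma prob_atypical_tendsto_0:
  "(\<lambda>N. measure_pmf.prob (random_graph \<alpha> \<beta> \<gamma> \<delta>_in \<delta>_out G0 (card (arcs G0) + N))
     (atypical_graphs \<epsilon> (d N) (card (arcs G0) + N))) \<longlonglongrightarrow> 0"
proof (rule tendstoI)
  fix \<eta> :: real assume \<eta>: "0 < \<eta>"
  obtain K where K: "0 < K"
    "\<And>L N. 1 \<le> L \<Longrightarrow> measure_pmf.prob (kinds N) {\<omega>. \<not> regular L \<omega> N} \<le> K / L"
    using prob_not_regular_le by blast
  define L where "L = max 1 (3 * K / \<eta>)"
  have L: "1 \<le> L" "K / L \<le> \<eta> / 3"
  proof -
    show "1 \<le> L" by (simp add: L_def)
    have "3 * K / \<eta> \<le> L" by (simp add: L_def)
    then show "K / L \<le> \<eta> / 3" using \<eta> \<open>1 \<le> L\<close> by (simp add: field_simps)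
  qed
  then have L0: "0 \<le> L" by simp
  obtain \<rho> :: "nat \<Rightarrow> real" where \<rho>: "\<rho> \<longlonglongrightarrow> 0" "\<And>N. 0 \<le> \<rho> N"
    "\<forall>\<^sub>F N in sequentially. \<forall>\<omega> d. typical L \<omega> N \<longrightarrow> (\<alpha> = 0 \<longrightarrow> (\<forall>j<N. \<omega> j \<noteq> From_New)) \<longrightarrow>
       measure_pmf.prob (graph_of_kinds \<omega> N) (atypical_graphs \<epsilon> d (card (arcs G0) + N)) \<le> \<rho> N"
    using prob_atypical_given_kinds[OF L0, of \<epsilon>] by blast
  have "(\<lambda>N. 4 * real N * exp (- ((fluctuation N)\<^sup>2 / 2))) \<longlonglongrightarrow> 0"
    unfolding fluctuation_def by real_asymp
  then have "\<forall>\<^sub>F N in sequentially. 4 * real N * exp (- ((fluctuation N)\<^sup>2 / 2)) < \<eta> / 3"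
    using \<eta> by (intro order_tendstoD) auto
  moreover have "\<forall>\<^sub>F N in sequentially. \<rho> N < \<eta> / 3"
    using \<eta> \<rho>(1) by (intro order_tendstoD) auto
  ultimately show "\<forall>\<^sub>F N in sequentially. dist (measure_pmf.prob (random_graph \<alpha> \<beta> \<gamma> \<delta>_in \<delta>_out G0 (card (arcs G0) + N))
     (atypical_graphs \<epsilon> (d N) (card (arcs G0) + N))) 0 < \<eta>"
    using \<rho>(3)
  proof eventually_elim
    case (elim N)
    let ?B = "atypical_graphs \<epsilon> (d N) (card (arcs G0) + N)"
    have "measure_pmf.prob (bind_pmf (kinds N) (\<lambda>\<omega>. graph_of_kinds \<omega> N)) ?B
        \<le> measure_pmf.prob (kinds N) {\<omega>. \<not> typical L \<omega> N} + \<rho> N"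
    proof (rule measure_bind_le)
      fix \<omega> assume "\<omega> \<in> set_pmf (kinds N)" "\<omega> \<notin> {\<omega>. \<not> typical L \<omega> N}"
      then show "measure_pmf.prob (graph_of_kinds \<omega> N) ?B \<le> \<rho> N"
        using elim(3) kinds_ne_From_New by blast
    qed (auto simp: finite_kinds finite_graph_of_kinds \<rho>(2))
    also have "measure_pmf.prob (kinds N) {\<omega>. \<not> typical L \<omega> N}
        \<le> measure_pmf.prob (kinds N) {\<omega>. \<not> regular L \<omega> N}
          + measure_pmf.prob (kinds N) {\<omega>. \<exists>i\<le>N. fluctuation N * sqrt (real i) < deviation \<omega> i}"
      by (rule order_trans[OF measure_pmf.finite_measure_mono measure_Un_le])
        (auto simp: typical_def not_le)
    also have "\<dots> \<le> K / L + 4 * real N * exp (- ((fluctuation N)\<^sup>2 / 2))"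
      by (intro add_mono K L prob_ex_deviation_sqrt) (simp add: fluctuation_def)
    finally have "measure_pmf.prob (bind_pmf (kinds N) (\<lambda>\<omega>. graph_of_kinds \<omega> N)) ?B < \<eta>"
      using elim(1,2) L(2) by linarith
    then show ?case by (simp add: random_graph_eq)
  qed
qed

end

theorem theorem2:
  fixes \<alpha> \<beta> \<gamma> \<delta>_in \<delta>_out \<epsilon> :: real
    and G0 :: "('a::infinite, 'b::infinite) pre_digraph"
    and d :: "nat \<Rightarrow> nat"
  assumes "0 \<le> \<alpha>" "0 \<le> \<beta>" "0 \<le> \<gamma>" "\<alpha> + \<beta> + \<gamma> = 1"
    and "0 \<le> \<delta>_in" "0 \<le> \<delta>_out"
    and "fin_digraph G0" "verts G0 \<noteq> {}"
    and "\<delta>_in = 0 \<or> \<delta>_out = 0 \<Longrightarrow> arcs G0 \<noteq> {}"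
    and "\<alpha> + \<gamma> > 0"
    and "\<alpha> + \<beta> > 0" "\<gamma> + \<delta>_in > 0"
    and "\<epsilon> > 0"
  shows "(\<lambda>t. measure_pmf.prob (random_graph \<alpha> \<beta> \<gamma> \<delta>_in \<delta>_out G0 t)
            {G. \<bar>real (n_in G (d t)) - f_bar \<alpha> \<gamma> \<delta>_in (d t) * real t\<bar>
                \<le> (sqrt (f_bar \<alpha> \<gamma> \<delta>_in (d t) * real t)
                     + (real (d t) + 1) powr (- 1 / 2 + \<epsilon>)) * ln (real t)})
         \<longlonglongrightarrow> 1"
proof -
  have "0 < real (card (arcs G0)) + \<delta>_in * real (card (verts G0))"
    using assms by (intro total_weight_pos) auto
  then interpret graph_process \<alpha> \<beta> \<gamma> \<delta>_in G0 \<delta>_out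
    using assms by (intro graph_process.intro attachment.intro graph_process_axioms.intro) auto
  let ?t0 = "card (arcs G0)"
  let ?P = "\<lambda>t. measure_pmf.prob (random_graph \<alpha> \<beta> \<gamma> \<delta>_in \<delta>_out G0 t)"
  let ?good = "\<lambda>t. {G. \<bar>real (n_in G (d t)) - f_bar \<alpha> \<gamma> \<delta>_in (d t) * real t\<bar>
                \<le> (sqrt (f_bar \<alpha> \<gamma> \<delta>_in (d t) * real t)
                     + (real (d t) + 1) powr (- 1 / 2 + \<epsilon>)) * ln (real t)}"
  have good: "?P t (?good t) = 1 - ?P t (atypical_graphs \<epsilon> (d t) t)" for t
  proof -
    have "?good t = space (measure_pmf (random_graph \<alpha> \<beta> \<gamma> \<delta>_in \<delta>_out G0 t)) - atypical_graphs \<epsilon> (d t) t"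
      by (auto simp: atypical_graphs_def f_def)
    then show ?thesis by (simp only: measure_pmf.prob_compl sets_measure_pmf UNIV_I)
  qed
  \<comment> \<open>The process starts at time \<open>t0\<close>, so the limit is taken in the
    number of steps, with \<open>d\<close> shifted accordingly.\<close>
  have "(\<lambda>N. 1 - ?P (N + ?t0) (atypical_graphs \<epsilon> (d (N + ?t0)) (N + ?t0))) \<longlonglongrightarrow> 1 - 0"
    using prob_atypical_tendsto_0[of \<epsilon> "\<lambda>N. d (N + ?t0)"]
    by (intro tendsto_diff tendsto_const) (simp add: add.commute)
  then have "(\<lambda>N. ?P (N + ?t0) (?good (N + ?t0))) \<longlonglongrightarrow> 1"
    by (simp only: good diff_zero)
  then show ?thesis by (rule LIMSEQ_offset)
qed

end
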